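(* Let $(M,\varphi)$ be an integrable $G_2$ manifold with characteristic connection $\nabla$, torsion 3-form $T$ and Lee form $\theta$. The following conditions are equivalent: a) The torsion is closed, $dT=0$; b) The characteristic Ricci tensor is given by $Ric=-\nabla\theta$, i.e. $Ric_{ij}=-\nabla_i\theta_j$. In particular, an integrable $G_2$ structure with closed torsion is of constant type, $d\lambda=0$, where $\lambda=\frac16(d\varphi,*\varphi)$.
   Context: Manifolds are connected. A $G_2$ structure on a smooth 7-manifold $M$ is a 3-form $\varphi$ which near each point has, in a suitable local coframe $e_1,\dots,e_7$, the form $\varphi=e_{127}+e_{135}-e_{146}-e_{236}-e_{245}+e_{347}+e_{567}$, where $e_{ijk}=e_i\wedge e_j\wedge e_k$. It determines a Riemannian metric $g$ and an orientation for which such coframes are oriented orthonormal; $*$ is the Hodge star and $\nabla^g$ the Levi-Civita connection. $(d\varphi,*\varphi)$ is the pointwise scalar product of 4-forms, so $d\varphi\wedge\varphi=(d\varphi,*\varphi)\,vol$. Components are taken in local orthonormal frames. The Lee form is $\theta=-\frac13*( *d\varphi\wedge\varphi)$. The $G_2$ structure is integrable if $d{*}\varphi=\theta\wedge{*}\varphi$; it is then of constant type if the function $(d\varphi,*\varphi)$ is constant. On an integrable $G_2$ manifold there is a unique metric connection $\nabla$ with $\nabla\varphi=0$ whose torsion $T(X,Y,Z)=g(\nabla_XY-\nabla_YX-[X,Y],Z)$ is a 3-form (the characteristic connection); $g(\nabla_XY,Z)=g(\nabla^g_XY,Z)+\frac12T(X,Y,Z)$ and $T=-*d\varphi+*(\theta\wedge\varphi)+\frac16(d\varphi,*\varphi)\varphi$.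 Curvature of $\nabla$: $R(X,Y)Z=[\nabla_X,\nabla_Y]Z-\nabla_{[X,Y]}Z$, $R(X,Y,Z,V)=g(R(X,Y)Z,V)$, characteristic Ricci tensor $Ric(X,Y)=\sum_iR(e_i,X,Y,e_i)$; $\nabla_i\theta_j=(\nabla_{e_i}\theta)(e_j)$. *)

theory Defs
  imports "HOL-Analysis.Analysis"
begin

section \<open>Smooth maps between open subsets of normed spaces\<close>

primrec Ck_on :: "nat \<Rightarrow> 'a::real_normed_vector set \<Rightarrow> ('a \<Rightarrow> 'b::real_normed_vector) \<Rightarrow> bool" where
  "Ck_on 0 S f \<longleftrightarrow> continuous_on S f"
| "Ck_on (Suc k) S f \<longleftrightarrow>
     (\<forall>x\<in>S. f differentiable (at x)) \<and>
     (\<forall>v. Ck_on k S (\<lambda>x. frechet_derivative f (at x) v))"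

text \<open>Only meaningful for open \<open>S\<close>: derivatives are taken in full neighbourhoods.\<close>

definition smooth_on :: "'a::real_normed_vector set \<Rightarrow> ('a \<Rightarrow> 'b::real_normed_vector) \<Rightarrow> bool" where
  "smooth_on S f \<longleftrightarrow> (\<forall>k. Ck_on k S f)"


section \<open>Connected smooth 7-manifolds\<close>

text \<open>The manifold is the whole of a topological type (Hausdorff and second countable through
  its sort). A chart is a pair of a domain and a coordinate map. The smooth structure is given by
  an atlas, which need not be maximal.\<close>

type_synonym coord = "real ^ 7"
type_synonym 'a chart = "'a set \<times> ('a \<Rightarrow> coord)"

definition chart_image :: "'a chart \<Rightarrow> coord set" where
  "chart_image c = snd c ` fst c"

definition overlap :: "'a chart \<Rightarrow> 'a chart \<Rightarrow> coord set" where
  "overlap c c' = snd c ` (fst c \<inter> fst c')"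

definition transition :: "'a chart \<Rightarrow> 'a chart \<Rightarrow> coord \<Rightarrow> coord" where
  "transition c c' = snd c' \<circ> inv_into (fst c) (snd c)"

definition smooth_manifold :: "'a::{t2_space,second_countable_topology} chart set \<Rightarrow> bool" where
  "smooth_manifold A \<longleftrightarrow>
     connected (UNIV :: 'a set) \<and>
     (\<Union>c\<in>A. fst c) = UNIV \<and>
     (\<forall>c\<in>A. open (fst c) \<and> open (chart_image c) \<and>
        (\<exists>h. homeomorphism (fst c) (chart_image c) (snd c) h)) \<and>
     (\<forall>c\<in>A. \<forall>c'\<in>A. smooth_on (overlap c c') (transition c c'))"


section \<open>Exterior algebra of a 7-dimensional vector space\<close>

text \<open>A \<open>k\<close>-form is a function on lists of vectors, of which only the values on lists of
  length \<open>k\<close> matter.\<close>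

type_synonym form = "coord list \<Rightarrow> real"

definition is_form :: "nat \<Rightarrow> form \<Rightarrow> bool" where
  "is_form k \<omega> \<longleftrightarrow>
     (\<forall>vs. length vs = k \<longrightarrow>
        (\<forall>i<k. linear (\<lambda>v. \<omega> (vs[i := v]))) \<and>
        (\<forall>i<k. \<forall>j<k. i \<noteq> j \<and> vs ! i = vs ! j \<longrightarrow> \<omega> vs = 0))"

text \<open>Wedge product of a \<open>p\<close>-form with a form of arbitrary degree, as a sum over
  \<open>p\<close>-shuffles; the set \<open>S\<close> holds the positions of the arguments passed to the first factor.
  The normalisation is \<open>(\<alpha> \<and> \<beta>)(u, v) = \<alpha>(u) \<beta>(v) - \<alpha>(v) \<beta>(u)\<close> for 1-forms.\<close>

definition wedge :: "nat \<Rightarrow> form \<Rightarrow> form \<Rightarrow> form" where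
  "wedge p \<alpha> \<beta> vs =
     (\<Sum>S | S \<subseteq> {..<length vs} \<and> card S = p.
        (- 1) ^ card {(i, j). i \<in> S \<and> j \<in> {..<length vs} - S \<and> j < i} *
        \<alpha> (nths vs S) * \<beta> (nths vs (- S)))"

text \<open>\<open>\<alpha>\<^sub>1 \<and> \<dots> \<and> \<alpha>\<^sub>m\<close> for 1-forms.\<close>

fun wedge_list :: "form list \<Rightarrow> form" where
  "wedge_list [] = (\<lambda>vs. 1)"
| "wedge_list (\<alpha> # \<alpha>s) = wedge 1 \<alpha> (wedge_list \<alpha>s)"

definition orthonormal :: "(coord \<Rightarrow> coord \<Rightarrow> real) \<Rightarrow> (nat \<Rightarrow> coord) \<Rightarrow> bool" where
  "orthonormal g E \<longleftrightarrow> (\<forall>i\<in>{1..7}. \<forall>j\<in>{1..7}. g (E i) (E j) = (if i = j then 1 else 0))"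

text \<open>The quantities below that are computed in this frame do not depend on the choice.\<close>

definition frame :: "(coord \<Rightarrow> coord \<Rightarrow> real) \<Rightarrow> nat \<Rightarrow> coord" where
  "frame g = (SOME E. orthonormal g E)"

definition subframe :: "(coord \<Rightarrow> coord \<Rightarrow> real) \<Rightarrow> nat set \<Rightarrow> coord list" where
  "subframe g S = map (frame g) (sorted_list_of_set S)"

text \<open>Scalar product of \<open>k\<close>-forms for which the \<open>e\<^sub>I\<close> with \<open>I\<close> increasing are orthonormal.\<close>

definition form_inner :: "(coord \<Rightarrow> coord \<Rightarrow> real) \<Rightarrow> nat \<Rightarrow> form \<Rightarrow> form \<Rightarrow> real" where
  "form_inner g k \<alpha> \<beta> =
     (\<Sum>S | S \<subseteq> {1..7} \<and> card S = k. \<alpha> (subframe g S) * \<beta> (subframe g S))"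

text \<open>Hodge star, normalised by \<open>\<alpha> \<and> \<star>\<beta> = (\<alpha>, \<beta>) vol\<close>: contraction of \<open>\<omega>\<close> with the first
  arguments of the volume form. The degree of \<open>\<omega>\<close> is read off from the number of arguments.
  The frame need not be oriented, since each frame vector enters each summand twice or not at all.\<close>

definition hodge :: "(coord \<Rightarrow> coord \<Rightarrow> real) \<Rightarrow> form \<Rightarrow> form \<Rightarrow> form" where
  "hodge g vol \<omega> vs =
     (\<Sum>S | S \<subseteq> {1..7} \<and> card S = 7 - length vs.
        \<omega> (subframe g S) * vol (subframe g S @ vs))"


section \<open>Pointwise \<open>G\<^sub>2\<close> structures\<close>

definition g2_coframe :: "form \<Rightarrow> (nat \<Rightarrow> form) \<Rightarrow> bool" where
  "g2_coframe P e \<longleftrightarrow>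
     (\<forall>i\<in>{1..7}. is_form 1 (e i)) \<and>
     (\<forall>a :: nat \<Rightarrow> real. (\<forall>v. (\<Sum>i=1..7. a i * e i [v]) = 0) \<longrightarrow> (\<forall>i\<in>{1..7}. a i = 0)) \<and>
     (\<forall>vs. length vs = 3 \<longrightarrow>
        (let e3 = (\<lambda>i j k. wedge_list [e i, e j, e k] vs) in
         P vs = e3 1 2 7 + e3 1 3 5 - e3 1 4 6 - e3 2 3 6 - e3 2 4 5 + e3 3 4 7 + e3 5 6 7))"

text \<open>Any two coframes adapted to the same 3-form differ by an element of \<open>G\<^sub>2 \<subseteq> SO(7)\<close>, so the
  metric and the volume form are independent of the choice made here.\<close>

definition adapted_coframe :: "form \<Rightarrow> nat \<Rightarrow> form" where
  "adapted_coframe P = (SOME e. g2_coframe P e)"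

definition g2_metric :: "form \<Rightarrow> coord \<Rightarrow> coord \<Rightarrow> real" where
  "g2_metric P u v = (\<Sum>i=1..7. adapted_coframe P i [u] * adapted_coframe P i [v])"

definition g2_vol :: "form \<Rightarrow> form" where
  "g2_vol P = wedge_list (map (adapted_coframe P) [1..<8])"


section \<open>Tensor calculus in a chart\<close>

text \<open>The functions of this section act on coordinate representations over an open subset of
  \<open>\<real>\<^sup>7\<close>. A connection is represented by its Christoffel symbols \<open>\<Gamma> x u v\<close>, with \<open>u\<close> the
  direction of differentiation.\<close>

type_synonym form_field = "coord \<Rightarrow> form"
type_synonym vector_field = "coord \<Rightarrow> coord"
type_synonym christoffel = "coord \<Rightarrow> coord \<Rightarrow> coord \<Rightarrow> coord"

definition ext_d :: "form_field \<Rightarrow> form_field" where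
  "ext_d \<omega> x vs =
     (\<Sum>i<length vs. (- 1) ^ i *
        frechet_derivative (\<lambda>y. \<omega> y (take i vs @ drop (Suc i) vs)) (at x) (vs ! i))"

definition lie_bracket :: "vector_field \<Rightarrow> vector_field \<Rightarrow> vector_field" where
  "lie_bracket X Y x =
     frechet_derivative Y (at x) (X x) - frechet_derivative X (at x) (Y x)"

definition nabla_vec :: "christoffel \<Rightarrow> vector_field \<Rightarrow> vector_field \<Rightarrow> vector_field" where
  "nabla_vec \<Gamma> X Y x = frechet_derivative Y (at x) (X x) + \<Gamma> x (X x) (Y x)"

text \<open>Covariant derivative \<open>(\<nabla>\<^sub>u \<omega>)(vs)\<close> of a covariant tensor field, alternating or not.\<close>

definition nabla_form :: "christoffel \<Rightarrow> form_field \<Rightarrow> coord \<Rightarrow> coord \<Rightarrow> form" where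
  "nabla_form \<Gamma> \<omega> x u vs =
     frechet_derivative (\<lambda>y. \<omega> y vs) (at x) u -
     (\<Sum>i<length vs. \<omega> x (vs[i := \<Gamma> x u (vs ! i)]))"

definition curvature ::
  "christoffel \<Rightarrow> vector_field \<Rightarrow> vector_field \<Rightarrow> vector_field \<Rightarrow> vector_field" where
  "curvature \<Gamma> X Y Z x =
     nabla_vec \<Gamma> X (nabla_vec \<Gamma> Y Z) x - nabla_vec \<Gamma> Y (nabla_vec \<Gamma> X Z) x -
     nabla_vec \<Gamma> (lie_bracket X Y) Z x"

definition metric :: "form_field \<Rightarrow> coord \<Rightarrow> coord \<Rightarrow> coord \<Rightarrow> real" where
  "metric \<phi> x = g2_metric (\<phi> x)"

definition star :: "form_field \<Rightarrow> form_field \<Rightarrow> form_field" where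
  "star \<phi> \<omega> x = hodge (metric \<phi> x) (g2_vol (\<phi> x)) (\<omega> x)"

text \<open>\<open>\<theta> = -1/3 \<star>(\<star>d\<phi> \<and> \<phi>)\<close>: the 6-form \<open>(\<star>d\<phi>) \<and> \<phi>\<close> is turned into a 1-form by the outer star.\<close>

definition lee_form :: "form_field \<Rightarrow> form_field" where
  "lee_form \<phi> x vs =
     - (1 / 3) * star \<phi> (\<lambda>y. wedge 3 (star \<phi> (ext_d \<phi>) y) (\<phi> y)) x vs"

text \<open>The function \<open>(d\<phi>, \<star>\<phi>)\<close>.\<close>

definition dphi_sphi :: "form_field \<Rightarrow> coord \<Rightarrow> real" where
  "dphi_sphi \<phi> x = form_inner (metric \<phi> x) 4 (ext_d \<phi> x) (star \<phi> \<phi> x)"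

definition lam :: "form_field \<Rightarrow> form_field" where
  "lam \<phi> x vs = dphi_sphi \<phi> x / 6"

text \<open>Torsion and Ricci tensor are tensorial, so tangent vectors are extended to vector fields
  with constant coefficients in the chart.\<close>

definition torsion :: "form_field \<Rightarrow> christoffel \<Rightarrow> form_field" where
  "torsion \<phi> \<Gamma> x vs =
     (let X = (\<lambda>_. vs ! 0); Y = (\<lambda>_. vs ! 1) in
      metric \<phi> x (nabla_vec \<Gamma> X Y x - nabla_vec \<Gamma> Y X x - lie_bracket X Y x) (vs ! 2))"

definition ricci :: "form_field \<Rightarrow> christoffel \<Rightarrow> coord \<Rightarrow> coord \<Rightarrow> coord \<Rightarrow> real" where
  "ricci \<phi> \<Gamma> x u v =
     (let E = frame (metric \<phi> x) in
      \<Sum>i=1..7. metric \<phi> x (curvature \<Gamma> (\<lambda>_. E i) (\<lambda>_. u) (\<lambda>_. v) x) (E i))"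


section \<open>Global objects on the manifold\<close>

text \<open>Tensor fields and connections on the manifold are families of coordinate representations,
  indexed by the charts of the atlas and related by the usual transformation laws.\<close>

definition differential_form ::
  "'a chart set \<Rightarrow> nat \<Rightarrow> ('a chart \<Rightarrow> form_field) \<Rightarrow> bool" where
  "differential_form A k \<omega> \<longleftrightarrow>
     (\<forall>c\<in>A. \<forall>x\<in>chart_image c. is_form k (\<omega> c x)) \<and>
     (\<forall>c\<in>A. \<forall>vs. length vs = k \<longrightarrow> smooth_on (chart_image c) (\<lambda>x. \<omega> c x vs)) \<and>
     (\<forall>c\<in>A. \<forall>c'\<in>A. \<forall>x\<in>overlap c c'. \<forall>vs. length vs = k \<longrightarrow>
        \<omega> c x vs =
        \<omega> c' (transition c c' x) (map (frechet_derivative (transition c c') (at x)) vs))"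

definition vanishes :: "'a chart set \<Rightarrow> nat \<Rightarrow> ('a chart \<Rightarrow> form_field) \<Rightarrow> bool" where
  "vanishes A k \<omega> \<longleftrightarrow>
     (\<forall>c\<in>A. \<forall>x\<in>chart_image c. \<forall>vs. length vs = k \<longrightarrow> \<omega> c x vs = 0)"

definition g2_structure :: "'a chart set \<Rightarrow> ('a chart \<Rightarrow> form_field) \<Rightarrow> bool" where
  "g2_structure A \<phi> \<longleftrightarrow>
     differential_form A 3 \<phi> \<and>
     (\<forall>c\<in>A. \<forall>x\<in>chart_image c. \<exists>V e.
        open V \<and> x \<in> V \<and> V \<subseteq> chart_image c \<and>
        (\<forall>i\<in>{1..7}. \<forall>v. smooth_on V (\<lambda>y. e y i [v])) \<and>
        (\<forall>y\<in>V. g2_coframe (\<phi> c y) (e y)))"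

definition integrable_g2 :: "'a chart set \<Rightarrow> ('a chart \<Rightarrow> form_field) \<Rightarrow> bool" where
  "integrable_g2 A \<phi> \<longleftrightarrow>
     g2_structure A \<phi> \<and>
     (\<forall>c\<in>A. \<forall>x\<in>chart_image c. \<forall>vs. length vs = 5 \<longrightarrow>
        ext_d (star (\<phi> c) (\<phi> c)) x vs =
        wedge 1 (lee_form (\<phi> c) x) (star (\<phi> c) (\<phi> c) x) vs)"

definition constant_type :: "'a chart set \<Rightarrow> ('a chart \<Rightarrow> form_field) \<Rightarrow> bool" where
  "constant_type A \<phi> \<longleftrightarrow> (\<exists>k. \<forall>c\<in>A. \<forall>x\<in>chart_image c. dphi_sphi (\<phi> c) x = k)"

definition affine_connection :: "'a chart set \<Rightarrow> ('a chart \<Rightarrow> christoffel) \<Rightarrow> bool" where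
  "affine_connection A \<Gamma> \<longleftrightarrow>
     (\<forall>c\<in>A. \<forall>x\<in>chart_image c. bilinear (\<Gamma> c x)) \<and>
     (\<forall>c\<in>A. \<forall>u v. smooth_on (chart_image c) (\<lambda>x. \<Gamma> c x u v)) \<and>
     (\<forall>c\<in>A. \<forall>c'\<in>A. \<forall>x\<in>overlap c c'. \<forall>u v.
        (let \<tau> = transition c c'; D = (\<lambda>y. frechet_derivative \<tau> (at y)) in
         D x (\<Gamma> c x u v) =
         frechet_derivative (\<lambda>y. D y v) (at x) u + \<Gamma> c' (\<tau> x) (D x u) (D x v)))"

definition characteristic_connection ::
  "'a chart set \<Rightarrow> ('a chart \<Rightarrow> form_field) \<Rightarrow> ('a chart \<Rightarrow> christoffel) \<Rightarrow> bool" where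
  "characteristic_connection A \<phi> \<Gamma> \<longleftrightarrow>
     affine_connection A \<Gamma> \<and>
     (\<forall>c\<in>A. \<forall>x\<in>chart_image c. \<forall>u.
        (\<forall>v w. nabla_form (\<Gamma> c) (\<lambda>y vs. metric (\<phi> c) y (vs ! 0) (vs ! 1)) x u [v, w] = 0) \<and>
        (\<forall>vs. length vs = 3 \<longrightarrow> nabla_form (\<Gamma> c) (\<phi> c) x u vs = 0)) \<and>
     (\<forall>c\<in>A. \<forall>x\<in>chart_image c. is_form 3 (torsion (\<phi> c) (\<Gamma> c) x))"

definition closed_torsion ::
  "'a chart set \<Rightarrow> ('a chart \<Rightarrow> form_field) \<Rightarrow> ('a chart \<Rightarrow> christoffel) \<Rightarrow> bool" where
  "closed_torsion A \<phi> \<Gamma> \<longleftrightarrow> vanishes A 4 (\<lambda>c. ext_d (torsion (\<phi> c) (\<Gamma> c)))"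

end

theory Submission
  imports Defs
begin

text \<open>
  In a frame adapted to \<open>\<phi>\<close>, parallelism of \<open>\<phi>\<close> makes \<open>d\<phi>\<close>, hence \<open>\<theta>\<close> and \<open>\<lambda>\<close>, linear in the
  torsion: \<open>6 \<theta>\<^sub>d = \<Sum> T\<^sub>a\<^sub>b\<^sub>c \<phi>\<^sub>a\<^sub>b\<^sub>m \<phi>\<^sub>m\<^sub>c\<^sub>d\<close> and \<open>6 \<lambda> = \<Sum> T\<^sub>a\<^sub>b\<^sub>c \<phi>\<^sub>a\<^sub>b\<^sub>c\<close>. The Bianchi identity for skew
  torsion gives \<open>R\<^sub>i\<^sub>a\<^sub>b\<^sub>c + R\<^sub>i\<^sub>b\<^sub>c\<^sub>a + R\<^sub>i\<^sub>c\<^sub>a\<^sub>b = 1/2 dT\<^sub>i\<^sub>a\<^sub>b\<^sub>c + \<nabla>\<^sub>i T\<^sub>a\<^sub>b\<^sub>c\<close>. As the curvature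
  takes values in the Lie algebra of \<open>G\<^sub>2\<close>, applying the two contractions above to this identity yields
  \<open>Ric\<^sub>i\<^sub>d = - \<nabla>\<^sub>i \<theta>\<^sub>d - 1/12 \<Sum> dT\<^sub>i\<^sub>a\<^sub>b\<^sub>c \<phi>\<^sub>a\<^sub>b\<^sub>m \<phi>\<^sub>m\<^sub>c\<^sub>d\<close> and \<open>\<Sum> (dT\<^sub>i\<^sub>a\<^sub>b\<^sub>c + 2 \<nabla>\<^sub>i T\<^sub>a\<^sub>b\<^sub>c) \<phi>\<^sub>a\<^sub>b\<^sub>c = 0\<close>.
  The first contraction is injective on 4-forms, which gives the equivalence; the second formula shows
  that \<open>d\<lambda> = 0\<close> when \<open>dT = 0\<close>.
\<close>

section \<open>Alternating forms\<close>

text \<open>Metric, volume form and frame are picked by SOME at each point, so neither regularity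
  nor invariance comes with the definitions. The expression (\<iota>_u P) \<and> (\<iota>_v P)
  \<and> P = 6 g(u,v) vol depends on P alone and ties all coframes of P to one metric and one volume
  form. Every quantity can then be computed in the frame dual to the differentiable coframe of
  \<open>g2_structure\<close>, where \<phi> has constant components. Such a frame need not be
  parallel, but its covariant derivative is a skew matrix and cancels in every contracted index. So
  \<nabla> passes through the contractions that define \<theta> and \<lambda> and, as \<nabla>\<phi>
  = 0, falls on T alone. What remains is linear algebra with the signs of \<open>phi0\<close>:
  curvature in the Lie algebra of G_2 means seven relations on a skew matrix, and the injectivity
  claim amounts to 49 equations that decouple into small systems for 35 components. Zero derivative
  of \<lambda> in each chart gives a constant only once (d\<phi>, \<star>\<phi>) is known to agree
  across charts; this is shown by transporting adapted frames and the torsion.\<close>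

lemma is_formD_linear:
  "is_form k \<omega> \<Longrightarrow> length vs = k \<Longrightarrow> i < k \<Longrightarrow> linear (\<lambda>v. \<omega> (vs[i := v]))"
  by (simp add: is_form_def)

lemma is_formD_alt:
  "is_form k \<omega> \<Longrightarrow> length vs = k \<Longrightarrow> i < k \<Longrightarrow> j < k \<Longrightarrow> i \<noteq> j \<Longrightarrow> vs ! i = vs ! j \<Longrightarrow> \<omega> vs = 0"
  unfolding is_form_def by blast

lemma is_form_cong:
  assumes "is_form k \<eta>" "\<And>vs. length vs = k \<Longrightarrow> \<omega> vs = \<eta> vs"
  shows "is_form k \<omega>"
  using assms by (simp add: is_form_def)

lemma is_form_0 [simp]: "is_form 0 \<omega>"
  by (simp add: is_form_def)

lemma is_form_1_iff: "is_form (Suc 0) \<omega> \<longleftrightarrow> linear (\<lambda>v. \<omega> [v])"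
proof
  assume "is_form (Suc 0) \<omega>"
  from is_formD_linear[OF this, of "[0]" 0] show "linear (\<lambda>v. \<omega> [v])" by simp
next
  assume l: "linear (\<lambda>v. \<omega> [v])"
  have "linear (\<lambda>v. \<omega> (vs[0 := v]))" if "length vs = Suc 0" for vs
    using l that by (cases vs) auto
  then show "is_form (Suc 0) \<omega>" by (simp add: is_form_def)
qed

lemma is_form_Cons:
  assumes "is_form (Suc k) \<omega>"
  shows "is_form k (\<lambda>vs. \<omega> (v # vs))"
  unfolding is_form_def
proof (intro allI impI conjI)
  fix vs :: "coord list" and i assume "length vs = k" "i < k"
  then show "linear (\<lambda>u. \<omega> (v # vs[i := u]))"
    using is_formD_linear[OF assms, of "v # vs" "Suc i"] by simp
next
  fix vs :: "coord list" and i j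
  assume "length vs = k" "i < k" "j < k" "i \<noteq> j \<and> vs ! i = vs ! j"
  then show "\<omega> (v # vs) = 0"
    using is_formD_alt[OF assms, of "v # vs" "Suc i" "Suc j"] by simp
qed

lemma is_form_append:
  "is_form (length us + k) \<omega> \<Longrightarrow> is_form k (\<lambda>vs. \<omega> (us @ vs))"
proof (induction us arbitrary: \<omega>)
  case (Cons u us)
  then have "is_form (length us + k) (\<lambda>vs. \<omega> (u # vs))"
    by (simp add: is_form_Cons)
  from Cons.IH[OF this] show ?case by simp
qed simp

lemma is_form_append_right:
  assumes "is_form (k + length us) \<omega>"
  shows "is_form k (\<lambda>vs. \<omega> (vs @ us))"
  unfolding is_form_def
proof (intro allI impI conjI)
  fix vs :: "coord list" and i assume "length vs = k" "i < k"
  then show "linear (\<lambda>u. \<omega> (vs[i := u] @ us))"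
    using is_formD_linear[OF assms, of "vs @ us" i] by (simp add: list_update_append)
next
  fix vs :: "coord list" and i j
  assume "length vs = k" "i < k" "j < k" "i \<noteq> j \<and> vs ! i = vs ! j"
  then show "\<omega> (vs @ us) = 0"
    using is_formD_alt[OF assms, of "vs @ us" i j] by (simp add: nth_append)
qed

lemma is_form_linear_hd:
  assumes "is_form (Suc k) \<omega>" "length vs = k"
  shows "linear (\<lambda>v. \<omega> (v # vs))"
  using is_formD_linear[OF assms(1), of "0 # vs" 0] assms(2) by simp

lemma is_form_same_hd:
  assumes "is_form (Suc (Suc k)) \<omega>" "length vs = k"
  shows "\<omega> (v # v # vs) = 0"
  using is_formD_alt[OF assms(1), of "v # v # vs" 0 1] assms(2) by simp

lemma is_form_swap:
  assumes "is_form k \<omega>" "length (xs @ a # b # ys) = k"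
  shows "\<omega> (xs @ b # a # ys) = - \<omega> (xs @ a # b # ys)"
proof -
  define F where "F u v = \<omega> (xs @ u # v # ys)" for u v
  have 1: "linear (\<lambda>u. F u v)" for v
    using is_formD_linear[OF assms(1), of "xs @ a # v # ys" "length xs"] assms(2)
    by (simp add: F_def)
  have 2: "linear (\<lambda>v. F u v)" for u
    using is_formD_linear[OF assms(1), of "(xs @ [u]) @ a # ys" "length (xs @ [u])"] assms(2)
    unfolding F_def list_update_length by simp
  have 0: "F u u = 0" for u
    unfolding F_def
    by (rule is_formD_alt[OF assms(1), of _ "length xs" "Suc (length xs)"])
       (use assms(2) in \<open>auto simp: nth_append\<close>)
  have "F (a + b) (a + b) = F a a + F a b + F b a + F b b"
    by (simp add: linear_add[OF 1] linear_add[OF 2])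
  then show ?thesis by (simp add: 0 F_def)
qed

lemma is_form_move:
  assumes "is_form k \<omega>" "length (xs @ v # ys) = k"
  shows "\<omega> (xs @ v # ys) = (- 1) ^ length xs * \<omega> (v # xs @ ys)"
  using assms(2)
proof (induction xs arbitrary: ys rule: rev_induct)
  case (snoc x xs)
  have "\<omega> ((xs @ [x]) @ v # ys) = - \<omega> (xs @ v # x # ys)"
    using is_form_swap[OF assms(1), of xs v x ys] snoc.prems by simp
  also have "\<dots> = - ((- 1) ^ length xs * \<omega> (v # xs @ x # ys))"
    using snoc.IH[of "x # ys"] snoc.prems by simp
  finally show ?case by simp
qed simp

text \<open>For inductions on the degree: alternation has to be checked for two equal leading
  arguments only. A later argument equal to the head is brought to second place by
  \<open>is_form_move\<close>, applied to the form with the head fixed.\<close>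

lemma is_formI_Cons:
  assumes f: "\<And>v. is_form k (\<lambda>vs. \<omega> (v # vs))"
    and l: "\<And>vs. length vs = k \<Longrightarrow> linear (\<lambda>v. \<omega> (v # vs))"
    and a: "\<And>v vs. Suc (length vs) = k \<Longrightarrow> \<omega> (v # v # vs) = 0"
  shows "is_form (Suc k) \<omega>"
proof -
  have alt: "\<omega> (v # ws) = 0" if "length ws = k" "m < k" "ws ! m = v" for v ws m
  proof -
    have ws: "ws = take m ws @ v # drop (Suc m) ws"
      using that by (metis id_take_nth_drop)
    have "\<omega> (v # take m ws @ v # drop (Suc m) ws) =
        (- 1) ^ length (take m ws) * \<omega> (v # v # take m ws @ drop (Suc m) ws)"
      by (rule is_form_move[OF f]) (use that in simp)
    also have "\<dots> = 0" using a[of "take m ws @ drop (Suc m) ws"] that by simp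
    finally show ?thesis using ws by simp
  qed
  show ?thesis
    unfolding is_form_def
  proof (intro allI impI conjI)
    fix vs :: "coord list" and i assume *: "length vs = Suc k" "i < Suc k"
    then obtain v ws where vs: "vs = v # ws" "length ws = k" by (cases vs) auto
    show "linear (\<lambda>u. \<omega> (vs[i := u]))"
      using * vs l is_formD_linear[OF f, of ws _ v] by (cases i) auto
  next
    fix vs :: "coord list" and i j
    assume *: "length vs = Suc k" "i < Suc k" "j < Suc k" "i \<noteq> j \<and> vs ! i = vs ! j"
    then obtain v ws where vs: "vs = v # ws" "length ws = k" by (cases vs) auto
    show "\<omega> vs = 0"
    proof (cases i)
      case 0
      then show ?thesis using * vs alt[of ws "j - 1" v] by (cases j) auto
    next
      case (Suc i')
      then show ?thesis
        using * vs alt[of ws i' v] is_formD_alt[OF f, of ws i' "j - 1" v] by (cases j) auto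
    qed
  qed
qed

lemma is_form_zero: "is_form k (\<lambda>vs. 0)"
  by (simp add: is_form_def linear_iff)

lemma is_form_add: "is_form k \<omega> \<Longrightarrow> is_form k \<eta> \<Longrightarrow> is_form k (\<lambda>vs. \<omega> vs + \<eta> vs)"
  unfolding is_form_def by (auto intro!: linear_compose_add)

lemma is_form_scale: "is_form k \<omega> \<Longrightarrow> is_form k (\<lambda>vs. c * \<omega> vs)"
  unfolding is_form_def by (auto simp: linear_iff algebra_simps)

lemma is_form_diff: "is_form k \<omega> \<Longrightarrow> is_form k \<eta> \<Longrightarrow> is_form k (\<lambda>vs. \<omega> vs - \<eta> vs)"
  unfolding is_form_def by (auto intro!: linear_compose_sub)

lemma is_form_sum: "(\<And>i. i \<in> I \<Longrightarrow> is_form k (\<omega> i)) \<Longrightarrow> is_form k (\<lambda>vs. \<Sum>i\<in>I. \<omega> i vs)"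
  by (induction I rule: infinite_finite_induct) (auto intro: is_form_zero is_form_add)

lemma linear_real_sum: "(\<And>i. i \<in> I \<Longrightarrow> linear (f i)) \<Longrightarrow> linear (\<lambda>v. \<Sum>i\<in>I. f i v :: real)"
  by (rule linear_compose_sum) auto

lemma linear_real_scale: "linear f \<Longrightarrow> linear (\<lambda>v. c * f v :: real)"
  by (auto simp: linear_iff algebra_simps)

text \<open>The sum in \<open>ext_d\<close> with the derivative abstracted to a family
  \<open>A u\<close> of forms; alternation can then be shown by a purely algebraic induction through
  \<open>alternate_Cons\<close>.\<close>

definition alternate :: "(coord \<Rightarrow> form) \<Rightarrow> form" where
  "alternate A vs = (\<Sum>i<length vs. (- 1) ^ i * A (vs ! i) (take i vs @ drop (Suc i) vs))"

lemma alternate_Nil [simp]: "alternate A [] = 0"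
  by (simp add: alternate_def)

lemma alternate_Cons: "alternate A (v # vs) = A v vs - alternate (\<lambda>u ws. A u (v # ws)) vs"
  unfolding alternate_def
  by (simp add: sum.lessThan_Suc_shift sum_negf[symmetric] del: sum.lessThan_Suc)

lemma alternate_cong:
  assumes "\<And>u ws. Suc (length ws) = length vs \<Longrightarrow> A u ws = B u ws"
  shows "alternate A vs = alternate B vs"
  unfolding alternate_def using assms by (intro sum.cong) auto

text \<open>On equal leading arguments the two terms that pass one of them to the direction slot
  cancel, and all others vanish because \<open>A u\<close> itself is alternating.\<close>

lemma is_form_alternate:
  assumes "\<And>u. is_form k (A u)" "\<And>vs. length vs = k \<Longrightarrow> linear (\<lambda>u. A u vs)"
  shows "is_form (Suc k) (alternate A)"
  using assms
proof (induction k arbitrary: A)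
  case 0
  then show ?case by (simp add: is_form_1_iff alternate_Cons)
next
  case (Suc k)
  show ?case
  proof (rule is_formI_Cons)
    fix v
    have "is_form (Suc k) (alternate (\<lambda>u ws. A u (v # ws)))"
      using Suc.prems by (intro Suc.IH) (auto intro: is_form_Cons)
    then show "is_form (Suc k) (\<lambda>vs. alternate A (v # vs))"
      unfolding alternate_Cons using Suc.prems by (intro is_form_diff) auto
  next
    fix vs :: "coord list" assume vs: "length vs = Suc k"
    have "linear (\<lambda>v. alternate (\<lambda>u ws. A u (v # ws)) vs)"
      unfolding alternate_def
      by (intro linear_real_sum linear_real_scale is_form_linear_hd[OF Suc.prems(1)])
         (use vs in auto)
    then show "linear (\<lambda>v. alternate A (v # vs))"
      unfolding alternate_Cons using Suc.prems(2) vs by (intro linear_compose_sub) auto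
  next
    fix v and vs :: "coord list" assume vs: "Suc (length vs) = Suc k"
    have "A u (v # v # ws) = 0" if "Suc (length ws) = length vs" for u ws
      using is_form_same_hd[of "length ws" "A u" ws v] Suc.prems(1)[of u] that vs by simp
    then have "alternate (\<lambda>u ws. A u (v # v # ws)) vs = alternate (\<lambda>u ws. 0) vs"
      by (intro alternate_cong) simp
    then show "alternate A (v # v # vs) = 0"
      by (simp add: alternate_Cons) (simp add: alternate_def)
  qed
qed

section \<open>Wedge products by recursion on the argument list\<close>

lemma wedge_0 [simp]: "wedge 0 \<alpha> \<beta> vs = \<alpha> [] * \<beta> vs"
proof -
  have "{S. S \<subseteq> {..<length vs} \<and> card S = 0} = {{}}"
    by (auto dest: finite_subset[OF _ finite_lessThan])
  then show ?thesis by (simp add: wedge_def nths_all)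
qed

lemma wedge_Suc_Nil [simp]: "wedge (Suc p) \<alpha> \<beta> [] = 0"
  by (auto simp: wedge_def intro!: sum.neutral)

lemma subset_lessThan_Suc_shift:
  "{S. S \<subseteq> {..<Suc n} \<and> card S = Suc p} =
     (\<lambda>S. insert 0 (Suc ` S)) ` {S. S \<subseteq> {..<n} \<and> card S = p} \<union>
     (`) Suc ` {S. S \<subseteq> {..<n} \<and> card S = Suc p}" (is "?L = ?A \<union> ?B")
proof (rule set_eqI, rule iffI)
  fix S assume "S \<in> ?L"
  then have S: "S \<subseteq> {..<Suc n}" "card S = Suc p" by auto
  then have fin: "finite S" using finite_subset by blast
  define S' where "S' = {i. Suc i \<in> S}"
  have S': "S' \<subseteq> {..<n}" using S(1) by (auto simp: S'_def)
  have im: "Suc ` S' = S - {0}" by (auto simp: S'_def image_iff) (metis not0_implies_Suc)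
  have "card S' = card (S - {0})" by (metis im card_image inj_Suc)
  show "S \<in> ?A \<union> ?B"
  proof (cases "0 \<in> S")
    case True
    then have "S = insert 0 (Suc ` S')" "card S' = p"
      using im \<open>card S' = card (S - {0})\<close> S(2) fin by auto
    then show ?thesis using S' by blast
  next
    case False
    then have "S = Suc ` S'" "card S' = Suc p"
      using im \<open>card S' = card (S - {0})\<close> S(2) fin by auto
    then show ?thesis using S' by blast
  qed
next
  fix S assume "S \<in> ?A \<union> ?B"
  then show "S \<in> ?L"
    by (auto simp: card_image finite_subset[OF _ finite_lessThan] card_insert_if)
qed

text \<open>The antiderivation rule \<iota>_v (\<alpha> \<and> \<beta>) = \<iota>_v \<alpha> \<and>
  \<beta> + (-1)^(p+1) \<alpha> \<and> \<iota>_v \<beta> for \<alpha> of degree p + 1. Shuffles are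
  split by whether v goes to \<alpha> or to \<beta>. Wedges on explicit frames are evaluated in this
  form.\<close>

lemma wedge_Suc_Cons:
  "wedge (Suc p) \<alpha> \<beta> (v # vs) =
     wedge p (\<lambda>ws. \<alpha> (v # ws)) \<beta> vs + (- 1) ^ Suc p * wedge (Suc p) \<alpha> (\<lambda>ws. \<beta> (v # ws)) vs"
proof -
  let ?n = "length vs"
  define I where "I n S = card {(i, j). i \<in> S \<and> j \<in> {..<n} - S \<and> j < i}" for n :: nat and S
  define W where "W S = (- 1) ^ I (Suc ?n) S * \<alpha> (nths (v # vs) S) * \<beta> (nths (v # vs) (- S))" for S
  let ?P = "\<lambda>p. {S. S \<subseteq> {..<?n} \<and> card S = p}"
  have I1: "I (Suc n) (insert 0 (Suc ` S)) = I n S" for n S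
  proof -
    have "{(i, j). i \<in> insert 0 (Suc ` S) \<and> j \<in> {..<Suc n} - insert 0 (Suc ` S) \<and> j < i} =
        map_prod Suc Suc ` {(i, j). i \<in> S \<and> j \<in> {..<n} - S \<and> j < i}" (is "?L = ?R")
    proof (rule set_eqI, rule iffI)
      fix z assume "z \<in> ?L"
      then obtain i j where z: "z = (Suc i, j)" "i \<in> S" "j < Suc n" "j \<noteq> 0" "j \<notin> Suc ` S" "j < Suc i"
        by auto
      then obtain j' where "j = Suc j'" by (cases j) auto
      then show "z \<in> ?R" using z by force
    qed auto
    then show ?thesis unfolding I_def by (simp add: card_image inj_on_def map_prod_def case_prod_unfold prod_eq_iff)
  qed
  \<comment> \<open>Position 0 now belongs to the second factor, and each element of S forms one new
    inversion with it; this is the origin of the sign (-1)^(p+1).\<close>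
  have I2: "I (Suc n) (Suc ` S) = card S + I n S" if "finite S" for n S
  proof -
    have eq: "{(i, j). i \<in> Suc ` S \<and> j \<in> {..<Suc n} - Suc ` S \<and> j < i} =
        (\<lambda>i. (Suc i, 0)) ` S \<union> map_prod Suc Suc ` {(i, j). i \<in> S \<and> j \<in> {..<n} - S \<and> j < i}"
      (is "?L = ?R1 \<union> ?R2")
    proof (rule set_eqI, rule iffI)
      fix z assume "z \<in> ?L"
      then obtain i j where z: "z = (Suc i, j)" "i \<in> S" "j < Suc n" "j \<notin> Suc ` S" "j < Suc i"
        by auto
      show "z \<in> ?R1 \<union> ?R2"
      proof (cases j)
        case (Suc j')
        then have "z = map_prod Suc Suc (i, j')" "(i, j') \<in> {(i, j). i \<in> S \<and> j \<in> {..<n} - S \<and> j < i}"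
          using z by auto
        then show ?thesis by blast
      qed (use z in auto)
    qed auto
    have fin: "finite {(i, j). i \<in> S \<and> j \<in> {..<n} - S \<and> j < i}"
      by (rule finite_subset[of _ "S \<times> {..<n}"]) (use that in auto)
    show ?thesis unfolding I_def eq
      by (subst card_Un_disjoint)
         (use that fin in \<open>auto simp: card_image inj_on_def prod_eq_iff\<close>)
  qed
  have n1: "nths (v # vs) (insert 0 (Suc ` S)) = v # nths vs S" for S
    by (simp add: nths_Cons image_iff)
  have n1': "nths (v # vs) (- insert 0 (Suc ` S)) = nths vs (- S)" for S
    by (auto simp: nths_Cons image_iff intro!: arg_cong[where f = "nths vs"])
  have n2: "nths (v # vs) (Suc ` S) = nths vs S" for S
    by (simp add: nths_Cons image_iff)
  have n2': "nths (v # vs) (- (Suc ` S)) = v # nths vs (- S)" for S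
    by (auto simp: nths_Cons image_iff intro!: arg_cong[where f = "nths vs"])
  have inj1: "inj_on (\<lambda>S. insert 0 (Suc ` S)) X" for X :: "nat set set"
  proof (rule inj_onI)
    fix S S' :: "nat set" assume "insert 0 (Suc ` S) = insert 0 (Suc ` S')"
    then have "Suc ` S = Suc ` S'" by (auto dest: equalityD1 equalityD2)
    then show "S = S'" by (simp add: inj_image_eq_iff)
  qed
  have inj2: "inj_on ((`) Suc) X" for X :: "nat set set"
    by (simp add: inj_on_def inj_image_eq_iff)
  have "wedge (Suc p) \<alpha> \<beta> (v # vs) = (\<Sum>S | S \<subseteq> {..<Suc ?n} \<and> card S = Suc p. W S)"
    unfolding wedge_def W_def I_def by simp
  also have "\<dots> = (\<Sum>S\<in>?P p. W (insert 0 (Suc ` S))) + (\<Sum>S\<in>?P (Suc p). W (Suc ` S))"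
    unfolding subset_lessThan_Suc_shift
    by (subst sum.union_disjoint) (auto simp: sum.reindex[OF inj1] sum.reindex[OF inj2])
  also have "(\<Sum>S\<in>?P p. W (insert 0 (Suc ` S))) = wedge p (\<lambda>ws. \<alpha> (v # ws)) \<beta> vs"
    unfolding wedge_def W_def I1 n1 n1' by (simp add: I_def)
  also have "(\<Sum>S\<in>?P (Suc p). W (Suc ` S)) =
      (\<Sum>S\<in>?P (Suc p). (- 1) ^ Suc p * ((- 1) ^ I ?n S * \<alpha> (nths vs S) * \<beta> (v # nths vs (- S))))"
    unfolding W_def n2 n2'
    by (intro sum.cong refl) (auto simp: I2 finite_subset[OF _ finite_lessThan] power_add)
  also have "\<dots> = (- 1) ^ Suc p * wedge (Suc p) \<alpha> (\<lambda>ws. \<beta> (v # ws)) vs"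
    unfolding wedge_def I_def sum_distrib_left by simp
  finally show ?thesis .
qed

lemma wedge_eq_0: "length vs < p \<Longrightarrow> wedge p \<alpha> \<beta> vs = 0"
proof -
  assume *: "length vs < p"
  have "card S \<noteq> p" if "S \<subseteq> {..<length vs}" for S
    using card_mono[OF finite_lessThan that] * by simp
  then show ?thesis unfolding wedge_def by (intro sum.neutral) blast
qed

lemma wedge_cong:
  assumes "\<And>ws. length ws = p \<Longrightarrow> \<alpha> ws = \<alpha>' ws"
    and "\<And>ws. length ws + p = length vs \<Longrightarrow> \<beta> ws = \<beta>' ws"
  shows "wedge p \<alpha> \<beta> vs = wedge p \<alpha>' \<beta>' vs"
  using assms
proof (induction vs arbitrary: p \<alpha> \<alpha>' \<beta> \<beta>')
  case Nil
  then show ?case by (cases p) auto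
next
  case (Cons v vs)
  show ?case
  proof (cases p)
    case 0
    then show ?thesis using Cons.prems by simp
  next
    case (Suc q)
    have "wedge q (\<lambda>ws. \<alpha> (v # ws)) \<beta> vs = wedge q (\<lambda>ws. \<alpha>' (v # ws)) \<beta>' vs"
      by (rule Cons.IH) (use Cons.prems Suc in auto)
    moreover have "wedge p \<alpha> (\<lambda>ws. \<beta> (v # ws)) vs = wedge p \<alpha>' (\<lambda>ws. \<beta>' (v # ws)) vs"
      by (rule Cons.IH) (use Cons.prems Suc in auto)
    ultimately show ?thesis using Suc by (simp add: wedge_Suc_Cons)
  qed
qed

lemma wedge_zero_left: "(\<And>ws. length ws = p \<Longrightarrow> \<alpha> ws = 0) \<Longrightarrow> wedge p \<alpha> \<beta> vs = 0"
  using wedge_cong[of p \<alpha> "\<lambda>_. 0" vs \<beta> \<beta>] by (simp add: wedge_def)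

lemma wedge_zero_right: "(\<And>ws. length ws + p = length vs \<Longrightarrow> \<beta> ws = 0) \<Longrightarrow> wedge p \<alpha> \<beta> vs = 0"
  using wedge_cong[of p \<alpha> \<alpha> vs \<beta> "\<lambda>_. 0"] by (simp add: wedge_def)

lemma length_nths_subset: "S \<subseteq> {..<length vs} \<Longrightarrow> length (nths vs S) = card S"
  by (auto simp: length_nths intro!: arg_cong[where f = card])

lemma length_nths_Compl: "S \<subseteq> {..<length vs} \<Longrightarrow> length (nths vs (- S)) = length vs - card S"
proof -
  assume S: "S \<subseteq> {..<length vs}"
  have "{i. i < length vs \<and> i \<in> - S} = {..<length vs} - S" by auto
  then show ?thesis using S
    by (simp add: length_nths card_Diff_subset finite_subset[OF _ finite_lessThan])
qed

lemma linear_wedge_left: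
  assumes "\<And>ws. length ws = p \<Longrightarrow> linear (\<lambda>v. \<alpha> v ws)"
  shows "linear (\<lambda>v. wedge p (\<alpha> v) \<beta> vs)"
proof -
  have "linear (\<lambda>v. c * \<alpha> v (nths vs S) * d)" if "S \<subseteq> {..<length vs} \<and> card S = p" for S c d
    using assms[of "nths vs S"] that
    by (auto simp: length_nths_subset linear_iff algebra_simps)
  then show ?thesis unfolding wedge_def by (intro linear_real_sum) auto
qed

lemma linear_wedge_right:
  assumes "\<And>ws. length ws + p = length vs \<Longrightarrow> linear (\<lambda>v. \<beta> v ws)"
  shows "linear (\<lambda>v. wedge p \<alpha> (\<beta> v) vs)"
proof -
  have "linear (\<lambda>v. c * \<beta> v (nths vs (- S)))" if "S \<subseteq> {..<length vs} \<and> card S = p" for S c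
    using that by (intro linear_real_scale assms)
      (use that card_mono[of "{..<length vs}" S] in \<open>auto simp: length_nths_Compl\<close>)
  then show ?thesis unfolding wedge_def by (intro linear_real_sum) auto
qed

lemma is_form_wedge:
  assumes "is_form p \<alpha>" "is_form q \<beta>"
  shows "is_form (p + q) (wedge p \<alpha> \<beta>)"
proof -
  \<comment> \<open>The induction runs on the total degree, since a contraction may lower either
    factor; n is therefore made a separate variable.\<close>
  have "is_form n (wedge p \<alpha> \<beta>)" if "n = p + q" "is_form p \<alpha>" "is_form q \<beta>" for n p q \<alpha> \<beta>
    using that
  proof (induction n arbitrary: p q \<alpha> \<beta>)
    case (Suc n)
    show ?case
    proof (cases p)
      case 0
      then show ?thesis using Suc.prems
        by (auto intro: is_form_cong[OF is_form_scale])
    next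
      case p: (Suc p')
      have L: "is_form p' (\<lambda>ws. \<alpha> (v # ws))" for v
        using Suc.prems p by (simp add: is_form_Cons)
      have Ll: "linear (\<lambda>v. \<alpha> (v # ws))" if "length ws = p'" for ws
        using Suc.prems p that by (simp add: is_form_linear_hd)
      show ?thesis
      proof (rule is_formI_Cons)
        fix v
        have 1: "is_form n (wedge p' (\<lambda>ws. \<alpha> (v # ws)) \<beta>)"
          using Suc.prems p by (intro Suc.IH[OF _ L]) auto
        have 2: "is_form n (wedge p \<alpha> (\<lambda>ws. \<beta> (v # ws)))"
        proof (cases q)
          \<comment> \<open>A 0-form has no contraction, but here the wedge has fewer than p
            arguments and vanishes.\<close>
          case 0
          then have "wedge p \<alpha> (\<lambda>ws. \<beta> (v # ws)) vs = 0" if "length vs = n" for vs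
            using that Suc.prems p by (intro wedge_eq_0) simp
          then show ?thesis by (rule is_form_cong[OF is_form_zero])
        next
          case (Suc q')
          then show ?thesis using Suc.prems Suc.IH[of p q' \<alpha>] by (simp add: is_form_Cons)
        qed
        show "is_form n (\<lambda>vs. wedge p \<alpha> \<beta> (v # vs))"
          unfolding p wedge_Suc_Cons
          using is_form_add[OF 1 is_form_scale[OF 2, of "(- 1) ^ Suc p'"]] p by simp
      next
        fix vs :: "coord list" assume vs: "length vs = n"
        have "linear (\<lambda>v. wedge p \<alpha> (\<lambda>ws. \<beta> (v # ws)) vs)"
        proof (rule linear_wedge_right)
          fix ws :: "coord list" assume "length ws + p = length vs"
          then have "q = Suc (length ws)" using vs Suc.prems(1) by simp
          then show "linear (\<lambda>v. \<beta> (v # ws))"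
            using Suc.prems by (simp add: is_form_linear_hd)
        qed
        then show "linear (\<lambda>v. wedge p \<alpha> \<beta> (v # vs))"
          unfolding p wedge_Suc_Cons
          by (intro linear_compose_add linear_wedge_left linear_real_scale Ll) auto
      next
        fix v and vs :: "coord list" assume vs: "Suc (length vs) = n"
        have "\<alpha> (v # v # ws) = 0" if "Suc (length ws) = p'" for ws
          using is_form_same_hd[of "length ws" \<alpha> ws v] Suc.prems p that by simp
        then have 1: "wedge r (\<lambda>ws. \<alpha> (v # v # ws)) \<beta> vs = 0" if "p' = Suc r" for r
          using that by (intro wedge_zero_left) simp
        have "\<beta> (v # v # ws) = 0" if "length ws + p = length vs" for ws
        proof -
          have "q = Suc (Suc (length ws))" using that vs Suc.prems(1) by simp
          then show ?thesis using Suc.prems(3) by (simp add: is_form_same_hd)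
        qed
        then have 2: "wedge p \<alpha> (\<lambda>ws. \<beta> (v # v # ws)) vs = 0"
          by (intro wedge_zero_right) simp
        show "wedge p \<alpha> \<beta> (v # v # vs) = 0"
        proof (cases p')
          case 0
          then show ?thesis using 2 unfolding p by (simp add: wedge_Suc_Cons)
        next
          case (Suc r)
          then show ?thesis using 1[OF Suc] 2 unfolding p by (simp add: wedge_Suc_Cons)
        qed
      qed
    qed
  qed simp
  then show ?thesis using assms by simp
qed

lemma is_form_wedge_list:
  "(\<And>\<alpha>. \<alpha> \<in> set \<alpha>s \<Longrightarrow> is_form 1 \<alpha>) \<Longrightarrow> is_form (length \<alpha>s) (wedge_list \<alpha>s)"
proof (induction \<alpha>s)
  case (Cons \<alpha> \<alpha>s)
  then show ?case using is_form_wedge[of 1 \<alpha> "length \<alpha>s" "wedge_list \<alpha>s"] by simp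
qed simp

text \<open>Keeps the frame index \<open>1\<close> a numeral.\<close>

declare One_nat_def [simp del]

lemma is_form_1: "is_form 1 \<omega> \<longleftrightarrow> linear (\<lambda>v. \<omega> [v])"
  using is_form_1_iff by (simp add: One_nat_def)

lemma wedge_1_Nil: "wedge 1 \<alpha> \<beta> [] = 0"
  by (simp add: One_nat_def)

lemma wedge_1_Cons:
  "wedge 1 \<alpha> \<beta> (v # vs) = \<alpha> [v] * \<beta> vs - wedge 1 \<alpha> (\<lambda>ws. \<beta> (v # ws)) vs"
  by (simp add: One_nat_def wedge_Suc_Cons)

section \<open>Orthonormal frames and independence of their choice\<close>

lemma orthonormal_expand:
  assumes lin: "\<And>v. linear (\<lambda>u. g u v)" and o: "orthonormal g E"
  shows "v = (\<Sum>i=1..7. g v (E i) *\<^sub>R E i)"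
proof -
  have d: "g (E i) (E j) = (if i = j then 1 else 0)" if "i \<in> {1..7}" "j \<in> {1..7}" for i j
    using o that by (simp add: orthonormal_def)
  have inj: "inj_on E {1..7}"
    by (rule inj_onI) (metis d zero_neq_one)
  have coeff: "g (\<Sum>i=1..7. c i *\<^sub>R E i) (E j) = c j" if "j \<in> {1..7}" for c j
  proof -
    have "g (\<Sum>i=1..7. c i *\<^sub>R E i) (E j) = (\<Sum>i=1..7. c i * g (E i) (E j))"
      by (simp add: linear_sum[OF lin] linear_cmul[OF lin])
    also have "\<dots> = (\<Sum>i=1..7. if i = j then c i else 0)"
      by (intro sum.cong) (use that d in auto)
    finally show ?thesis using that by simp
  qed
  \<comment> \<open>Pairing a linear relation with \<open>E j\<close> isolates its j-th coefficient,
    so seven orthonormal vectors are independent and span by dimension.\<close>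
  have ind: "independent (E ` {1..7})"
  proof (rule independent_if_scalars_zero)
    fix c x assume c: "(\<Sum>x\<in>E ` {1..7}. c x *\<^sub>R x) = 0" and "x \<in> E ` {1..7}"
    then obtain j where j: "j \<in> {1..7}" "x = E j" by auto
    have "(\<Sum>i=1..7. c (E i) *\<^sub>R E i) = 0" using c by (simp add: sum.reindex[OF inj])
    with coeff[OF j(1), of "\<lambda>i. c (E i)"] show "c x = 0"
      using j linear_0[OF lin] by simp
  qed simp
  have "(UNIV :: coord set) \<subseteq> span (E ` {1..7})"
    by (rule card_ge_dim_independent[OF _ ind]) (use inj in \<open>auto simp: card_image\<close>)
  then have "v \<in> range (\<lambda>c. \<Sum>x\<in>E ` {1..7}. c x *\<^sub>R x)"
    by (simp add: span_finite[symmetric] subset_eq)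
  then obtain c where "v = (\<Sum>x\<in>E ` {1..7}. c x *\<^sub>R x)" by auto
  then have v: "v = (\<Sum>i=1..7. c (E i) *\<^sub>R E i)" by (simp add: sum.reindex[OF inj])
  have "(\<Sum>i=1..7. g v (E i) *\<^sub>R E i) = (\<Sum>i=1..7. c (E i) *\<^sub>R E i)"
    by (intro sum.cong refl) (subst v, simp add: coeff)
  with v show ?thesis by simp
qed

text \<open>The matrix g (E i) (F j) is orthogonal, which is \<open>gg\<close>. This allows the
  frame chosen in \<open>frame\<close> to be replaced by one dual to an adapted coframe.\<close>

lemma trace_frame_indep:
  fixes B :: "coord \<Rightarrow> coord \<Rightarrow> real"
  assumes lin: "\<And>v. linear (\<lambda>u. g u v)" and sym: "\<And>u v. g u v = g v u"
    and E: "orthonormal g E" and F: "orthonormal g F"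
    and B1: "\<And>v. linear (\<lambda>u. B u v)" and B2: "\<And>u. linear (\<lambda>v. B u v)"
  shows "(\<Sum>i=1..7. B (E i) (E i)) = (\<Sum>i=1..7. B (F i) (F i))"
proof -
  have gg: "(\<Sum>i=1..7. g (E i) (F j) * g (E i) (F k)) = (if j = k then 1 else 0)"
    if "j \<in> {1..7}" "k \<in> {1..7}" for j k
  proof -
    have "(if j = k then 1 else 0) = g (F j) (F k)" using F that by (simp add: orthonormal_def)
    also have "\<dots> = g (\<Sum>i=1..7. g (F j) (E i) *\<^sub>R E i) (F k)"
      by (subst orthonormal_expand[OF lin E, of "F j"]) simp
    also have "\<dots> = (\<Sum>i=1..7. g (E i) (F j) * g (E i) (F k))"
      by (simp add: linear_sum[OF lin] linear_cmul[OF lin] sym[of "F j"])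
    finally show ?thesis by simp
  qed
  have ex: "B u u = (\<Sum>j=1..7. \<Sum>k=1..7. g u (F j) * g u (F k) * B (F j) (F k))" for u
  proof -
    have "B u u = B (\<Sum>j=1..7. g u (F j) *\<^sub>R F j) (\<Sum>k=1..7. g u (F k) *\<^sub>R F k)"
      using orthonormal_expand[OF lin F, of u] by simp
    then have "B u u = (\<Sum>k=1..7. \<Sum>j=1..7. g u (F j) * g u (F k) * B (F j) (F k))"
      by (simp add: linear_sum[OF B1] linear_cmul[OF B1] linear_sum[OF B2] linear_cmul[OF B2]
          sum_distrib_left mult_ac)
    then show ?thesis by (subst sum.swap)
  qed
  have "(\<Sum>i=1..7. B (E i) (E i)) =
      (\<Sum>i=1..7. \<Sum>j=1..7. \<Sum>k=1..7. g (E i) (F j) * g (E i) (F k) * B (F j) (F k))"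
    by (intro sum.cong refl ex)
  also have "\<dots> = (\<Sum>j=1..7. \<Sum>i=1..7. \<Sum>k=1..7. g (E i) (F j) * g (E i) (F k) * B (F j) (F k))"
    by (rule sum.swap)
  also have "\<dots> = (\<Sum>j=1..7. \<Sum>k=1..7. \<Sum>i=1..7. g (E i) (F j) * g (E i) (F k) * B (F j) (F k))"
    by (intro sum.cong refl sum.swap)
  also have "\<dots> = (\<Sum>j=1..7. \<Sum>k=1..7. (\<Sum>i=1..7. g (E i) (F j) * g (E i) (F k)) * B (F j) (F k))"
    by (simp add: sum_distrib_right)
  also have "\<dots> = (\<Sum>j=1..7. \<Sum>k=1..7. if j = k then B (F j) (F k) else 0)"
    by (intro sum.cong refl) (simp add: gg)
  also have "\<dots> = (\<Sum>j=1..7. B (F j) (F j))"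
    by (simp add: sum.delta)
  finally show ?thesis .
qed

text \<open>\<open>form_inner\<close> with the frame as an argument, so that two frames can be
  compared.\<close>

definition frame_inner :: "(nat \<Rightarrow> coord) \<Rightarrow> nat \<Rightarrow> form \<Rightarrow> form \<Rightarrow> real" where
  "frame_inner E k \<alpha> \<beta> =
     (\<Sum>S | S \<subseteq> {1..7} \<and> card S = k.
        \<alpha> (map E (sorted_list_of_set S)) * \<beta> (map E (sorted_list_of_set S)))"

lemma insort_split: "\<exists>ys zs. insort x xs = ys @ x # zs \<and> xs = ys @ zs"
proof (induction xs)
  case (Cons a xs)
  then obtain ys zs where "insort x xs = ys @ x # zs" "xs = ys @ zs" by blast
  then show ?case
    by (cases "x \<le> a") (auto intro: exI[of _ "[]"] exI[of _ "a # ys"])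
qed simp

text \<open>The sign is -1 to the power of the position of i in the sorted list. It depends on S and
  i only, so two forms evaluated on the same frame acquire the same sign and it drops out of their
  product.\<close>

lemma is_form_insert:
  assumes "finite S" "card S = k" "i \<notin> S"
  obtains s :: real where "s * s = 1"
    and "\<And>\<omega> E. is_form (Suc k) \<omega> \<Longrightarrow> \<omega> (map E (sorted_list_of_set (insert i S))) =
      s * \<omega> (E i # map E (sorted_list_of_set S))"
proof -
  obtain ys zs where s: "sorted_list_of_set (insert i S) = ys @ i # zs" "sorted_list_of_set S = ys @ zs"
    using insort_split[of i "sorted_list_of_set S"] assms by (auto simp: sorted_list_of_set_insert)
  have len: "length (ys @ zs) = k" using s(2) assms by (metis length_sorted_list_of_set)
  show ?thesis
  proof (rule that[of "(- 1) ^ length ys"])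
    show "(- 1) ^ length ys * (- 1) ^ length ys = (1 :: real)"
      by (simp flip: power_mult_distrib)
    fix \<eta> E assume "is_form (Suc k) \<eta>"
    from is_form_move[OF this, of "map E ys" "E i" "map E zs"] len
    show "\<eta> (map E (sorted_list_of_set (insert i S))) =
        (- 1) ^ length ys * \<eta> (E i # map E (sorted_list_of_set S))"
      by (simp add: s)
  qed
qed

lemma is_form_repeat:
  assumes "is_form (Suc k) \<omega>" "length xs = k" "v \<in> set xs"
  shows "\<omega> (v # xs) = 0"
proof -
  obtain j where "j < length xs" "xs ! j = v" using assms(3) by (auto simp: in_set_conv_nth)
  then show ?thesis
    using is_formD_alt[OF assms(1), of "v # xs" 0 "Suc j"] assms(2) by simp
qed

text \<open>Double counting: a set of size k + 1 arises from each of its k + 1 elements as leading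
  argument i, and pairs with i in S contribute 0. Independence of the frame is thereby reduced to
  one slot at a time.\<close>

lemma frame_inner_Suc:
  assumes \<alpha>: "is_form (Suc k) \<alpha>" and \<beta>: "is_form (Suc k) \<beta>"
  shows "Suc k * frame_inner E (Suc k) \<alpha> \<beta> =
    (\<Sum>i=1..7. frame_inner E k (\<lambda>vs. \<alpha> (E i # vs)) (\<lambda>vs. \<beta> (E i # vs)))"
proof -
  define I :: "nat set" where "I = {1..7}"
  have fI: "finite I" by (simp add: I_def)
  define L where "L S = map E (sorted_list_of_set S)" for S
  define H where "H i S = \<alpha> (E i # L S) * \<beta> (E i # L S)" for i S
  define G where "G S = \<alpha> (L S) * \<beta> (L S)" for S
  have fin: "finite S" if "S \<subseteq> I" for S using finite_subset[OF that fI] .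
  have H0: "H i S = 0" if "S \<subseteq> I" "card S = k" "i \<in> S" for i S
  proof -
    have "E i \<in> set (L S)" using that fin[OF that(1)] by (simp add: L_def)
    then have "\<alpha> (E i # L S) = 0" by (intro is_form_repeat[OF \<alpha>]) (simp_all add: L_def that)
    then show ?thesis by (simp add: H_def)
  qed
  have HG: "H i S = G (insert i S)" if "S \<subseteq> I" "card S = k" "i \<notin> S" for i S
  proof -
    note S = that
    obtain s :: real where s: "s * s = 1"
      "\<And>\<omega> E. is_form (Suc k) \<omega> \<Longrightarrow> \<omega> (map E (sorted_list_of_set (insert i S))) =
        s * \<omega> (E i # map E (sorted_list_of_set S))"
      using is_form_insert[OF fin[OF S(1)] S(2,3)] by metis
    have "G (insert i S) = (s * s) * H i S"
      unfolding G_def H_def L_def s(2)[OF \<alpha>] s(2)[OF \<beta>] by (simp only: ac_simps)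
    then show ?thesis using s(1) by simp
  qed
  have "(\<Sum>i\<in>I. \<Sum>S | S \<subseteq> I \<and> card S = k. H i S) =
      (\<Sum>i\<in>I. \<Sum>S | S \<subseteq> I \<and> card S = k \<and> i \<notin> S. H i S)"
    by (intro sum.cong refl sum.mono_neutral_right) (auto simp: fI H0)
  also have "\<dots> = (\<Sum>(i, S)\<in>(SIGMA i:I. {S. S \<subseteq> I \<and> card S = k \<and> i \<notin> S}). H i S)"
    by (subst sum.Sigma) (auto simp: fI)
  also have "\<dots> = (\<Sum>(S, i)\<in>(SIGMA S:{S. S \<subseteq> I \<and> card S = Suc k}. S). G S)"
    by (rule sum.reindex_bij_witness
          [where i = "\<lambda>(S, i). (i, S - {i})" and j = "\<lambda>(i, S). (insert i S, i)"])
       (auto simp: HG fin insert_absorb card_insert_if)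
  also have "\<dots> = (\<Sum>S | S \<subseteq> I \<and> card S = Suc k. \<Sum>i\<in>S. G S)"
    by (subst sum.Sigma) (auto simp: fI fin)
  also have "\<dots> = Suc k * (\<Sum>S | S \<subseteq> I \<and> card S = Suc k. G S)"
    by (simp add: sum_distrib_left)
  finally show ?thesis
    by (simp add: frame_inner_def H_def G_def L_def I_def)
qed

lemma linear_frame_inner_left:
  assumes "\<And>ws. length ws = k \<Longrightarrow> linear (\<lambda>v. \<alpha> v ws)"
  shows "linear (\<lambda>v. frame_inner E k (\<alpha> v) \<beta>)"
proof -
  have "linear (\<lambda>v. \<alpha> v (map E (sorted_list_of_set S)) * c)" if "S \<subseteq> {1..7} \<and> card S = k" for S c
    using assms[of "map E (sorted_list_of_set S)"] that by (auto simp: linear_iff algebra_simps)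
  then show ?thesis unfolding frame_inner_def by (intro linear_real_sum) auto
qed

lemma frame_inner_commute: "frame_inner E k \<alpha> \<beta> = frame_inner E k \<beta> \<alpha>"
  by (simp add: frame_inner_def mult.commute)

lemma linear_frame_inner_right:
  "(\<And>ws. length ws = k \<Longrightarrow> linear (\<lambda>v. \<beta> v ws)) \<Longrightarrow> linear (\<lambda>v. frame_inner E k \<alpha> (\<beta> v))"
  by (subst frame_inner_commute) (rule linear_frame_inner_left)

lemma frame_inner_cong:
  "(\<And>ws. length ws = k \<Longrightarrow> \<alpha> ws = \<alpha>' ws) \<Longrightarrow> (\<And>ws. length ws = k \<Longrightarrow> \<beta> ws = \<beta>' ws) \<Longrightarrow>
    frame_inner E k \<alpha> \<beta> = frame_inner E k \<alpha>' \<beta>'"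
  by (auto simp: frame_inner_def intro!: sum.cong)

text \<open>After \<open>frame_inner_Suc\<close> the frame in the first slot is changed by
  \<open>trace_frame_indep\<close>, the one in the remaining slots by induction.\<close>

lemma frame_inner_indep:
  assumes lin: "\<And>v. linear (\<lambda>u. g u v)" and sym: "\<And>u v. g u v = g v u"
    and E: "orthonormal g E" and F: "orthonormal g F"
    and "is_form k \<alpha>" "is_form k \<beta>"
  shows "frame_inner E k \<alpha> \<beta> = frame_inner F k \<alpha> \<beta>"
  using assms(5,6)
proof (induction k arbitrary: \<alpha> \<beta>)
  case 0
  have "{S. S \<subseteq> {1..7::nat} \<and> card S = 0} = {{}}" by (auto dest: finite_subset)
  then show ?case by (simp add: frame_inner_def)
next
  case (Suc k)
  let ?i = "\<lambda>(\<omega> :: form) v vs. \<omega> (v # vs)"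
  have "Suc k * frame_inner E (Suc k) \<alpha> \<beta> = (\<Sum>i=1..7. frame_inner E k (?i \<alpha> (E i)) (?i \<beta> (E i)))"
    by (rule frame_inner_Suc[OF Suc.prems])
  also have "\<dots> = (\<Sum>i=1..7. frame_inner F k (?i \<alpha> (E i)) (?i \<beta> (E i)))"
    by (intro sum.cong refl Suc.IH is_form_Cons Suc.prems)
  also have "\<dots> = (\<Sum>i=1..7. frame_inner F k (?i \<alpha> (F i)) (?i \<beta> (F i)))"
    using Suc.prems
    by (intro trace_frame_indep[OF lin sym E F, where B = "\<lambda>u v. frame_inner F k (?i \<alpha> u) (?i \<beta> v)"])
       (auto intro: linear_frame_inner_left linear_frame_inner_right is_form_linear_hd)
  also have "\<dots> = Suc k * frame_inner F (Suc k) \<alpha> \<beta>"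
    by (rule frame_inner_Suc[OF Suc.prems, symmetric])
  finally show ?case by simp
qed

lemma form_eq_0:
  assumes lin: "\<And>v. linear (\<lambda>u. g u v)" and F: "orthonormal g F"
    and "is_form k \<omega>"
    and "\<And>S. S \<subseteq> {1..7} \<Longrightarrow> card S = k \<Longrightarrow> \<omega> (map F (sorted_list_of_set S)) = 0"
    and "length vs = k"
  shows "\<omega> vs = 0"
  using assms(3-)
proof (induction k arbitrary: \<omega> vs)
  case 0
  from 0(2)[of "{}"] 0(3) show ?case by simp
next
  case (Suc k)
  obtain v ws where vs: "vs = v # ws" "length ws = k" using Suc.prems(3) by (cases vs) auto
  have "\<omega> (F i # ws) = 0" if i: "i \<in> {1..7}" for i
  proof (rule Suc.IH[OF is_form_Cons[OF Suc.prems(1)] _ vs(2)])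
    fix S :: "nat set" assume S: "S \<subseteq> {1..7}" "card S = k"
    have fS: "finite S" using finite_subset[OF S(1)] by simp
    show "\<omega> (F i # map F (sorted_list_of_set S)) = 0"
    proof (cases "i \<in> S")
      case True
      then show ?thesis using S fS by (intro is_form_repeat[OF Suc.prems(1)]) auto
    next
      case False
      obtain s :: real where s: "s * s = 1"
        "\<omega> (map F (sorted_list_of_set (insert i S))) = s * \<omega> (F i # map F (sorted_list_of_set S))"
        using is_form_insert[OF fS S(2) False] Suc.prems(1) by metis
      have "\<omega> (map F (sorted_list_of_set (insert i S))) = 0"
        by (rule Suc.prems(2)) (use S i False fS in auto)
      then show ?thesis using s by auto
    qed
  qed
  moreover have "\<omega> vs = (\<Sum>i=1..7. g v (F i) * \<omega> (F i # ws))"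
    unfolding vs(1)
    by (subst orthonormal_expand[OF lin F, of v])
       (simp add: linear_sum[OF is_form_linear_hd[OF Suc.prems(1) vs(2)]]
         linear_cmul[OF is_form_linear_hd[OF Suc.prems(1) vs(2)]])
  ultimately show ?case by simp
qed

lemma form_eqI:
  assumes "\<And>v. linear (\<lambda>u. g u v)" "orthonormal g F"
    and "is_form k \<omega>" "is_form k \<eta>"
    and "\<And>S. S \<subseteq> {1..7} \<Longrightarrow> card S = k \<Longrightarrow>
      \<omega> (map F (sorted_list_of_set S)) = \<eta> (map F (sorted_list_of_set S))"
    and "length vs = k"
  shows "\<omega> vs = \<eta> vs"
  using form_eq_0[OF assms(1,2) is_form_diff[OF assms(3,4)] _ assms(6)] assms(5) by simp

lemma subset_card_7: "{S. S \<subseteq> {1..7::nat} \<and> card S = 7} = {{1..7}}"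
  using card_subset_eq[of "{1..7::nat}"] by auto

lemma sorted_list_1_7: "sorted_list_of_set {1..7::nat} = [1, 2, 3, 4, 5, 6, 7]"
proof -
  have "sorted_list_of_set {1..7::nat} = [1..<Suc 7]"
    by (metis sorted_list_of_set_range atLeastLessThanSuc_atLeastAtMost)
  then show ?thesis by (simp add: upt_rec)
qed

section \<open>Adapted coframes\<close>

definition dual_frame :: "(nat \<Rightarrow> form) \<Rightarrow> (nat \<Rightarrow> coord) \<Rightarrow> bool" where
  "dual_frame e f \<longleftrightarrow> (\<forall>i\<in>{1..7}. \<forall>j\<in>{1..7}. e i [f j] = (if i = j then 1 else 0))"

definition coframe_metric :: "(nat \<Rightarrow> form) \<Rightarrow> coord \<Rightarrow> coord \<Rightarrow> real" where
  "coframe_metric e u v = (\<Sum>i=1..7. e i [u] * e i [v])"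

definition coframe_vol :: "(nat \<Rightarrow> form) \<Rightarrow> form" where
  "coframe_vol e = wedge_list (map e [1..<8])"

lemma g2_coframe_linear: "g2_coframe P e \<Longrightarrow> i \<in> {1..7} \<Longrightarrow> linear (\<lambda>v. e i [v])"
  by (simp add: g2_coframe_def is_form_1)

text \<open>Linear independence of the coframe says that no nonzero vector is orthogonal to the
  image of the map L with components \<open>e i\<close>. So L is onto, and preimages of an
  orthonormal basis form the dual frame.\<close>

lemma ex_dual_frame:
  assumes P: "g2_coframe P e"
  shows "\<exists>f. dual_frame e f"
proof -
  obtain b :: "nat \<Rightarrow> coord" where b: "bij_betw b {1..7} Basis"
    using finite_same_card_bij[of "{1..7::nat}" "Basis :: coord set"] by auto
  have bb: "b i \<bullet> b j = (if i = j then 1 else 0)" if "i \<in> {1..7}" "j \<in> {1..7}" for i j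
  proof -
    have "b i \<in> Basis" "b j \<in> Basis" using b that by (auto simp: bij_betw_def)
    moreover have "b i = b j \<longleftrightarrow> i = j"
      using b that by (auto simp: bij_betw_def inj_on_eq_iff)
    ultimately show ?thesis by (simp add: inner_Basis)
  qed
  define L where "L v = (\<Sum>i=1..7. e i [v] *\<^sub>R b i)" for v
  have lin: "linear (\<lambda>v. e i [v])" if "i \<in> {1..7}" for i
    using g2_coframe_linear[OF P that] .
  have linL: "linear L"
    unfolding L_def by (intro linear_compose_sum ballI) (use lin in \<open>auto simp: linear_iff algebra_simps\<close>)
  have bL: "b j \<bullet> L v = e j [v]" if "j \<in> {1..7}" for j v
  proof -
    have "b j \<bullet> L v = (\<Sum>i=1..7. if i = j then e i [v] else 0)"
      unfolding L_def inner_sum_right by (intro sum.cong) (use bb that in auto)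
    then show ?thesis using that by simp
  qed
  have "span (range L) = UNIV"
  proof (rule ccontr)
    assume "span (range L) \<noteq> UNIV"
    then obtain a where a: "a \<noteq> 0" "\<forall>x\<in>span (range L). a \<bullet> x = 0"
      using span_not_UNIV_orthogonal[of "range L"] by blast
    have aL: "a \<bullet> L v = 0" for v using a(2) by (simp add: span_base)
    have "(\<Sum>i=1..7. (a \<bullet> b i) * e i [v]) = 0" for v
      using aL[of v] by (simp add: L_def inner_sum_right mult.commute)
    moreover have "\<forall>a. (\<forall>v. (\<Sum>i=1..7. a i * e i [v]) = 0) \<longrightarrow> (\<forall>i\<in>{1..7}. a i = 0)"
      using P by (simp add: g2_coframe_def)
    ultimately have "\<forall>i\<in>{1..7}. a \<bullet> b i = 0" by fast
    then have "\<forall>x\<in>b ` {1..7}. a \<bullet> x = 0" by blast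
    then have "\<forall>x\<in>Basis. a \<bullet> x = 0" by (simp only: bij_betw_imp_surj_on[OF b])
    with a(1) show False by (simp add: euclidean_all_zero_iff)
  qed
  then have "surj L" using linear_span_image[OF linL, of UNIV] by simp
  then have "L (inv L (b j)) = b j" for j by (rule surj_f_inv_f)
  then have "e i [inv L (b j)] = (if i = j then 1 else 0)" if "i \<in> {1..7}" "j \<in> {1..7}" for i j
    using bL[OF that(1), of "inv L (b j)"] bb[OF that] by simp
  then have "dual_frame e (\<lambda>j. inv L (b j))" by (simp add: dual_frame_def)
  then show ?thesis by blast
qed

lemma coframe_metric_sym: "coframe_metric e u v = coframe_metric e v u"
  by (simp add: coframe_metric_def mult.commute)

lemma coframe_metric_linear:
  assumes "g2_coframe P e"
  shows "linear (\<lambda>u. coframe_metric e u v)" "linear (coframe_metric e u)"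
  unfolding coframe_metric_def
  by (intro linear_real_sum; use g2_coframe_linear[OF assms] in \<open>auto simp: linear_iff algebra_simps\<close>)+

lemma coframe_metric_dual:
  assumes "dual_frame e f" "i \<in> {1..7}"
  shows "coframe_metric e u (f i) = e i [u]"
proof -
  have "coframe_metric e u (f i) = (\<Sum>j=1..7. if j = i then e j [u] else 0)"
    unfolding coframe_metric_def using assms by (intro sum.cong) (auto simp: dual_frame_def)
  then show ?thesis using assms by simp
qed

lemma orthonormal_dual_frame: "dual_frame e f \<Longrightarrow> orthonormal (coframe_metric e) f"
  by (auto simp: orthonormal_def coframe_metric_dual) (auto simp: dual_frame_def)

lemma wedge_list_3:
  "wedge_list [\<alpha>, \<beta>, \<gamma>] [u, v, w] =
     \<alpha> [u] * (\<beta> [v] * \<gamma> [w] - \<beta> [w] * \<gamma> [v]) - \<alpha> [v] * (\<beta> [u] * \<gamma> [w] - \<beta> [w] * \<gamma> [u])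
     + \<alpha> [w] * (\<beta> [u] * \<gamma> [v] - \<beta> [v] * \<gamma> [u])"
  by (simp add: wedge_1_Cons wedge_1_Nil algebra_simps)

lemma g2_coframe_is_form:
  assumes P: "g2_coframe P e"
  shows "is_form 3 P"
proof -
  have w: "is_form 3 (wedge_list [e i, e j, e k])" if "i \<in> {1..7}" "j \<in> {1..7}" "k \<in> {1..7}" for i j k
  proof -
    have "is_form (length [e i, e j, e k]) (wedge_list [e i, e j, e k])"
      by (rule is_form_wedge_list) (use that P in \<open>auto simp: g2_coframe_def\<close>)
    then show ?thesis by (simp add: numeral_3_eq_3)
  qed
  let ?e3 = "\<lambda>i j k vs. wedge_list [e i, e j, e k] vs"
  have "is_form 3 (\<lambda>vs. ?e3 1 2 7 vs + ?e3 1 3 5 vs - ?e3 1 4 6 vs - ?e3 2 3 6 vs - ?e3 2 4 5 vs +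
      ?e3 3 4 7 vs + ?e3 5 6 7 vs)"
    by (intro is_form_add is_form_diff w) auto
  then show ?thesis
    by (rule is_form_cong) (use P in \<open>simp add: g2_coframe_def Let_def del: wedge_list.simps\<close>)
qed

section \<open>Components of the 3-form in an adapted frame\<close>

definition kd :: "nat \<Rightarrow> nat \<Rightarrow> real" where
  "kd i j = (if i = j then 1 else 0)"

text \<open>The value of e_ijk on (f a, f b, f c): a 3 by 3 determinant of Kronecker
  symbols.\<close>

definition kd3 :: "nat \<Rightarrow> nat \<Rightarrow> nat \<Rightarrow> nat \<Rightarrow> nat \<Rightarrow> nat \<Rightarrow> real" where
  "kd3 i j k a b c =
     kd i a * (kd j b * kd k c - kd j c * kd k b) - kd i b * (kd j a * kd k c - kd j c * kd k a)
     + kd i c * (kd j a * kd k b - kd j b * kd k a)"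

definition phi0 :: "nat \<Rightarrow> nat \<Rightarrow> nat \<Rightarrow> real" where
  "phi0 a b c = kd3 1 2 7 a b c + kd3 1 3 5 a b c - kd3 1 4 6 a b c - kd3 2 3 6 a b c
     - kd3 2 4 5 a b c + kd3 3 4 7 a b c + kd3 5 6 7 a b c"

lemma g2_dual_frame_components:
  assumes P: "g2_coframe P e" and f: "dual_frame e f"
    and "a \<in> {1..7}" "b \<in> {1..7}" "c \<in> {1..7}"
  shows "P [f a, f b, f c] = phi0 a b c"
proof -
  have "e i [f j] = kd i j" if "i \<in> {1..7}" "j \<in> {1..7}" for i j
    using f that by (simp add: dual_frame_def kd_def)
  then have "wedge_list [e i, e j, e k] [f a, f b, f c] = kd3 i j k a b c"
    if "i \<in> {1..7}" "j \<in> {1..7}" "k \<in> {1..7}" for i j k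
    unfolding wedge_list_3 using that assms(3-5) by (simp add: kd3_def)
  then show ?thesis
    using P unfolding g2_coframe_def Let_def phi0_def by simp
qed

lemma phi0_swap:
  "phi0 b a c = - phi0 a b c" "phi0 a c b = - phi0 a b c"
  by (simp_all add: phi0_def kd3_def algebra_simps)

lemma phi0_same [simp]: "phi0 a a c = 0" "phi0 a b b = 0" "phi0 a b a = 0"
  by (simp_all add: phi0_def kd3_def algebra_simps)

text \<open>Conditional copies of \<open>phi0_swap\<close> that fire on inverted pairs only: simp
  sorts numeral indices without looping until the table \<open>phi0_values\<close> applies.
  \<open>t_sort\<close> and \<open>coframe_vol_sort\<close> follow the same pattern.\<close>

lemma phi0_sort:
  "a < b \<Longrightarrow> phi0 b a c = - phi0 a b c" "b < c \<Longrightarrow> phi0 a c b = - phi0 a b c"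
  by (rule phi0_swap)+

lemma phi0_values:
  "phi0 1 2 3 = 0" "phi0 1 2 4 = 0" "phi0 1 2 5 = 0" "phi0 1 2 6 = 0"
  "phi0 1 2 7 = 1" "phi0 1 3 4 = 0" "phi0 1 3 5 = 1" "phi0 1 3 6 = 0"
  "phi0 1 3 7 = 0" "phi0 1 4 5 = 0" "phi0 1 4 6 = - 1" "phi0 1 4 7 = 0"
  "phi0 1 5 6 = 0" "phi0 1 5 7 = 0" "phi0 1 6 7 = 0" "phi0 2 3 4 = 0"
  "phi0 2 3 5 = 0" "phi0 2 3 6 = - 1" "phi0 2 3 7 = 0" "phi0 2 4 5 = - 1"
  "phi0 2 4 6 = 0" "phi0 2 4 7 = 0" "phi0 2 5 6 = 0" "phi0 2 5 7 = 0"
  "phi0 2 6 7 = 0" "phi0 3 4 5 = 0" "phi0 3 4 6 = 0" "phi0 3 4 7 = 1"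
  "phi0 3 5 6 = 0" "phi0 3 5 7 = 0" "phi0 3 6 7 = 0" "phi0 4 5 6 = 0"
  "phi0 4 5 7 = 0" "phi0 4 6 7 = 0" "phi0 5 6 7 = 1"
  by (simp_all add: phi0_def kd3_def kd_def)

section \<open>The cubic invariant; uniqueness of metric and volume form\<close>

lemma wedge_2_Cons:
  "wedge 2 \<alpha> \<beta> (v # vs) = wedge 1 (\<lambda>ws. \<alpha> (v # ws)) \<beta> vs + wedge 2 \<alpha> (\<lambda>ws. \<beta> (v # ws)) vs"
  using wedge_Suc_Cons[of "Suc 0"] by (simp add: One_nat_def numeral_2_eq_2)

lemma wedge_2_Nil: "wedge 2 \<alpha> \<beta> [] = 0"
  by (simp add: numeral_2_eq_2)

text \<open>\<open>(\<iota>\<^sub>u P) \<and> (\<iota>\<^sub>v P) \<and> P\<close>, which determines the metric and the volume form of \<open>P\<close>.\<close>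

definition g2_cubic :: "form \<Rightarrow> coord \<Rightarrow> coord \<Rightarrow> form" where
  "g2_cubic P u v = wedge 2 (\<lambda>ws. P (u # ws)) (wedge 2 (\<lambda>ws. P (v # ws)) P)"

lemma mem_1_7_iff: "i \<in> {1..7::nat} \<longleftrightarrow> i = 1 \<or> i = 2 \<or> i = 3 \<or> i = 4 \<or> i = 5 \<or> i = 6 \<or> i = 7"
  by auto

lemma g2_cubic_dual:
  assumes P: "g2_coframe P e" and f: "dual_frame e f" and "a \<in> {1..7}" "b \<in> {1..7}"
  shows "g2_cubic P (f a) (f b) (map f [1, 2, 3, 4, 5, 6, 7]) = 6 * kd a b"
  using assms(3,4) g2_dual_frame_components[OF P f] unfolding mem_1_7_iff
  by (elim disjE)
     (simp_all add: g2_cubic_def wedge_2_Cons wedge_2_Nil wedge_1_Cons wedge_1_Nil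
       phi0_sort phi0_values kd_def)

lemma g2_cubic_linear:
  assumes P: "is_form 3 P"
  shows "linear (\<lambda>u. g2_cubic P u v vs)" "length vs = 7 \<Longrightarrow> linear (\<lambda>v. g2_cubic P u v vs)"
proof -
  have l: "linear (\<lambda>u. P (u # ws))" if "length ws = 2" for ws
    using P that is_form_linear_hd[of 2 P ws] by simp
  show "linear (\<lambda>u. g2_cubic P u v vs)"
    unfolding g2_cubic_def by (intro linear_wedge_left l)
  show "linear (\<lambda>v. g2_cubic P u v vs)" if "length vs = 7"
    unfolding g2_cubic_def by (intro linear_wedge_right linear_wedge_left l)
qed

lemma is_form_g2_cubic:
  assumes P: "is_form 3 P"
  shows "is_form 7 (g2_cubic P u v)"
proof -
  have i: "is_form 2 (\<lambda>ws. P (u # ws))" for u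
    using P is_form_Cons[of 2 P u] by simp
  show ?thesis
    unfolding g2_cubic_def
    using is_form_wedge[OF i is_form_wedge[OF i P], of u v] by simp
qed

lemma wedge_1_eq_0: "(\<And>v. v \<in> set vs \<Longrightarrow> \<alpha> [v] = 0) \<Longrightarrow> wedge 1 \<alpha> \<beta> vs = 0"
  by (induction vs arbitrary: \<beta>) (auto simp: wedge_1_Cons wedge_1_Nil)

lemma wedge_list_dual:
  assumes "distinct ks" "set ks \<subseteq> {1..7}" "dual_frame e f"
  shows "wedge_list (map e ks) (map f ks) = 1"
  using assms(1,2)
proof (induction ks)
  case (Cons k ks)
  have "wedge 1 (e k) \<beta> (map f ks) = 0" for \<beta>
    by (rule wedge_1_eq_0) (use Cons.prems assms(3) in \<open>auto simp: dual_frame_def\<close>)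
  then show ?case
    using Cons assms(3) by (simp add: wedge_1_Cons dual_frame_def)
qed simp

lemma coframe_vol_eq: "coframe_vol e = wedge_list (map e [1, 2, 3, 4, 5, 6, 7])"
  by (simp add: coframe_vol_def upt_rec)

lemma is_form_coframe_vol:
  assumes "g2_coframe P e"
  shows "is_form 7 (coframe_vol e)"
proof -
  have "is_form (length (map e [1..<8])) (wedge_list (map e [1..<8]))"
    by (rule is_form_wedge_list) (use assms in \<open>auto simp: g2_coframe_def\<close>)
  then show ?thesis by (simp add: coframe_vol_def)
qed

lemma coframe_vol_dual:
  "dual_frame e f \<Longrightarrow> coframe_vol e (map f [1, 2, 3, 4, 5, 6, 7]) = 1"
  unfolding coframe_vol_eq by (rule wedge_list_dual) auto

text \<open>Both sides are bilinear in u and v and top forms in vs, so the 49 evaluations in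
  \<open>g2_cubic_dual\<close> suffice. The left side depends on P alone, which is what links
  different coframes of P.\<close>

lemma g2_cubic_eq:
  assumes P: "g2_coframe P e" and vs: "length vs = 7"
  shows "g2_cubic P u v vs = 6 * coframe_metric e u v * coframe_vol e vs"
proof -
  obtain f where f: "dual_frame e f" using ex_dual_frame[OF P] by blast
  note gl = coframe_metric_linear[OF P] and o = orthonormal_dual_frame[OF f]
  note P3 = g2_coframe_is_form[OF P]
  let ?F = "map f [1, 2, 3, 4, 5, 6, 7]"
  note l = g2_cubic_linear[OF P3]
  have u: "u = (\<Sum>i=1..7. e i [u] *\<^sub>R f i)" for u
    using orthonormal_expand[OF gl(1) o, of u] by (simp add: coframe_metric_dual[OF f])
  have "g2_cubic P u v ?F =
      g2_cubic P (\<Sum>i=1..7. e i [u] *\<^sub>R f i) (\<Sum>j=1..7. e j [v] *\<^sub>R f j) ?F"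
    using u[of u] u[of v] by simp
  also have "\<dots> = (\<Sum>i=1..7. \<Sum>j=1..7. e i [u] * (e j [v] * g2_cubic P (f i) (f j) ?F))"
    by (simp add: linear_sum[OF l(1)] linear_cmul[OF l(1)] linear_sum[OF l(2)] linear_cmul[OF l(2)]
        sum_distrib_left)
  also have "\<dots> = (\<Sum>i=1..7. \<Sum>j=1..7. if j = i then 6 * (e i [u] * e i [v]) else 0)"
    by (intro sum.cong refl) (auto simp: g2_cubic_dual[OF P f] kd_def simp del: list.map)
  also have "\<dots> = 6 * coframe_metric e u v"
    by (simp add: coframe_metric_def sum_distrib_left)
  finally have 1: "g2_cubic P u v ?F = 6 * coframe_metric e u v" .
  have S: "map f (sorted_list_of_set S) = ?F" if "S \<subseteq> {1..7}" "card S = 7" for S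
  proof -
    have "S = {1..7}" using that subset_card_7 by blast
    then show ?thesis by (simp add: sorted_list_1_7)
  qed
  show ?thesis
    by (rule form_eqI[OF gl(1) o is_form_g2_cubic[OF P3] is_form_scale[OF is_form_coframe_vol[OF P]] _ vs])
       (simp only: S 1 coframe_vol_dual[OF f] mult_1_right)
qed

lemma is_form_scale_args:
  "is_form k \<omega> \<Longrightarrow> length vs = k \<Longrightarrow> \<omega> (map (\<lambda>v. c *\<^sub>R v) vs) = c ^ k * \<omega> vs"
proof (induction k arbitrary: \<omega> vs)
  case (Suc k)
  then obtain v ws where vs: "vs = v # ws" "length ws = k" by (cases vs) auto
  have "\<omega> (c *\<^sub>R v # map (\<lambda>v. c *\<^sub>R v) ws) = c * \<omega> (v # map (\<lambda>v. c *\<^sub>R v) ws)"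
    using linear_cmul[OF is_form_linear_hd[OF Suc.prems(1)], of "map (\<lambda>v. c *\<^sub>R v) ws" c v] vs by simp
  also have "\<omega> (v # map (\<lambda>v. c *\<^sub>R v) ws) = c ^ k * \<omega> (v # ws)"
    by (rule Suc.IH[OF is_form_Cons[OF Suc.prems(1)] vs(2)])
  finally show ?case by (simp add: vs)
qed simp

text \<open>Comparing the cubic invariant for two coframes shows that the metrics are proportional with
  the ratio \<open>D\<close> of the volume forms as factor, and rescaling a frame gives \<open>D ^ 9 = 1\<close>.\<close>

lemma g2_coframe_unique:
  assumes P: "g2_coframe P e" and P': "g2_coframe P e'"
  shows "coframe_metric e u v = coframe_metric e' u v"
    and "length vs = 7 \<Longrightarrow> coframe_vol e vs = coframe_vol e' vs"
proof -
  obtain f where f: "dual_frame e f" using ex_dual_frame[OF P] by blast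
  obtain f' where f': "dual_frame e' f'" using ex_dual_frame[OF P'] by blast
  note o = orthonormal_dual_frame[OF f] and o' = orthonormal_dual_frame[OF f']
  note gl = coframe_metric_linear[OF P]
  let ?F' = "map f' [1, 2, 3, 4, 5, 6, 7]"
  define D where "D = coframe_vol e ?F'"
  have cub: "coframe_metric e u v * coframe_vol e vs = coframe_metric e' u v * coframe_vol e' vs"
    if "length vs = 7" for u v vs
    using g2_cubic_eq[OF P that, of u v] g2_cubic_eq[OF P' that, of u v] by simp
  have gD: "coframe_metric e u v * D = coframe_metric e' u v" for u v
    using cub[of ?F' u v] coframe_vol_dual[OF f'] by (simp add: D_def)
  have "coframe_metric e (f' 1) (f' 1) * D = 1"
    using gD[of "f' 1" "f' 1"] o' by (simp add: orthonormal_def)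
  moreover have "coframe_metric e (f' 1) (f' 1) \<ge> 0"
    unfolding coframe_metric_def by (intro sum_nonneg) simp
  ultimately have D: "D > 0"
    by (metis mult_nonneg_nonpos not_less zero_less_one order_le_less_trans)
  \<comment> \<open>By \<open>gD\<close> the vectors \<open>f' i\<close> have squared length 1 / D
    for the metric of e, so the factor sqrt D makes them orthonormal. Positivity of D came from the
    length of \<open>f' 1\<close>.\<close>
  define h where "h i = sqrt D *\<^sub>R f' i" for i
  have "coframe_metric e (h i) (h j) = D * coframe_metric e (f' i) (f' j)" for i j
    using D by (simp add: h_def linear_cmul[OF gl(1)] linear_cmul[OF gl(2)])
  then have oh: "orthonormal (coframe_metric e) h"
    using o' gD by (simp add: orthonormal_def mult.commute)
  \<comment> \<open>In degree 7 there is only one index set, so frame independence of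
    \<open>frame_inner\<close> says that the volume form is 1 or -1 on each orthonormal frame; no
    determinant enters.\<close>
  have fi: "frame_inner E 7 (coframe_vol e) (coframe_vol e) =
      (coframe_vol e (map E [1, 2, 3, 4, 5, 6, 7]))\<^sup>2" for E
    unfolding frame_inner_def subset_card_7 by (simp add: sorted_list_1_7 power2_eq_square)
  have "(coframe_vol e (map h [1, 2, 3, 4, 5, 6, 7]))\<^sup>2 = 1"
    using frame_inner_indep[OF gl(1) coframe_metric_sym oh o is_form_coframe_vol[OF P] is_form_coframe_vol[OF P]]
    unfolding fi coframe_vol_dual[OF f] by simp
  moreover have "coframe_vol e (map h [1, 2, 3, 4, 5, 6, 7]) = sqrt D ^ 7 * D"
    using is_form_scale_args[OF is_form_coframe_vol[OF P], of ?F' "sqrt D"]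
    by (simp add: h_def D_def)
  ultimately have "(sqrt D ^ 2) ^ 7 * D ^ 2 = 1"
    by (simp add: power_mult_distrib flip: power_mult)
  then have "D ^ 9 = 1" using D by (simp flip: power_add)
  then have D1: "D = 1" using D power_eq_iff_eq_base[of 9 D 1] by simp
  show g: "coframe_metric e u v = coframe_metric e' u v" for u v using gD[of u v] D1 by simp
  show "coframe_vol e vs = coframe_vol e' vs" if "length vs = 7"
    using cub[OF that, of "f 1" "f 1"] g[of "f 1" "f 1"] o by (simp add: orthonormal_def)
qed

lemma g2_metric_eq:
  assumes "g2_coframe P e"
  shows "g2_metric P u v = coframe_metric e u v"
proof -
  have "g2_coframe P (adapted_coframe P)"
    unfolding adapted_coframe_def by (rule someI[of "g2_coframe P", OF assms])
  from g2_coframe_unique(1)[OF this assms] show ?thesis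
    by (simp add: g2_metric_def coframe_metric_def)
qed

lemma g2_vol_eq:
  assumes "g2_coframe P e" "length vs = 7"
  shows "g2_vol P vs = coframe_vol e vs"
proof -
  have "g2_coframe P (adapted_coframe P)"
    unfolding adapted_coframe_def by (rule someI[of "g2_coframe P", OF assms(1)])
  from g2_coframe_unique(2)[OF this assms] show ?thesis
    by (simp add: g2_vol_def coframe_vol_def)
qed

lemma linear_eq_on_dual_frame:
  assumes "dual_frame e f" "g2_coframe P e" "linear h" "linear h'"
    and "\<And>d. d \<in> {1..7} \<Longrightarrow> h (f d) = (h' (f d) :: real)"
  shows "h v = h' v"
proof -
  have v: "v = (\<Sum>i=1..7. e i [v] *\<^sub>R f i)"
    using orthonormal_expand[OF coframe_metric_linear(1)[OF assms(2)] orthonormal_dual_frame[OF assms(1)], of v]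
    by (simp add: coframe_metric_dual[OF assms(1)])
  have "h (\<Sum>i=1..7. e i [v] *\<^sub>R f i) = h' (\<Sum>i=1..7. e i [v] *\<^sub>R f i)"
    by (simp add: linear_sum[OF assms(3)] linear_cmul[OF assms(3)] linear_sum[OF assms(4)]
        linear_cmul[OF assms(4)] assms(5))
  with v show ?thesis by simp
qed

section \<open>The Hodge star in an adapted frame\<close>

lemma is_form_not_distinct:
  assumes "is_form k \<omega>" "length vs = k" "\<not> distinct vs"
  shows "\<omega> vs = 0"
  using assms is_formD_alt[OF assms(1,2)] by (auto simp: distinct_conv_nth)

lemma g2_metric_frame:
  assumes P: "g2_coframe P e"
  shows "g2_metric P = coframe_metric e" "orthonormal (coframe_metric e) (frame (coframe_metric e))"
proof -
  show "g2_metric P = coframe_metric e" by (intro ext g2_metric_eq[OF P])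
  show "orthonormal (coframe_metric e) (frame (coframe_metric e))"
    unfolding frame_def using ex_dual_frame[OF P] orthonormal_dual_frame by (metis someI_ex)
qed

text \<open>Both choices hidden in the star are removed: the coframe behind \<open>g2_vol\<close> by
  uniqueness, the frame of the metric by \<open>frame_inner_indep\<close>.\<close>

lemma hodge_eq:
  assumes P: "g2_coframe P e" and f: "dual_frame e f"
    and \<omega>: "is_form k \<omega>" and vs: "k + length vs = 7"
  shows "hodge (g2_metric P) (g2_vol P) \<omega> vs = frame_inner f k \<omega> (\<lambda>ws. coframe_vol e (ws @ vs))"
proof -
  note g = g2_metric_frame[OF P]
  have k: "7 - length vs = k" using vs by simp
  have "hodge (g2_metric P) (g2_vol P) \<omega> vs =
      frame_inner (frame (coframe_metric e)) k \<omega> (\<lambda>ws. g2_vol P (ws @ vs))"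
    by (simp add: hodge_def frame_inner_def subframe_def g k)
  also have "\<dots> = frame_inner (frame (coframe_metric e)) k \<omega> (\<lambda>ws. coframe_vol e (ws @ vs))"
    by (intro frame_inner_cong refl g2_vol_eq[OF P]) (use vs in simp)
  also have "\<dots> = frame_inner f k \<omega> (\<lambda>ws. coframe_vol e (ws @ vs))"
    using is_form_coframe_vol[OF P] vs
    by (intro frame_inner_indep[OF coframe_metric_linear(1)[OF P] coframe_metric_sym g(2)
          orthonormal_dual_frame[OF f] \<omega>] is_form_append_right) simp
  finally show ?thesis .
qed

lemma is_form_hodge:
  assumes P: "g2_coframe P e" and \<omega>: "is_form k \<omega>" and km: "k + m = 7"
  shows "is_form m (hodge (g2_metric P) (g2_vol P) \<omega>)"
proof -
  obtain f where f: "dual_frame e f" using ex_dual_frame[OF P] by blast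
  have "is_form m (\<lambda>vs. frame_inner f k \<omega> (\<lambda>ws. coframe_vol e (ws @ vs)))"
    unfolding frame_inner_def
  proof (intro is_form_sum is_form_scale)
    fix S assume "S \<in> {S. S \<subseteq> {1..7::nat} \<and> card S = k}"
    then show "is_form m (\<lambda>vs. coframe_vol e (map f (sorted_list_of_set S) @ vs))"
      using is_form_coframe_vol[OF P] km by (intro is_form_append) simp
  qed
  then show ?thesis
    by (rule is_form_cong) (use hodge_eq[OF P f \<omega>] km in simp)
qed

lemma set_1_7: "set [1, 2, 3, 4, 5, 6, 7] = {1..7::nat}"
  by (rule set_eqI) (simp only: mem_1_7_iff list.set insert_iff empty_iff simp_thms)

text \<open>The volume form vanishes on repeated arguments, so of the sum over index sets only the
  complement of js survives.\<close>

lemma hodge_dual_frame: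
  assumes P: "g2_coframe P e" and f: "dual_frame e f" and \<omega>: "is_form k \<omega>"
    and js: "distinct js" "set js \<subseteq> {1..7}" "k + length js = 7"
  defines "cs \<equiv> filter (\<lambda>i. i \<notin> set js) [1, 2, 3, 4, 5, 6, 7]"
  shows "hodge (g2_metric P) (g2_vol P) \<omega> (map f js) =
    \<omega> (map f cs) * coframe_vol e (map f (cs @ js))"
proof -
  let ?C = "{1..7} - set js"
  have setcs: "set cs = ?C"
    unfolding cs_def set_filter set_1_7 by blast
  have cs: "sorted_list_of_set ?C = cs"
    unfolding setcs[symmetric]
    by (rule sorted_list_of_set.idem_if_sorted_distinct) (auto simp: cs_def sorted_wrt_filter)
  have cardC: "card ?C = k"
    using js by (simp add: card_Diff_subset distinct_card)
  let ?t = "\<lambda>S. \<omega> (map f (sorted_list_of_set S)) * coframe_vol e (map f (sorted_list_of_set S) @ map f js)"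
  have "?t S = 0" if "S \<subseteq> {1..7}" "card S = k" "S \<noteq> ?C" for S
  proof -
    have fin: "finite S" using finite_subset[OF that(1)] by simp
    have "S \<inter> set js \<noteq> {}"
    proof
      assume "S \<inter> set js = {}"
      then have "S \<subseteq> ?C" using that(1) by auto
      then have "S = ?C" by (intro card_subset_eq) (use that cardC in auto)
      with that(3) show False by simp
    qed
    then have "\<not> distinct (map f (sorted_list_of_set S) @ map f js)"
      using fin by auto
    then have "coframe_vol e (map f (sorted_list_of_set S) @ map f js) = 0"
      by (rule is_form_not_distinct[OF is_form_coframe_vol[OF P], rotated]) (use that js in simp)
    then show ?thesis by simp
  qed
  then have "(\<Sum>S | S \<subseteq> {1..7} \<and> card S = k. ?t S) = (\<Sum>S\<in>{?C}. ?t S)"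
    using cardC by (intro sum.mono_neutral_right) auto
  then show ?thesis
    using hodge_eq[OF P f \<omega>, of "map f js"] js(3) by (simp add: frame_inner_def cs)
qed

lemma coframe_vol_sort:
  assumes P: "g2_coframe P e" and f: "dual_frame e f"
  defines "V \<equiv> \<lambda>a b c d i j k. coframe_vol e [f a, f b, f c, f d, f i, f j, f k]"
  shows "b < a \<Longrightarrow> V a b c d i j k = - V b a c d i j k"
    "c < b \<Longrightarrow> V a b c d i j k = - V a c b d i j k"
    "d < c \<Longrightarrow> V a b c d i j k = - V a b d c i j k"
    "i < d \<Longrightarrow> V a b c d i j k = - V a b c i d j k"
    "j < i \<Longrightarrow> V a b c d i j k = - V a b c d j i k"
    "k < j \<Longrightarrow> V a b c d i j k = - V a b c d i k j"
    "V 1 2 3 4 5 6 7 = 1"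
  unfolding V_def
  using is_form_swap[OF is_form_coframe_vol[OF P], of "[]" "f b" "f a" "[f c, f d, f i, f j, f k]"]
    is_form_swap[OF is_form_coframe_vol[OF P], of "[f a]" "f c" "f b" "[f d, f i, f j, f k]"]
    is_form_swap[OF is_form_coframe_vol[OF P], of "[f a, f b]" "f d" "f c" "[f i, f j, f k]"]
    is_form_swap[OF is_form_coframe_vol[OF P], of "[f a, f b, f c]" "f i" "f d" "[f j, f k]"]
    is_form_swap[OF is_form_coframe_vol[OF P], of "[f a, f b, f c, f d]" "f j" "f i" "[f k]"]
    is_form_swap[OF is_form_coframe_vol[OF P], of "[f a, f b, f c, f d, f i]" "f k" "f j" "[]"]
    coframe_vol_dual[OF f]
  by simp_all

section \<open>Contractions with \<open>phi0\<close>; Lee form and \<lambda> in components\<close>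

lemma sum_1_7: "(\<Sum>i=1..7. F i) = F 1 + F 2 + F 3 + F 4 + F 5 + F 6 + F (7::nat)" for F :: "nat \<Rightarrow> real"
  by (simp add: eval_nat_numeral One_nat_def)

text \<open>Each index lies in three monomials of the 3-form, so six of the 49 terms survive. These
  rules keep the later component checks small.\<close>

lemma phi0_contract:
  fixes X :: "nat \<Rightarrow> nat \<Rightarrow> real"
  shows
  "(\<Sum>b=1..7. \<Sum>c=1..7. phi0 1 b c * X b c) = X 2 7 - X 7 2 + X 3 5 - X 5 3 - X 4 6 + X 6 4"
  "(\<Sum>b=1..7. \<Sum>c=1..7. phi0 2 b c * X b c) = X 7 1 - X 1 7 - X 3 6 + X 6 3 - X 4 5 + X 5 4"
  "(\<Sum>b=1..7. \<Sum>c=1..7. phi0 3 b c * X b c) = X 5 1 - X 1 5 - X 6 2 + X 2 6 + X 4 7 - X 7 4"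
  "(\<Sum>b=1..7. \<Sum>c=1..7. phi0 4 b c * X b c) = X 1 6 - X 6 1 - X 5 2 + X 2 5 + X 7 3 - X 3 7"
  "(\<Sum>b=1..7. \<Sum>c=1..7. phi0 5 b c * X b c) = X 1 3 - X 3 1 - X 2 4 + X 4 2 + X 6 7 - X 7 6"
  "(\<Sum>b=1..7. \<Sum>c=1..7. phi0 6 b c * X b c) = X 4 1 - X 1 4 - X 2 3 + X 3 2 + X 7 5 - X 5 7"
  "(\<Sum>b=1..7. \<Sum>c=1..7. phi0 7 b c * X b c) = X 1 2 - X 2 1 + X 3 4 - X 4 3 + X 5 6 - X 6 5"
  by (simp_all only: sum_1_7, simp_all add: phi0_sort phi0_values)

text \<open>The contraction with \<phi>_abm \<phi>_mcd, its indices rotated cyclically so that the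
  index not summed in an inner double sum stands first in each \<open>phi0\<close>, as
  \<open>phi0_contract\<close> requires.\<close>

definition phi_contract :: "(nat \<Rightarrow> nat \<Rightarrow> nat \<Rightarrow> real) \<Rightarrow> nat \<Rightarrow> real" where
  "phi_contract X d =
     (\<Sum>m=1..7. \<Sum>c=1..7. phi0 d m c * (\<Sum>a=1..7. \<Sum>b=1..7. phi0 m a b * X a b c))"

definition phi_trace :: "(nat \<Rightarrow> nat \<Rightarrow> nat \<Rightarrow> real) \<Rightarrow> real" where
  "phi_trace X = (\<Sum>a=1..7. \<Sum>b=1..7. \<Sum>c=1..7. phi0 a b c * X a b c)"

lemma phi_contract_add:
  "phi_contract (\<lambda>a b c. X a b c / 2 + Y a b c) d = phi_contract X d / 2 + phi_contract Y d"
  unfolding phi_contract_def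
  by (simp add: distrib_left sum.distrib sum_divide_distrib sum_distrib_left)

lemma phi_trace_add:
  "phi_trace (\<lambda>a b c. X a b c / 2 + Y a b c) = phi_trace X / 2 + phi_trace Y"
  unfolding phi_trace_def
  by (simp add: distrib_left sum.distrib sum_divide_distrib sum_distrib_left)

lemma wedge_3_Cons:
  "wedge 3 \<alpha> \<beta> (v # vs) = wedge 2 (\<lambda>ws. \<alpha> (v # ws)) \<beta> vs - wedge 3 \<alpha> (\<lambda>ws. \<beta> (v # ws)) vs"
  using wedge_Suc_Cons[of 2 \<alpha> \<beta> v vs] by simp

lemma wedge_3_Nil: "wedge 3 \<alpha> \<beta> [] = 0"
  by (simp add: numeral_3_eq_3)

text \<open>Sums over k-subsets indexed by a list, for the Pascal-type recursion
  \<open>subset_sum_Cons\<close>; simp can thereby expand a scalar product of 4-forms into its 35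
  terms.\<close>

definition subset_sum :: "nat list \<Rightarrow> nat \<Rightarrow> (nat list \<Rightarrow> real) \<Rightarrow> real" where
  "subset_sum xs k F = (\<Sum>S | S \<subseteq> set xs \<and> card S = k. F (sorted_list_of_set S))"

lemma subset_sum_0: "subset_sum xs 0 F = F []"
proof -
  have "{S. S \<subseteq> set xs \<and> card S = 0} = {{}}" by (auto dest: finite_subset[OF _ finite_set])
  then show ?thesis by (simp add: subset_sum_def)
qed

lemma subset_sum_Nil: "subset_sum [] (Suc k) F = 0"
  by (auto simp: subset_sum_def intro!: sum.neutral)

lemma subset_sum_Cons:
  assumes "sorted_wrt (<) (x # xs)"
  shows "subset_sum (x # xs) (Suc k) F = subset_sum xs k (\<lambda>l. F (x # l)) + subset_sum xs (Suc k) F"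
proof -
  have x: "x < y" if "y \<in> set xs" for y using assms that by simp
  then have nx: "x \<notin> set xs" by blast
  have fin: "finite S" if "S \<subseteq> set xs" for S using finite_subset[OF that] by simp
  have srt: "sorted_list_of_set (insert x S) = x # sorted_list_of_set S" if "S \<subseteq> set xs" for S
    using x that fin[OF that]
    by (subst sorted_list_of_set_insert) (fastforce intro!: insort_is_Cons simp: less_imp_le)+
  have eq: "{S. S \<subseteq> set (x # xs) \<and> card S = Suc k} =
      insert x ` {S. S \<subseteq> set xs \<and> card S = k} \<union> {S. S \<subseteq> set xs \<and> card S = Suc k}"
    (is "?L = ?A \<union> ?B")
  proof (rule set_eqI, rule iffI)
    fix S assume S: "S \<in> ?L"
    show "S \<in> ?A \<union> ?B"
    proof (cases "x \<in> S")
      case True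
      have "finite S" using S finite_subset[of S "set (x # xs)"] by simp
      then have "S - {x} \<subseteq> set xs \<and> card (S - {x}) = k" "S = insert x (S - {x})"
        using S True by auto
      then show ?thesis by blast
    next
      case False
      then show ?thesis using S by auto
    qed
  next
    fix S assume "S \<in> ?A \<union> ?B"
    then show "S \<in> ?L" using nx fin by (auto simp: card_insert_if)
  qed
  have inj: "inj_on (insert x) {S. S \<subseteq> set xs \<and> card S = k}"
  proof (rule inj_onI)
    fix S S' assume "S \<in> {S. S \<subseteq> set xs \<and> card S = k}" "S' \<in> {S. S \<subseteq> set xs \<and> card S = k}"
      and eq: "insert x S = insert x S'"
    then have "x \<notin> S" "x \<notin> S'" using nx by auto
    with eq show "S = S'" by (simp add: insert_ident)
  qed
  have A: "(\<Sum>S\<in>?A. F (sorted_list_of_set S)) = (\<Sum>S | S \<subseteq> set xs \<and> card S = k. F (x # sorted_list_of_set S))"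
    unfolding sum.reindex[OF inj] by (intro sum.cong) (auto simp: srt)
  have "?A \<inter> ?B = {}" using nx by blast
  then show ?thesis
    unfolding subset_sum_def eq by (subst sum.union_disjoint) (simp_all add: A)
qed

lemma frame_inner_subset_sum:
  "frame_inner E k \<alpha> \<beta> = subset_sum [1, 2, 3, 4, 5, 6, 7] k (\<lambda>l. \<alpha> (map E l) * \<beta> (map E l))"
  by (simp only: frame_inner_def subset_sum_def set_1_7)

text \<open>The recursion for the degrees 1 to 4, with numerals in place of Suc.\<close>

lemmas subset_sum_numeral = subset_sum_0
  subset_sum_Cons[where k = 0, folded One_nat_def] subset_sum_Nil[where k = 0, folded One_nat_def]
  subset_sum_Cons[where k = 1, unfolded Suc_1] subset_sum_Nil[where k = 1, unfolded Suc_1]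
  subset_sum_Cons[where k = 2, simplified] subset_sum_Nil[where k = 2, simplified]
  subset_sum_Cons[where k = 3, simplified] subset_sum_Nil[where k = 3, simplified]

text \<open>Here \<open>t\<close> stands for the torsion and \<open>w\<close> for \<open>d\<phi>\<close>, which \<open>wt\<close> expresses through the torsion of a
  connection preserving \<open>\<phi>\<close>.\<close>

locale adapted_frame =
  fixes P :: form and e :: "nat \<Rightarrow> form" and f :: "nat \<Rightarrow> coord"
    and w :: form and t :: "nat \<Rightarrow> nat \<Rightarrow> nat \<Rightarrow> real"
  assumes P: "g2_coframe P e" and f: "dual_frame e f"
    and w: "is_form 4 w"
    and wt: "\<And>a b c d. a \<in> {1..7} \<Longrightarrow> b \<in> {1..7} \<Longrightarrow> c \<in> {1..7} \<Longrightarrow> d \<in> {1..7} \<Longrightarrow>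
      w [f a, f b, f c, f d] = (\<Sum>m=1..7. t a b m * phi0 m c d - t a c m * phi0 m b d
        + t a d m * phi0 m b c + t b c m * phi0 m a d - t b d m * phi0 m a c + t c d m * phi0 m a b)"
    and t_swap: "\<And>a b c. t b a c = - t a b c" "\<And>a b c. t a c b = - t a b c"
begin

lemma t_same: "t a a c = 0" "t a b b = 0" "t a b a = 0"
  using t_swap(1)[of a a c] t_swap(2)[of a b b] t_swap(1)[of a b a] t_swap(2)[of a a b] t_swap(2)[of b a a]
  by simp_all

lemma t_sort: "a < b \<Longrightarrow> t b a c = - t a b c" "b < c \<Longrightarrow> t a c b = - t a b c"
  by (rule t_swap)+

lemma dual3:
  "a \<in> {1..7} \<Longrightarrow> b \<in> {1..7} \<Longrightarrow> c \<in> {1..7} \<Longrightarrow> distinct [a, b, c] \<Longrightarrow>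
    hodge (g2_metric P) (g2_vol P) w [f a, f b, f c] =
    (let cs = filter (\<lambda>i. i \<notin> set [a, b, c]) [1, 2, 3, 4, 5, 6, 7]
     in w (map f cs) * coframe_vol e (map f (cs @ [a, b, c])))"
  using hodge_dual_frame[OF P f w, of "[a, b, c]"] by (simp add: Let_def del: distinct.simps filter.simps)

lemma dual4:
  "a \<in> {1..7} \<Longrightarrow> b \<in> {1..7} \<Longrightarrow> c \<in> {1..7} \<Longrightarrow> d \<in> {1..7} \<Longrightarrow> distinct [a, b, c, d] \<Longrightarrow>
    hodge (g2_metric P) (g2_vol P) P [f a, f b, f c, f d] =
    (let cs = filter (\<lambda>i. i \<notin> set [a, b, c, d]) [1, 2, 3, 4, 5, 6, 7]
     in P (map f cs) * coframe_vol e (map f (cs @ [a, b, c, d])))"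
  using hodge_dual_frame[OF P f g2_coframe_is_form[OF P], of "[a, b, c, d]"]
  by (simp add: Let_def del: distinct.simps filter.simps)

text \<open>The outer star picks the component complementary to d, the inner star turns components
  of w into those of a 3-form, and \<open>wt\<close> brings in t. The factor -1/2 combines with the
  -1/3 of \<open>lee_form\<close> to the 1/6 in \<open>lee_form_frame\<close>.\<close>

lemma star_wedge_dual:
  assumes "d \<in> {1..7}"
  shows "hodge (g2_metric P) (g2_vol P) (wedge 3 (hodge (g2_metric P) (g2_vol P) w) P) [f d] =
    - phi_contract t d / 2"
proof -
  have "is_form (3 + 3) (wedge 3 (hodge (g2_metric P) (g2_vol P) w) P)"
    by (intro is_form_wedge is_form_hodge[OF P w] g2_coframe_is_form[OF P]) simp
  from hodge_dual_frame[OF P f this, of "[d]"] assms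
  have h: "hodge (g2_metric P) (g2_vol P) (wedge 3 (hodge (g2_metric P) (g2_vol P) w) P) [f d] =
    (let cs = filter (\<lambda>i. i \<notin> set [d]) [1, 2, 3, 4, 5, 6, 7]
     in wedge 3 (hodge (g2_metric P) (g2_vol P) w) P (map f cs) * coframe_vol e (map f (cs @ [d])))"
    by (simp add: Let_def del: filter.simps)
  note c = g2_dual_frame_components[OF P f]
  show ?thesis
    unfolding h using assms unfolding mem_1_7_iff
    by (elim disjE)
       (simp_all add: dual3 c wedge_3_Cons wedge_3_Nil wedge_2_Cons wedge_2_Nil wedge_1_Cons wedge_1_Nil
         coframe_vol_sort[OF P f] wt sum_1_7 phi0_sort phi0_values phi_contract_def phi0_contract
         t_same t_sort)
qed

text \<open>In the frame f the star of P has seven nonzero components, one for each monomial of P;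
  \<open>wt\<close> expresses the matching components of w through t.\<close>

lemma inner_star:
  "form_inner (g2_metric P) 4 w (hodge (g2_metric P) (g2_vol P) P) = phi_trace t"
proof -
  note g = g2_metric_frame[OF P] 
  note c = g2_dual_frame_components[OF P f]
  have "form_inner (g2_metric P) 4 w (hodge (g2_metric P) (g2_vol P) P) =
      frame_inner (frame (coframe_metric e)) 4 w (hodge (g2_metric P) (g2_vol P) P)"
    by (simp add: form_inner_def frame_inner_def subframe_def g)
  also have "\<dots> = frame_inner f 4 w (hodge (g2_metric P) (g2_vol P) P)"
    by (intro frame_inner_indep[OF coframe_metric_linear(1)[OF P] coframe_metric_sym g(2)
          orthonormal_dual_frame[OF f] w] is_form_hodge[OF P g2_coframe_is_form[OF P]]) simp
  also have "\<dots> = phi_trace t"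
    unfolding frame_inner_subset_sum phi_trace_def
      sum_1_7[of "\<lambda>a. \<Sum>b=1..7. \<Sum>c=1..7. phi0 a b c * t a b c"] phi0_contract
    by (simp add: subset_sum_numeral dual4 c coframe_vol_sort[OF P f] wt phi0_sort phi0_values
        sum_1_7 t_same t_sort)
  finally show ?thesis .
qed

end

section \<open>Contractions with the 3-form\<close>

text \<open>The Lie algebra of G_2 has codimension 7 in so(7), so seven triples (a, b, c) yield all
  its equations. The d-th relation says that r is orthogonal to \<iota>_d of the 3-form. Each is
  solved for one entry in order to serve as a rewrite rule.\<close>

lemma g2_derivation_relations:
  fixes r :: "nat \<Rightarrow> nat \<Rightarrow> real"
  assumes skew: "\<And>a b. r b a = - r a b"
    and der: "\<And>a b c. a \<in> {1..7} \<Longrightarrow> b \<in> {1..7} \<Longrightarrow> c \<in> {1..7} \<Longrightarrow>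
      (\<Sum>x=1..7. r a x * phi0 x b c + r b x * phi0 a x c + r c x * phi0 a b x) = 0"
  shows "r 2 7 = r 4 6 - r 3 5" "r 1 7 = - r 3 6 - r 4 5" "r 1 5 = r 2 6 + r 4 7"
    "r 1 6 = r 3 7 - r 2 5" "r 1 3 = r 2 4 - r 6 7" "r 1 4 = - r 2 3 - r 5 7"
    "r 1 2 = - r 3 4 - r 5 6"
proof -
  have same: "r a a = 0" for a using skew[of a a] by simp
  have sort: "r b a = - r a b" if "a < b" for a b using skew .
  note s = sum_1_7 phi0_sort phi0_values same sort
  show "r 2 7 = r 4 6 - r 3 5" using der[of 2 3 4] by (simp add: s)
  show "r 1 7 = - r 3 6 - r 4 5" using der[of 1 3 4] by (simp add: s)
  show "r 1 5 = r 2 6 + r 4 7" using der[of 1 2 4] by (simp add: s)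
  show "r 1 6 = r 3 7 - r 2 5" using der[of 1 2 3] by (simp add: s)
  show "r 1 3 = r 2 4 - r 6 7" using der[of 1 2 6] by (simp add: s)
  show "r 1 4 = - r 2 3 - r 5 7" using der[of 1 2 5] by (simp add: s)
  show "r 1 2 = - r 3 4 - r 5 6" using der[of 1 3 6] by (simp add: s)
qed

text \<open>Each matrix \<open>r i\<close> lies in the Lie algebra of G_2, hence is orthogonal to
  \<iota>_i of the 3-form; this kills each cyclic term of the trace. In the contraction, once
  \<open>rel\<close> has eliminated seven entries of each \<open>r i\<close>, only the trace over
  the first two indices is left. For r from the curvature that trace is the Ricci tensor.\<close>

lemma phi_contract_cyclic:
  fixes r :: "nat \<Rightarrow> nat \<Rightarrow> nat \<Rightarrow> real"
  assumes skew: "\<And>i a b. r i b a = - r i a b"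
    and der: "\<And>i a b c. i \<in> {1..7} \<Longrightarrow> a \<in> {1..7} \<Longrightarrow> b \<in> {1..7} \<Longrightarrow> c \<in> {1..7} \<Longrightarrow>
      (\<Sum>x=1..7. r i a x * phi0 x b c + r i b x * phi0 a x c + r i c x * phi0 a b x) = 0"
  shows "d \<in> {1..7} \<Longrightarrow> phi_contract (\<lambda>a b c. r a b c + r b c a + r c a b) d = - 6 * (\<Sum>a=1..7. r a a d)"
    and "phi_trace (\<lambda>a b c. r a b c + r b c a + r c a b) = 0"
proof -
  have same: "r i a a = 0" for i a using skew[of i a a] by simp
  have sort: "r i b a = - r i a b" if "a < b" for i a b using skew .
  have rel: "r i 2 7 = r i 4 6 - r i 3 5" "r i 1 7 = - r i 3 6 - r i 4 5" "r i 1 5 = r i 2 6 + r i 4 7"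
    "r i 1 6 = r i 3 7 - r i 2 5" "r i 1 3 = r i 2 4 - r i 6 7" "r i 1 4 = - r i 2 3 - r i 5 7"
    "r i 1 2 = - r i 3 4 - r i 5 6" if "i \<in> {1..7}" for i
    using g2_derivation_relations[of "r i", OF skew der[OF that]] by simp_all
  show "d \<in> {1..7} \<Longrightarrow> phi_contract (\<lambda>a b c. r a b c + r b c a + r c a b) d = - 6 * (\<Sum>a=1..7. r a a d)"
    unfolding mem_1_7_iff
    by (elim disjE)
       (simp_all only: phi_contract_def phi0_contract,
        simp_all add: sum_1_7 phi0_contract same sort rel)
  show "phi_trace (\<lambda>a b c. r a b c + r b c a + r c a b) = 0"
    unfolding phi_trace_def
      sum_1_7[of "\<lambda>a. \<Sum>b=1..7. \<Sum>c=1..7. phi0 a b c * _ a b c"] phi0_contract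
    by (simp add: same sort rel)
qed

text \<open>The pairs (j, d) give 49 equations, each a signed sum of at most four components. They
  decouple by the index k that completes j and d to a triple of the 3-form, with j = d as a block of
  its own, so that only systems in four or seven unknowns have to be solved.\<close>

lemma four_form_phi_contract:
  fixes W :: "nat \<Rightarrow> nat \<Rightarrow> nat \<Rightarrow> nat \<Rightarrow> real"
  assumes skew: "\<And>a b c d. W b a c d = - W a b c d" "\<And>a b c d. W a c b d = - W a b c d"
      "\<And>a b c d. W a b d c = - W a b c d"
    and 0: "\<forall>j\<in>{1..7}. \<forall>d\<in>{1..7}. phi_contract (W j) d = 0"
  shows "W 1 2 3 4 = 0" "W 1 2 3 5 = 0" "W 1 2 3 6 = 0" "W 1 2 3 7 = 0" "W 1 2 4 5 = 0"
    "W 1 2 4 6 = 0" "W 1 2 4 7 = 0" "W 1 2 5 6 = 0" "W 1 2 5 7 = 0" "W 1 2 6 7 = 0"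
    "W 1 3 4 5 = 0" "W 1 3 4 6 = 0" "W 1 3 4 7 = 0" "W 1 3 5 6 = 0" "W 1 3 5 7 = 0"
    "W 1 3 6 7 = 0" "W 1 4 5 6 = 0" "W 1 4 5 7 = 0" "W 1 4 6 7 = 0" "W 1 5 6 7 = 0"
    "W 2 3 4 5 = 0" "W 2 3 4 6 = 0" "W 2 3 4 7 = 0" "W 2 3 5 6 = 0" "W 2 3 5 7 = 0"
    "W 2 3 6 7 = 0" "W 2 4 5 6 = 0" "W 2 4 5 7 = 0" "W 2 4 6 7 = 0" "W 2 5 6 7 = 0"
    "W 3 4 5 6 = 0" "W 3 4 5 7 = 0" "W 3 4 6 7 = 0" "W 3 5 6 7 = 0" "W 4 5 6 7 = 0"
proof -
  have same: "W a a c d = 0" "W a b b d = 0" "W a b c c = 0" for a b c d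
    using skew(1)[of a a c d] skew(2)[of a b b d] skew(3)[of a b c c] by simp_all
  have same': "W a b a d = 0" "W a b c b = 0" "W a b c a = 0" for a b c d
    using same skew(2)[of a a b d] skew(3)[of a b b c] skew(1)[of b a c a] skew(2)[of b a c a]
    by simp_all
  have sort: "a < b \<Longrightarrow> W b a c d = - W a b c d" "b < c \<Longrightarrow> W a c b d = - W a b c d"
     "c < d \<Longrightarrow> W a b d c = - W a b c d" for a b c d
    by (rule skew)+
  have eq: "W j 2 3 4 + W j 2 5 6 + W j 3 6 7 + W j 4 5 7 = 0"
    "W j 1 3 4 + W j 1 5 6 - W j 3 5 7 + W j 4 6 7 = 0"
    "W j 1 2 4 - W j 1 6 7 - W j 2 5 7 + W j 4 5 6 = 0"
    "W j 1 2 3 + W j 1 5 7 - W j 2 6 7 + W j 3 5 6 = 0"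
    "W j 1 2 6 + W j 1 4 7 + W j 2 3 7 + W j 3 4 6 = 0"
    "W j 1 2 5 - W j 1 3 7 + W j 2 4 7 + W j 3 4 5 = 0"
    "W j 1 3 6 + W j 1 4 5 + W j 2 3 5 - W j 2 4 6 = 0" if "j \<in> {1..7}" for j
    using 0[rule_format, of j 1, OF that, unfolded phi_contract_def phi0_contract]
      0[rule_format, of j 2, OF that, unfolded phi_contract_def phi0_contract]
      0[rule_format, of j 3, OF that, unfolded phi_contract_def phi0_contract]
      0[rule_format, of j 4, OF that, unfolded phi_contract_def phi0_contract]
      0[rule_format, of j 5, OF that, unfolded phi_contract_def phi0_contract]
      0[rule_format, of j 6, OF that, unfolded phi_contract_def phi0_contract]
      0[rule_format, of j 7, OF that, unfolded phi_contract_def phi0_contract]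
     
    by (simp_all add: phi0_contract sort same same')
  note s = same same' sort
  \<comment> \<open>The block j = d: it contains exactly the seven components whose indices are
    complementary to a triple of the 3-form.\<close>
  show "W 1 2 3 4 = 0" "W 1 2 5 6 = 0" "W 1 3 6 7 = 0" "W 1 4 5 7 = 0" "W 2 3 5 7 = 0" "W 2 4 6 7 = 0" "W 3 4 5 6 = 0"
    using eq(1)[of 1] eq(2)[of 2] eq(3)[of 3] eq(4)[of 4] eq(5)[of 5] eq(6)[of 6] eq(7)[of 7]
    by (simp_all add: s)
  \<comment> \<open>From here on each block belongs to one k: the six equations whose j and d
    complete k to a triple of the 3-form determine four components.\<close>
  show "W 1 2 3 5 = 0" "W 1 2 4 6 = 0" "W 2 3 4 7 = 0" "W 2 5 6 7 = 0"
    using eq(7)[of 1] eq(6)[of 3] eq(5)[of 4] eq(4)[of 5] eq(3)[of 6] eq(1)[of 7]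
    by (simp_all add: s)
  show "W 1 2 3 6 = 0" "W 1 2 4 5 = 0" "W 1 3 4 7 = 0" "W 1 5 6 7 = 0"
    using eq(7)[of 2] eq(5)[of 3] eq(6)[of 4] eq(3)[of 5] eq(4)[of 6] eq(2)[of 7]
    by (simp_all add: s)
  show "W 1 2 3 7 = 0" "W 1 3 4 6 = 0" "W 2 3 4 5 = 0" "W 3 5 6 7 = 0"
    using eq(5)[of 1] eq(6)[of 2] eq(7)[of 4] eq(1)[of 5] eq(2)[of 6] eq(4)[of 7]
    by (simp_all add: s)
  show "W 1 2 4 7 = 0" "W 1 3 4 5 = 0" "W 2 3 4 6 = 0" "W 4 5 6 7 = 0"
    using eq(6)[of 1] eq(5)[of 2] eq(7)[of 3] eq(2)[of 5] eq(1)[of 6] eq(3)[of 7]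
    by (simp_all add: s)
  show "W 1 2 5 7 = 0" "W 1 4 5 6 = 0" "W 2 3 5 6 = 0" "W 3 4 5 7 = 0"
    using eq(3)[of 1] eq(4)[of 2] eq(1)[of 3] eq(2)[of 4] eq(7)[of 6] eq(6)[of 7]
    by (simp_all add: s)
  show "W 1 2 6 7 = 0" "W 1 3 5 6 = 0" "W 2 4 5 6 = 0" "W 3 4 6 7 = 0"
    using eq(4)[of 1] eq(3)[of 2] eq(2)[of 3] eq(1)[of 4] eq(7)[of 5] eq(5)[of 7]
    by (simp_all add: s)
  show "W 1 3 5 7 = 0" "W 1 4 6 7 = 0" "W 2 3 6 7 = 0" "W 2 4 5 7 = 0"
    using eq(2)[of 1] eq(1)[of 2] eq(4)[of 3] eq(3)[of 4] eq(6)[of 5] eq(5)[of 6]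
    by (simp_all add: s)
qed

section \<open>Calculus\<close>

text \<open>The mean value theorem is applied to the increment in direction v as a function of the
  step along u, and then differentiability of \<open>H y u\<close> at x is used. The second
  difference is symmetric in u and v; using the estimate twice gives
  \<open>second_derivative_symmetric\<close> from differentiability at the single point x, which is
  available for g and \<phi> in a chart.\<close>

lemma second_difference:
  fixes h :: "'a::real_normed_vector \<Rightarrow> real"
  assumes U: "open U" "x \<in> U" and d: "\<And>y. y \<in> U \<Longrightarrow> (h has_derivative H y) (at y)"
    and u: "((\<lambda>y. H y u) has_derivative Hu) (at x)" and \<epsilon>: "\<epsilon> > 0"
  shows "\<exists>\<delta>>0. \<forall>s. 0 < s \<and> s < \<delta> \<longrightarrow>
    \<bar>h (x + s *\<^sub>R u + s *\<^sub>R v) - h (x + s *\<^sub>R u) - h (x + s *\<^sub>R v) + h x - s\<^sup>2 * Hu v\<bar> \<le> \<epsilon> * s\<^sup>2"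
proof -
  \<comment> \<open>C bounds (norm z1 + norm z2) / s for the two displacements compared below; the
    summand 1 keeps it positive when u = v = 0.\<close>
  define C where "C = 2 * norm u + norm v + 1"
  have C: "C > 0" by (simp add: C_def add_nonneg_pos)
  interpret Hu: bounded_linear Hu using u by (rule has_derivative_bounded_linear)
  from U obtain \<rho> where \<rho>: "\<rho> > 0" "ball x \<rho> \<subseteq> U" by (meson open_contains_ball)
  have "\<epsilon> / C > 0" using \<epsilon> C by simp
  then obtain d1 where d1: "d1 > 0"
    "\<And>y. norm (y - x) < d1 \<Longrightarrow> norm (H y u - H x u - Hu (y - x)) \<le> \<epsilon> / C * norm (y - x)"
    using u unfolding has_derivative_at_alt by blast
  define \<delta> where "\<delta> = min \<rho> d1 / C"
  have \<delta>: "\<delta> > 0" using \<rho> d1 C by (simp add: \<delta>_def)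
  show ?thesis
  proof (intro exI conjI allI impI)
    show "\<delta> > 0" by fact
    fix s :: real assume s: "0 < s \<and> s < \<delta>"
    then have sC: "s * C < min \<rho> d1" using C by (simp add: \<delta>_def pos_less_divide_eq)
    have near: "norm (\<sigma> *\<^sub>R u + \<tau> *\<^sub>R v) < min \<rho> d1" if "0 \<le> \<sigma>" "\<sigma> \<le> s" "0 \<le> \<tau>" "\<tau> \<le> s" for \<sigma> \<tau>
    proof -
      have "norm (\<sigma> *\<^sub>R u + \<tau> *\<^sub>R v) \<le> norm (\<sigma> *\<^sub>R u) + norm (\<tau> *\<^sub>R v)" by (rule norm_triangle_ineq)
      also have "\<dots> \<le> s * norm u + s * norm v"
        using that by (intro add_mono) (auto intro: mult_right_mono)
      also have "\<dots> \<le> s * C"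
        using s by (simp add: C_def algebra_simps)
      finally show ?thesis using sC by simp
    qed
    have inU: "x + \<sigma> *\<^sub>R u + \<tau> *\<^sub>R v \<in> U" if "0 \<le> \<sigma>" "\<sigma> \<le> s" "0 \<le> \<tau>" "\<tau> \<le> s" for \<sigma> \<tau>
    proof -
      have "dist x (x + \<sigma> *\<^sub>R u + \<tau> *\<^sub>R v) < \<rho>"
        using near[OF that] norm_minus_cancel[of "\<sigma> *\<^sub>R u + \<tau> *\<^sub>R v"]
        by (simp add: dist_norm add.assoc)
      then show ?thesis using \<rho> by auto
    qed
    define k where "k \<sigma> = h (x + \<sigma> *\<^sub>R u + s *\<^sub>R v) - h (x + \<sigma> *\<^sub>R u)" for \<sigma>
    have "\<exists>\<xi>\<in>{0<..<s}. k s - k 0 =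
        (\<lambda>\<sigma> r. H (x + \<sigma> *\<^sub>R u + s *\<^sub>R v) (r *\<^sub>R u) - H (x + \<sigma> *\<^sub>R u) (r *\<^sub>R u)) \<xi> (s - 0)"
    proof (rule mvt_simple)
      show "0 < s" using s by simp
      fix \<sigma> assume \<sigma>: "0 \<le> \<sigma>" "\<sigma> \<le> s"
      have d': "(h has_derivative H (x + \<sigma> *\<^sub>R u + \<tau> *\<^sub>R v)) (at (x + \<sigma> *\<^sub>R u + \<tau> *\<^sub>R v))"
        if "0 \<le> \<tau>" "\<tau> \<le> s" for \<tau>
        by (rule d[OF inU]) (use \<sigma> that in auto)
      have "((\<lambda>\<sigma>. h (x + \<sigma> *\<^sub>R u + \<tau> *\<^sub>R v)) has_derivative
          (\<lambda>r. H (x + \<sigma> *\<^sub>R u + \<tau> *\<^sub>R v) (r *\<^sub>R u))) (at \<sigma> within {0..s})"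
        if "0 \<le> \<tau>" "\<tau> \<le> s" for \<tau>
        by (rule has_derivative_compose[of "\<lambda>\<sigma>. x + \<sigma> *\<^sub>R u + \<tau> *\<^sub>R v" _ _ _ h, OF _ d'[OF that]])
           (auto intro!: derivative_eq_intros)
      from this[of s] this[of 0] s
      show "(k has_derivative (\<lambda>r. H (x + \<sigma> *\<^sub>R u + s *\<^sub>R v) (r *\<^sub>R u) - H (x + \<sigma> *\<^sub>R u) (r *\<^sub>R u)))
          (at \<sigma> within {0..s})"
        unfolding k_def by (intro has_derivative_diff) auto
    qed
    then obtain \<xi> where \<xi>: "0 < \<xi>" "\<xi> < s"
      "k s - k 0 = H (x + \<xi> *\<^sub>R u + s *\<^sub>R v) (s *\<^sub>R u) - H (x + \<xi> *\<^sub>R u) (s *\<^sub>R u)"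
      by auto
    have scale: "H y (s *\<^sub>R u) = s * H y u" if "y \<in> U" for y
      using linear_cmul[OF has_derivative_linear[OF d[OF that]]] by simp
    define z1 z2 where "z1 = \<xi> *\<^sub>R u + s *\<^sub>R v" and "z2 = \<xi> *\<^sub>R u"
    have kk: "k s - k 0 = s * (H (x + z1) u - H (x + z2) u)"
      using \<xi> inU[of \<xi> s] inU[of \<xi> 0] by (simp add: z1_def z2_def scale right_diff_distrib add.assoc)
    have n1: "\<bar>H (x + z1) u - H x u - Hu z1\<bar> \<le> \<epsilon> / C * norm z1"
      using d1(2)[of "x + z1"] near[of \<xi> s] \<xi> by (simp add: z1_def)
    have n2: "\<bar>H (x + z2) u - H x u - Hu z2\<bar> \<le> \<epsilon> / C * norm z2"
      using d1(2)[of "x + z2"] near[of \<xi> 0] \<xi> by (simp add: z2_def)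
    have "Hu z1 - Hu z2 = s * Hu v" by (simp add: z1_def z2_def Hu.add Hu.scaleR)
    then have "\<bar>H (x + z1) u - H (x + z2) u - s * Hu v\<bar> \<le> \<epsilon> / C * (norm z1 + norm z2)"
      using n1 n2 by (simp add: distrib_left)
    also have "\<dots> \<le> \<epsilon> / C * (s * C)"
    proof (rule mult_left_mono)
      have "norm z1 \<le> norm (\<xi> *\<^sub>R u) + norm (s *\<^sub>R v)" unfolding z1_def by (rule norm_triangle_ineq)
      then have "norm z1 + norm z2 \<le> s * norm u + s * norm v + s * norm u"
        using \<xi> s mult_right_mono[of \<xi> s "norm u"] by (simp add: z2_def)
      also have "\<dots> \<le> s * C" using s by (simp add: C_def algebra_simps)
      finally show "norm z1 + norm z2 \<le> s * C" .
    qed (use \<epsilon> C in auto)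
    also have "\<dots> = \<epsilon> * s" using C by simp
    finally have *: "\<bar>H (x + z1) u - H (x + z2) u - s * Hu v\<bar> \<le> \<epsilon> * s" .
    have "k s - k 0 - s\<^sup>2 * Hu v = s * (H (x + z1) u - H (x + z2) u - s * Hu v)"
      unfolding kk by (simp add: power2_eq_square algebra_simps)
    then have "\<bar>k s - k 0 - s\<^sup>2 * Hu v\<bar> \<le> s * (\<epsilon> * s)"
      using mult_left_mono[OF *, of s] s by (simp add: abs_mult)
    then show "\<bar>h (x + s *\<^sub>R u + s *\<^sub>R v) - h (x + s *\<^sub>R u) - h (x + s *\<^sub>R v) + h x - s\<^sup>2 * Hu v\<bar> \<le> \<epsilon> * s\<^sup>2"
      by (simp add: k_def power2_eq_square algebra_simps)
  qed
qed

lemma second_derivative_symmetric: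
  fixes h :: "'a::real_normed_vector \<Rightarrow> real"
  assumes U: "open U" "x \<in> U" and d: "\<And>y. y \<in> U \<Longrightarrow> (h has_derivative H y) (at y)"
    and u: "((\<lambda>y. H y u) has_derivative Hu) (at x)"
    and v: "((\<lambda>y. H y v) has_derivative Hv) (at x)"
  shows "Hu v = Hv u"
proof -
  have le: "\<bar>Hu v - Hv u\<bar> \<le> 0 + \<epsilon>" if "\<epsilon> > 0" for \<epsilon>
  proof -
    have \<epsilon>2: "\<epsilon> / 2 > 0" using that by simp
    obtain \<delta>1 where 1: "\<delta>1 > 0" "\<And>s. 0 < s \<and> s < \<delta>1 \<Longrightarrow>
      \<bar>h (x + s *\<^sub>R u + s *\<^sub>R v) - h (x + s *\<^sub>R u) - h (x + s *\<^sub>R v) + h x - s\<^sup>2 * Hu v\<bar> \<le> \<epsilon> / 2 * s\<^sup>2"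
      using second_difference[OF U d u \<epsilon>2, of v] by auto
    obtain \<delta>2 where 2: "\<delta>2 > 0" "\<And>s. 0 < s \<and> s < \<delta>2 \<Longrightarrow>
      \<bar>h (x + s *\<^sub>R v + s *\<^sub>R u) - h (x + s *\<^sub>R v) - h (x + s *\<^sub>R u) + h x - s\<^sup>2 * Hv u\<bar> \<le> \<epsilon> / 2 * s\<^sup>2"
      using second_difference[OF U d v \<epsilon>2, of u] by auto
    define s where "s = min \<delta>1 \<delta>2 / 2"
    have s: "0 < s" "s < \<delta>1" "s < \<delta>2" using 1 2 by (auto simp: s_def)
    have comm: "x + s *\<^sub>R v + s *\<^sub>R u = x + s *\<^sub>R u + s *\<^sub>R v" by simp
    have "\<bar>s\<^sup>2 * Hu v - s\<^sup>2 * Hv u\<bar> \<le> \<epsilon> / 2 * s\<^sup>2 + \<epsilon> / 2 * s\<^sup>2"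
      using 1(2)[of s] 2(2)[of s] s unfolding comm by linarith
    then have "s\<^sup>2 * \<bar>Hu v - Hv u\<bar> \<le> s\<^sup>2 * \<epsilon>"
      by (simp add: abs_mult mult.commute[of \<epsilon>] flip: right_diff_distrib)
    then show ?thesis using s by simp
  qed
  have "\<bar>Hu v - Hv u\<bar> \<le> 0" by (rule field_le_epsilon[OF le])
  then show ?thesis by simp
qed

lemma linear_family_derivative:
  fixes B :: "'a::real_normed_vector \<Rightarrow> 'b::real_vector \<Rightarrow> 'c::real_normed_vector"
  assumes U: "open U" "x \<in> U" and lin: "\<And>y. y \<in> U \<Longrightarrow> linear (B y)"
    and B: "\<And>v. ((\<lambda>y. B y v) has_derivative B' v) (at x)"
  shows "linear (\<lambda>v. B' v u)"
proof (rule linearI)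
  fix v w
  have "((\<lambda>y. B y (v + w)) has_derivative (\<lambda>u. B' v u + B' w u)) (at x)"
    by (rule has_derivative_transform_within_open[OF has_derivative_add[OF B B] U])
       (simp add: linear_add[OF lin])
  from has_derivative_unique[OF this B] show "B' (v + w) u = B' v u + B' w u" by metis
next
  fix c v
  have "((\<lambda>y. B y (c *\<^sub>R v)) has_derivative (\<lambda>u. c *\<^sub>R B' v u)) (at x)"
    by (rule has_derivative_transform_within_open[OF has_derivative_scaleR_right[OF B] U])
       (simp add: linear_cmul[OF lin])
  from has_derivative_unique[OF this B] show "B' (c *\<^sub>R v) u = c *\<^sub>R B' v u" by metis
qed

text \<open>A product rule for tensors whose differentiability is known only for fixed arguments:
  expanding X in \<open>Basis\<close> reduces it to finitely many products.\<close>

lemma has_derivative_linear_family: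
  fixes B :: "'a::real_normed_vector \<Rightarrow> 'b::euclidean_space \<Rightarrow> 'c::real_normed_vector"
  assumes U: "open U" "x \<in> U" and lin: "\<And>y. y \<in> U \<Longrightarrow> linear (B y)"
    and B: "\<And>v. ((\<lambda>y. B y v) has_derivative B' v) (at x)"
    and X: "(X has_derivative X') (at x)"
  shows "((\<lambda>y. B y (X y)) has_derivative (\<lambda>u. B' (X x) u + B x (X' u))) (at x)"
proof -
  have exp: "h v = (\<Sum>b\<in>Basis. (v \<bullet> b) *\<^sub>R h b)" if "linear h" for h :: "'b \<Rightarrow> 'c" and v
  proof -
    have "h v = h (\<Sum>b\<in>Basis. (v \<bullet> b) *\<^sub>R b)" by (simp add: euclidean_representation)
    then show ?thesis by (simp add: linear_sum[OF that] linear_cmul[OF that])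
  qed
  have "((\<lambda>y. \<Sum>b\<in>Basis. (X y \<bullet> b) *\<^sub>R B y b) has_derivative
      (\<lambda>u. \<Sum>b\<in>Basis. (X x \<bullet> b) *\<^sub>R B' b u + (X' u \<bullet> b) *\<^sub>R B x b)) (at x)"
    by (intro has_derivative_sum has_derivative_scaleR has_derivative_inner_left X B)
  also have "(\<lambda>u. \<Sum>b\<in>Basis. (X x \<bullet> b) *\<^sub>R B' b u + (X' u \<bullet> b) *\<^sub>R B x b) =
      (\<lambda>u. B' (X x) u + B x (X' u))"
    by (intro ext) (simp add: sum.distrib exp[OF lin[OF U(2)], symmetric]
        exp[OF linear_family_derivative[OF U lin B], symmetric])
  finally show ?thesis
    by (rule has_derivative_transform_within_open[OF _ U]) (simp add: exp[OF lin, symmetric])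
qed

lemma has_derivative_bilinear_family:
  fixes B :: "'a::real_normed_vector \<Rightarrow> 'b::euclidean_space \<Rightarrow> 'b \<Rightarrow> 'c::real_normed_vector"
  assumes U: "open U" "x \<in> U"
    and lin: "\<And>y w. y \<in> U \<Longrightarrow> linear (\<lambda>v. B y v w)" "\<And>y v. y \<in> U \<Longrightarrow> linear (\<lambda>w. B y v w)"
    and B: "\<And>v w. ((\<lambda>y. B y v w) has_derivative B' v w) (at x)"
    and X: "(X has_derivative X') (at x)" and Y: "(Y has_derivative Y') (at x)"
  shows "((\<lambda>y. B y (X y) (Y y)) has_derivative
    (\<lambda>u. B' (X x) (Y x) u + B x (X' u) (Y x) + B x (X x) (Y' u))) (at x)"
  by (rule has_derivative_linear_family[of U x "\<lambda>y w. B y (X y) w"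
        "\<lambda>w u. B' (X x) w u + B x (X' u) w", OF U _ _ Y])
     (auto intro: lin has_derivative_linear_family[OF U lin(1) B X])

lemma has_derivative_trilinear_family:
  fixes B :: "'a::real_normed_vector \<Rightarrow> 'b::euclidean_space \<Rightarrow> 'b \<Rightarrow> 'b \<Rightarrow> 'c::real_normed_vector"
  assumes U: "open U" "x \<in> U"
    and lin: "\<And>y w z. y \<in> U \<Longrightarrow> linear (\<lambda>v. B y v w z)" "\<And>y v z. y \<in> U \<Longrightarrow> linear (\<lambda>w. B y v w z)"
      "\<And>y v w. y \<in> U \<Longrightarrow> linear (\<lambda>z. B y v w z)"
    and B: "\<And>v w z. ((\<lambda>y. B y v w z) has_derivative B' v w z) (at x)"
    and X: "(X has_derivative X') (at x)" and Y: "(Y has_derivative Y') (at x)"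
    and Z: "(Z has_derivative Z') (at x)"
  shows "((\<lambda>y. B y (X y) (Y y) (Z y)) has_derivative
    (\<lambda>u. B' (X x) (Y x) (Z x) u + B x (X' u) (Y x) (Z x) + B x (X x) (Y' u) (Z x)
      + B x (X x) (Y x) (Z' u))) (at x)"
  by (rule has_derivative_linear_family[of U x "\<lambda>y z. B y (X y) (Y y) z"
        "\<lambda>z u. B' (X x) (Y x) z u + B x (X' u) (Y x) z + B x (X x) (Y' u) z", OF U _ _ Z])
     (auto intro: lin has_derivative_bilinear_family[of U x "\<lambda>y v w. B y v w _", OF U lin(1,2) B X Y])

lemma differentiable_prod_real:
  fixes h :: "'i \<Rightarrow> 'a::real_normed_vector \<Rightarrow> real"
  assumes "\<And>i. i \<in> I \<Longrightarrow> h i differentiable (at x)"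
  shows "(\<lambda>y. \<Prod>i\<in>I. h i y) differentiable (at x)"
  using assms by (induction I rule: infinite_finite_induct) (auto intro: differentiable_mult)

lemma differentiable_det:
  fixes A :: "'a::real_normed_vector \<Rightarrow> real ^ 'n ^ 'n"
  assumes "\<And>i j. (\<lambda>y. A y $ i $ j) differentiable (at x)"
  shows "(\<lambda>y. det (A y)) differentiable (at x)"
  unfolding det_def
  by (intro differentiable_sum ballI differentiable_mult differentiable_const
      differentiable_prod_real[of UNIV "\<lambda>i y. A y $ i $ _ i"] assms)
     (auto simp: finite_permutations)

lemma differentiable_vec_nth:
  fixes h :: "'a::euclidean_space \<Rightarrow> real ^ 'n"
  assumes "\<And>k. (\<lambda>y. h y $ k) differentiable (at x)"
  shows "h differentiable (at x)"
proof -
  have "(\<lambda>y. h y \<bullet> b) differentiable (at x)" if b: "b \<in> Basis" for b :: "real ^ 'n"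
  proof -
    obtain k where "b = axis k 1" using b by (auto simp: Basis_vec_def)
    then show ?thesis using assms[of k] by (simp add: inner_axis)
  qed
  then show ?thesis
    using differentiable_componentwise_within[of h x UNIV] by simp
qed

text \<open>The vector \<open>f y j\<close> solves a linear system whose matrix consists of coframe
  components, and Cramer's rule writes the solution as quotients of differentiable determinants. The
  chosen dual frame thus inherits differentiability from the coframe.\<close>

lemma differentiable_dual_frame:
  fixes e :: "coord \<Rightarrow> nat \<Rightarrow> form" and f :: "coord \<Rightarrow> nat \<Rightarrow> coord"
  assumes V: "open V" "x \<in> V" and P: "\<And>y. y \<in> V \<Longrightarrow> g2_coframe (P y) (e y)"
    and f: "\<And>y. y \<in> V \<Longrightarrow> dual_frame (e y) (f y)"
    and e: "\<And>i v. i \<in> {1..7} \<Longrightarrow> (\<lambda>y. e y i [v]) differentiable (at x)"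
    and j: "j \<in> {1..7}"
  shows "(\<lambda>y. f y j) differentiable (at x)"
proof -
  \<comment> \<open>Matrices are indexed by the type 7, coframes by numbers from 1 to 7; \<iota>
    translates.\<close>
  obtain \<iota> :: "7 \<Rightarrow> nat" where \<iota>: "bij_betw \<iota> UNIV {1..7}"
    using finite_same_card_bij[of "UNIV :: 7 set" "{1..7::nat}"] by auto
  have \<iota>7: "\<iota> k \<in> {1..7}" for k using \<iota> by (auto simp: bij_betw_def)
  define A :: "coord \<Rightarrow> real ^ 7 ^ 7" where "A y = (\<chi> k l. e y (\<iota> k) [axis l 1])" for y
  define b :: coord where "b = (\<chi> k. if \<iota> k = j then 1 else 0)"
  have A: "A y *v v = (\<chi> k. e y (\<iota> k) [v])" if "y \<in> V" for y v
  proof -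
    have "e y (\<iota> k) [v] = (\<Sum>l\<in>UNIV. e y (\<iota> k) [axis l 1] * v $ l)" for k
    proof -
      note l = g2_coframe_linear[OF P[OF that] \<iota>7, of k]
      have "e y (\<iota> k) [v] = e y (\<iota> k) [\<Sum>l\<in>UNIV. v $ l *s axis l 1]" by (simp add: basis_expansion)
      also have "\<dots> = (\<Sum>l\<in>UNIV. v $ l * e y (\<iota> k) [axis l 1])"
        by (simp add: linear_sum[OF l] linear_cmul[OF l] scalar_mult_eq_scaleR)
      finally show ?thesis by (simp add: mult.commute)
    qed
    then show ?thesis by (simp add: A_def matrix_vector_mult_def)
  qed
  have det: "det (A y) \<noteq> 0" if "y \<in> V" for y
  proof -
    have "v = 0" if "A y *v v = 0" for v
    proof -
      have e0: "e y i [v] = 0" if "i \<in> {1..7}" for i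
      proof -
        have "i \<in> range \<iota>" using that by (simp only: bij_betw_imp_surj_on[OF \<iota>])
        then obtain k where "i = \<iota> k" by blast
        then show ?thesis using A[OF \<open>y \<in> V\<close>, of v] \<open>A y *v v = 0\<close> by (simp add: vec_eq_iff)
      qed
      show "v = 0"
        using orthonormal_expand[OF coframe_metric_linear(1)[OF P[OF \<open>y \<in> V\<close>]]
            orthonormal_dual_frame[OF f[OF \<open>y \<in> V\<close>]], of v]
        by (simp add: coframe_metric_dual[OF f[OF \<open>y \<in> V\<close>]] e0)
    qed
    then have "\<exists>B. B ** A y = mat 1" by (simp add: matrix_left_invertible_ker)
    then show ?thesis using invertible_det_nz invertible_left_inverse by blast
  qed
  have "A y *v f y j = b" if "y \<in> V" for y
    using A[OF that] f[OF that] j \<iota>7 by (simp add: b_def dual_frame_def vec_eq_iff)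
  then have fy: "f y j = (\<chi> k. det (\<chi> i l. if l = k then b $ i else A y $ i $ l) / det (A y))"
    if "y \<in> V" for y using cramer[OF det[OF that]] that by blast
  have Ad: "(\<lambda>y. A y $ i $ l) differentiable (at x)" for i l
    using e[OF \<iota>7] by (simp add: A_def)
  have "(\<lambda>y. \<chi> k. det (\<chi> i l. if l = k then b $ i else A y $ i $ l) / det (A y)) differentiable (at x)"
  proof (rule differentiable_vec_nth)
    fix k
    have "(\<lambda>y. det (\<chi> i l. if l = k then b $ i else A y $ i $ l) / det (A y)) differentiable (at x)"
    proof (intro differentiable_divide differentiable_det det V)
      fix i l
      show "(\<lambda>y. (\<chi> i l. if l = k then b $ i else A y $ i $ l) $ i $ l) differentiable (at x)"
        by (cases "l = k") (simp_all add: Ad)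
    qed (rule Ad)
    then show "(\<lambda>y. (\<chi> k. det (\<chi> i l. if l = k then b $ i else A y $ i $ l) / det (A y)) $ k)
        differentiable (at x)" by simp
  qed
  then obtain D where "((\<lambda>y. \<chi> k. det (\<chi> i l. if l = k then b $ i else A y $ i $ l) / det (A y))
      has_derivative D) (at x)" by (auto simp: differentiable_def)
  then have "((\<lambda>y. f y j) has_derivative D) (at x)"
    by (rule has_derivative_transform_within_open[OF _ V]) (simp add: fy)
  then show ?thesis by (auto simp: differentiable_def)
qed

section \<open>Smoothness and exterior derivatives of fields\<close>

lemma smooth_on_differentiable:
  assumes "smooth_on S h" "x \<in> S"
  shows "h differentiable (at x)"
proof -
  have "Ck_on (Suc 0) S h" using assms(1) by (simp only: smooth_on_def)
  then show ?thesis using assms(2) by simp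
qed

lemma smooth_on_frechet_derivative:
  assumes "smooth_on S h"
  shows "smooth_on S (\<lambda>x. frechet_derivative h (at x) v)"
  unfolding smooth_on_def
proof
  fix k
  have "Ck_on (Suc k) S h" using assms by (simp only: smooth_on_def)
  then show "Ck_on k S (\<lambda>x. frechet_derivative h (at x) v)" by simp
qed

lemma frechet_derivative_eq:
  "(h has_derivative h') (at x) \<Longrightarrow> frechet_derivative h (at x) u = h' u"
  using frechet_derivative_at[of h h' x] by simp

lemma length_3E:
  assumes "length vs = 3" obtains a b c where "vs = [a, b, c]"
  using assms by (auto simp: numeral_3_eq_3 length_Suc_conv)

lemma is_form_3_linear:
  assumes "is_form 3 \<omega>"
  shows "linear (\<lambda>a. \<omega> [a, b, c])" "linear (\<lambda>b. \<omega> [a, b, c])" "linear (\<lambda>c. \<omega> [a, b, c])"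
  using is_formD_linear[OF assms, of "[a, b, c]" 0] is_formD_linear[OF assms, of "[a, b, c]" 1]
    is_formD_linear[OF assms, of "[a, b, c]" 2] by (simp_all add: One_nat_def)

lemma is_form_3_swap:
  assumes "is_form 3 \<omega>"
  shows "\<omega> [b, a, c] = - \<omega> [a, b, c]" "\<omega> [a, c, b] = - \<omega> [a, b, c]"
  using is_form_swap[OF assms, of "[]" a b "[c]"] is_form_swap[OF assms, of "[a]" b c "[]"]
  by simp_all

lemma sum_lessThan_4: "(\<Sum>i<4. F i) = F 0 + F 1 + F 2 + F (3::nat)" for F :: "nat \<Rightarrow> real"
  by (simp add: numeral_eq_Suc One_nat_def)

lemma ext_d_4:
  "ext_d \<omega> x [i, j, k, l] =
    frechet_derivative (\<lambda>y. \<omega> y [j, k, l]) (at x) i - frechet_derivative (\<lambda>y. \<omega> y [i, k, l]) (at x) j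
    + frechet_derivative (\<lambda>y. \<omega> y [i, j, l]) (at x) k - frechet_derivative (\<lambda>y. \<omega> y [i, j, k]) (at x) l"
proof -
  have "length [i, j, k, l] = 4" by simp
  then show ?thesis
    unfolding ext_d_def by (simp only: sum_lessThan_4) (simp add: numeral_eq_Suc One_nat_def)
qed

lemma ext_d_alternate:
  "ext_d \<omega> x = alternate (\<lambda>u ws. frechet_derivative (\<lambda>y. \<omega> y ws) (at x) u)"
  by (intro ext) (simp add: ext_d_def alternate_def)

lemma is_form_frechet_derivative:
  assumes U: "open U" "x \<in> U" and f: "\<And>y. y \<in> U \<Longrightarrow> is_form k (\<omega> y)"
    and d: "\<And>vs. length vs = k \<Longrightarrow> (\<lambda>y. \<omega> y vs) differentiable (at x)"
  shows "is_form k (\<lambda>ws. frechet_derivative (\<lambda>y. \<omega> y ws) (at x) u)"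
  unfolding is_form_def
proof (intro allI impI conjI)
  fix vs :: "coord list" and i assume vs: "length vs = k" "i < k"
  show "linear (\<lambda>v. frechet_derivative (\<lambda>y. \<omega> y (vs[i := v])) (at x) u)"
    by (rule linear_family_derivative[OF U, where B = "\<lambda>y v. \<omega> y (vs[i := v])"])
       (use vs f d in \<open>auto intro: is_formD_linear simp flip: frechet_derivative_works\<close>)
next
  fix vs :: "coord list" and i j
  assume vs: "length vs = k" "i < k" "j < k" "i \<noteq> j \<and> vs ! i = vs ! j"
  have "((\<lambda>y. \<omega> y vs) has_derivative (\<lambda>_. 0)) (at x)"
    by (rule has_derivative_transform_within_open[OF has_derivative_const U])
       (use vs f in \<open>auto intro: is_formD_alt[symmetric]\<close>)
  from frechet_derivative_eq[OF this, of u] show "frechet_derivative (\<lambda>y. \<omega> y vs) (at x) u = 0" .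
qed

lemma is_form_ext_d:
  assumes U: "open U" "x \<in> U" and f: "\<And>y. y \<in> U \<Longrightarrow> is_form k (\<omega> y)"
    and d: "\<And>vs. length vs = k \<Longrightarrow> (\<lambda>y. \<omega> y vs) differentiable (at x)"
  shows "is_form (Suc k) (ext_d \<omega> x)"
  unfolding ext_d_alternate
proof (rule is_form_alternate)
  show "is_form k (\<lambda>ws. frechet_derivative (\<lambda>y. \<omega> y ws) (at x) u)" for u
    by (rule is_form_frechet_derivative[OF U f d])
  show "linear (\<lambda>u. frechet_derivative (\<lambda>y. \<omega> y vs) (at x) u)" if "length vs = k" for vs
    using has_derivative_linear frechet_derivative_works d[OF that] by blast
qed

section \<open>The characteristic connection in a chart\<close>

locale g2_chart =
  fixes U :: "coord set" and \<phi> :: form_field and \<Gamma> :: christoffel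
  assumes U: "open U"
    and bilinear: "x \<in> U \<Longrightarrow> bilinear (\<Gamma> x)"
    and \<Gamma>_diff: "x \<in> U \<Longrightarrow> (\<lambda>y. \<Gamma> y u v) differentiable (at x)"
    and \<phi>_form: "x \<in> U \<Longrightarrow> is_form 3 (\<phi> x)"
    and \<phi>_diff: "x \<in> U \<Longrightarrow> length vs = 3 \<Longrightarrow> (\<lambda>y. \<phi> y vs) differentiable (at x)"
    and coframe: "x \<in> U \<Longrightarrow> \<exists>V e. open V \<and> x \<in> V \<and> V \<subseteq> U \<and>
      (\<forall>i\<in>{1..7}. \<forall>v. \<forall>y\<in>V. (\<lambda>z. e z i [v]) differentiable (at y)) \<and>
      (\<forall>y\<in>V. g2_coframe (\<phi> y) (e y))"
    and metric_parallel: "x \<in> U \<Longrightarrow>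
      nabla_form \<Gamma> (\<lambda>y vs. metric \<phi> y (vs ! 0) (vs ! 1)) x u [v, w] = 0"
    and \<phi>_parallel: "x \<in> U \<Longrightarrow> length vs = 3 \<Longrightarrow> nabla_form \<Gamma> \<phi> x u vs = 0"
    and torsion_form: "x \<in> U \<Longrightarrow> is_form 3 (torsion \<phi> \<Gamma> x)"
begin

abbreviation g where "g \<equiv> metric \<phi>"

lemma ex_coframe: "x \<in> U \<Longrightarrow> \<exists>e. g2_coframe (\<phi> x) e"
  using coframe by blast

lemma g_eq: "g2_coframe (\<phi> x) e \<Longrightarrow> g x = coframe_metric e"
  unfolding metric_def using g2_metric_frame(1) .

lemma g_linear:
  assumes "x \<in> U" shows "linear (\<lambda>u. g x u v)" "linear (g x u)"
  using ex_coframe[OF assms] coframe_metric_linear g_eq by auto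

lemma g_sym: "x \<in> U \<Longrightarrow> g x u v = g x v u"
  using ex_coframe g_eq coframe_metric_sym by metis

lemma \<Gamma>_linear:
  assumes "x \<in> U" shows "linear (\<lambda>u. \<Gamma> x u v)" "linear (\<Gamma> x u)"
  using bilinear[OF assms] by (auto simp: bilinear_def)

text \<open>The pointwise choice in \<open>g2_metric\<close> has no regularity of its own; by
  uniqueness the metric agrees near x with the one of a differentiable coframe.\<close>

lemma g_differentiable:
  assumes x: "x \<in> U"
  shows "(\<lambda>y. g y v w) differentiable (at x)"
proof -
  obtain V e where V: "open V" "x \<in> V"
    "\<And>i v y. i \<in> {1..7} \<Longrightarrow> y \<in> V \<Longrightarrow> (\<lambda>z. e z i [v]) differentiable (at y)"
    "\<And>y. y \<in> V \<Longrightarrow> g2_coframe (\<phi> y) (e y)" using coframe[OF x] by blast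
  have "(\<lambda>y. \<Sum>i=1..7. e y i [v] * e y i [w]) differentiable (at x)"
    by (intro differentiable_sum ballI differentiable_mult V) auto
  then obtain D where "((\<lambda>y. \<Sum>i=1..7. e y i [v] * e y i [w]) has_derivative D) (at x)"
    by (auto simp: differentiable_def)
  then have "((\<lambda>y. g y v w) has_derivative D) (at x)"
    by (rule has_derivative_transform_within_open[OF _ V(1,2)]) (simp add: g_eq[OF V(4)] coframe_metric_def)
  then show ?thesis by (auto simp: differentiable_def)
qed

text \<open>Parallelism read as a formula for the derivative: it can be differentiated once more
  with derivatives of \<Gamma> only, which is how the curvature symmetries arise.\<close>

lemma g_deriv:
  assumes x: "x \<in> U"
  shows "((\<lambda>y. g y v w) has_derivative (\<lambda>u. g x (\<Gamma> x u v) w + g x v (\<Gamma> x u w))) (at x)"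
proof -
  have "frechet_derivative (\<lambda>y. g y v w) (at x) u = g x (\<Gamma> x u v) w + g x v (\<Gamma> x u w)" for u
    using metric_parallel[OF x, of u v w] by (simp add: nabla_form_def One_nat_def)
  then have "frechet_derivative (\<lambda>y. g y v w) (at x) = (\<lambda>u. g x (\<Gamma> x u v) w + g x v (\<Gamma> x u w))"
    by (intro ext)
  then show ?thesis
    using frechet_derivative_works[of "\<lambda>y. g y v w" "at x"] g_differentiable[OF x, of v w] by simp
qed

lemma \<phi>_deriv:
  assumes x: "x \<in> U"
  shows "((\<lambda>y. \<phi> y [a, b, c]) has_derivative
    (\<lambda>u. \<phi> x [\<Gamma> x u a, b, c] + \<phi> x [a, \<Gamma> x u b, c] + \<phi> x [a, b, \<Gamma> x u c])) (at x)"
proof -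
  have "frechet_derivative (\<lambda>y. \<phi> y [a, b, c]) (at x) u =
      \<phi> x [\<Gamma> x u a, b, c] + \<phi> x [a, \<Gamma> x u b, c] + \<phi> x [a, b, \<Gamma> x u c]" for u
    using \<phi>_parallel[OF x, of "[a, b, c]" u] by (simp add: nabla_form_def One_nat_def)
  then have "frechet_derivative (\<lambda>y. \<phi> y [a, b, c]) (at x) =
      (\<lambda>u. \<phi> x [\<Gamma> x u a, b, c] + \<phi> x [a, \<Gamma> x u b, c] + \<phi> x [a, b, \<Gamma> x u c])"
    by (intro ext)
  then show ?thesis using frechet_derivative_works[of "\<lambda>y. \<phi> y [a, b, c]" "at x"] \<phi>_diff[OF x, of "[a, b, c]"]
    by simp
qed

section \<open>Curvature and its symmetries\<close>

definition D\<Gamma> where "D\<Gamma> x u v w = frechet_derivative (\<lambda>y. \<Gamma> y v w) (at x) u"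

lemma \<Gamma>_deriv: "x \<in> U \<Longrightarrow> ((\<lambda>y. \<Gamma> y v w) has_derivative (\<lambda>u. D\<Gamma> x u v w)) (at x)"
  using \<Gamma>_diff frechet_derivative_works unfolding D\<Gamma>_def by fastforce

lemma D\<Gamma>_linear:
  assumes x: "x \<in> U"
  shows "linear (\<lambda>u. D\<Gamma> x u v w)" "linear (\<lambda>v. D\<Gamma> x u v w)" "linear (D\<Gamma> x u v)"
proof -
  show "linear (\<lambda>u. D\<Gamma> x u v w)" using has_derivative_linear[OF \<Gamma>_deriv[OF x]] .
  show "linear (\<lambda>v. D\<Gamma> x u v w)"
    by (rule linear_family_derivative[OF U x _ \<Gamma>_deriv[OF x]]) (rule \<Gamma>_linear)
  show "linear (D\<Gamma> x u v)"
    by (rule linear_family_derivative[OF U x _ \<Gamma>_deriv[OF x]]) (rule \<Gamma>_linear)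
qed

text \<open>The curvature on constant coordinate fields, whose brackets vanish.\<close>

definition R where
  "R x u v w = D\<Gamma> x u v w - D\<Gamma> x v u w + \<Gamma> x u (\<Gamma> x v w) - \<Gamma> x v (\<Gamma> x u w)"

lemma curvature_eq:
  assumes "x \<in> U"
  shows "curvature \<Gamma> (\<lambda>_. u) (\<lambda>_. v) (\<lambda>_. w) x = R x u v w"
proof -
  have "nabla_vec \<Gamma> (\<lambda>_. v) (\<lambda>_. w) = (\<lambda>y. \<Gamma> y v w)" for v w
    by (intro ext) (simp add: nabla_vec_def frechet_derivative_const)
  then show ?thesis
    using linear_0[OF \<Gamma>_linear(1)[OF assms]]
    by (simp add: curvature_def lie_bracket_def R_def D\<Gamma>_def frechet_derivative_const)
       (simp add: nabla_vec_def lie_bracket_def frechet_derivative_const)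
qed

text \<open>The second derivative of g(w, z) is symmetric in its two directions. Written through
  \<Gamma> and its derivative by \<open>g_deriv\<close>, its antisymmetric part is the action of R
  on g.\<close>

lemma R_metric:
  assumes x: "x \<in> U"
  shows "g x (R x u v w) z = - g x w (R x u v z)"
proof -
  let ?H = "\<lambda>y u. g y (\<Gamma> y u w) z + g y w (\<Gamma> y u z)"
  let ?K = "\<lambda>u v. (g x (\<Gamma> x v (\<Gamma> x u w)) z + g x (\<Gamma> x u w) (\<Gamma> x v z) + g x (D\<Gamma> x v u w) z)
    + (g x (\<Gamma> x v w) (\<Gamma> x u z) + g x w (\<Gamma> x v (\<Gamma> x u z)) + g x w (D\<Gamma> x v u z))"
  have K: "((\<lambda>y. ?H y u) has_derivative ?K u) (at x)" for u
    by (intro has_derivative_add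
        has_derivative_linear_family[OF U x g_linear(1) g_deriv[OF x] \<Gamma>_deriv[OF x]]
        has_derivative_linear_family[OF U x g_linear(2) g_deriv[OF x] \<Gamma>_deriv[OF x]])
  have "?K u v = ?K v u"
    by (rule second_derivative_symmetric[OF U x g_deriv K K])
  then show ?thesis
    by (simp add: R_def linear_add[OF g_linear(1)[OF x]] linear_diff[OF g_linear(1)[OF x]]
        linear_add[OF g_linear(2)[OF x]] linear_diff[OF g_linear(2)[OF x]])
qed

lemma \<phi>_linear:
  assumes "x \<in> U"
  shows "linear (\<lambda>a. \<phi> x [a, b, c])" "linear (\<lambda>b. \<phi> x [a, b, c])" "linear (\<lambda>c. \<phi> x [a, b, c])"
  using is_form_3_linear[OF \<phi>_form[OF assms]] by auto

text \<open>The argument of \<open>R_metric\<close> with \<phi> in place of g. It says that the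
  curvature takes values in the Lie algebra of G_2.\<close>

lemma R_\<phi>:
  assumes x: "x \<in> U"
  shows "\<phi> x [R x u v a, b, c] + \<phi> x [a, R x u v b, c] + \<phi> x [a, b, R x u v c] = 0"
proof -
  let ?D = "\<lambda>v a b c. \<phi> x [\<Gamma> x v a, b, c] + \<phi> x [a, \<Gamma> x v b, c] + \<phi> x [a, b, \<Gamma> x v c]"
  let ?H = "\<lambda>y u. \<phi> y [\<Gamma> y u a, b, c] + \<phi> y [a, \<Gamma> y u b, c] + \<phi> y [a, b, \<Gamma> y u c]"
  let ?K = "\<lambda>u v. (?D v (\<Gamma> x u a) b c + \<phi> x [D\<Gamma> x v u a, b, c])
    + (?D v a (\<Gamma> x u b) c + \<phi> x [a, D\<Gamma> x v u b, c])
    + (?D v a b (\<Gamma> x u c) + \<phi> x [a, b, D\<Gamma> x v u c])"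
  have K: "((\<lambda>y. ?H y u) has_derivative ?K u) (at x)" for u
    by (intro has_derivative_add
        has_derivative_linear_family[OF U x \<phi>_linear(1) \<phi>_deriv[OF x] \<Gamma>_deriv[OF x]]
        has_derivative_linear_family[OF U x \<phi>_linear(2) \<phi>_deriv[OF x] \<Gamma>_deriv[OF x]]
        has_derivative_linear_family[OF U x \<phi>_linear(3) \<phi>_deriv[OF x] \<Gamma>_deriv[OF x]])
  have "?K u v = ?K v u"
    by (rule second_derivative_symmetric[OF U x \<phi>_deriv K K])
  then show ?thesis
    by (simp add: R_def linear_add[OF \<phi>_linear(1)[OF x]] linear_diff[OF \<phi>_linear(1)[OF x]]
        linear_add[OF \<phi>_linear(2)[OF x]] linear_diff[OF \<phi>_linear(2)[OF x]]
        linear_add[OF \<phi>_linear(3)[OF x]] linear_diff[OF \<phi>_linear(3)[OF x]])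
qed

section \<open>Torsion, its covariant derivative and the Bianchi identity\<close>

definition \<tau> where "\<tau> x u v = \<Gamma> x u v - \<Gamma> x v u"
definition t3 where "t3 x a b c = g x (\<tau> x a b) c"

lemma torsion_eq: "torsion \<phi> \<Gamma> x [a, b, c] = t3 x a b c"
  by (simp add: torsion_def nabla_vec_def lie_bracket_def frechet_derivative_const t3_def \<tau>_def
      One_nat_def numeral_2_eq_2)

lemma t3_swap:
  assumes x: "x \<in> U"
  shows "t3 x b a c = - t3 x a b c" "t3 x a c b = - t3 x a b c"
  using is_form_3_swap(1)[OF torsion_form[OF x], of b a c]
    is_form_3_swap(2)[OF torsion_form[OF x], of a c b] by (simp_all add: torsion_eq)

lemma t3_linear:
  assumes x: "x \<in> U"
  shows "linear (\<lambda>a. t3 x a b c)" "linear (\<lambda>b. t3 x a b c)" "linear (t3 x a b)"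
  using is_form_3_linear[OF torsion_form[OF x]] by (simp_all add: torsion_eq)

text \<open>\<open>\<nabla>\<^sub>u\<close> of the torsion, as a vector-valued 2-form and as a 3-form.\<close>

definition N\<tau> where
  "N\<tau> x u a b = \<Gamma> x u (\<tau> x a b) + D\<Gamma> x u a b - D\<Gamma> x u b a - \<tau> x (\<Gamma> x u a) b - \<tau> x a (\<Gamma> x u b)"
definition nt where "nt x u a b c = g x (N\<tau> x u a b) c"

lemma t3_deriv:
  assumes x: "x \<in> U"
  shows "((\<lambda>y. t3 y a b c) has_derivative
    (\<lambda>u. nt x u a b c + t3 x (\<Gamma> x u a) b c + t3 x a (\<Gamma> x u b) c + t3 x a b (\<Gamma> x u c))) (at x)"
proof -
  have \<tau>: "((\<lambda>y. \<tau> y a b) has_derivative (\<lambda>u. D\<Gamma> x u a b - D\<Gamma> x u b a)) (at x)"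
    unfolding \<tau>_def by (intro has_derivative_diff \<Gamma>_deriv x)
  have "((\<lambda>y. t3 y a b c) has_derivative
    (\<lambda>u. g x (\<Gamma> x u (\<tau> x a b)) c + g x (\<tau> x a b) (\<Gamma> x u c) + g x (D\<Gamma> x u a b - D\<Gamma> x u b a) c)) (at x)"
    unfolding t3_def
    by (rule has_derivative_linear_family[OF U x g_linear(1) g_deriv[OF x] \<tau>])
  then show ?thesis
    by (simp add: nt_def N\<tau>_def t3_def linear_add[OF g_linear(1)[OF x]] linear_diff[OF g_linear(1)[OF x]]
        algebra_simps)
qed

lemma t3_frechet:
  "x \<in> U \<Longrightarrow> frechet_derivative (\<lambda>y. t3 y a b c) (at x) u =
    nt x u a b c + t3 x (\<Gamma> x u a) b c + t3 x a (\<Gamma> x u b) c + t3 x a b (\<Gamma> x u c)"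
  by (rule frechet_derivative_eq[OF t3_deriv])

text \<open>\<open>t3\<close> is alternating at all points near x, hence so is its derivative; the
  Christoffel terms alternate among themselves.\<close>

lemma nt_swap:
  assumes x: "x \<in> U"
  shows "nt x u b a c = - nt x u a b c" "nt x u a c b = - nt x u a b c"
proof -
  have e1: "((\<lambda>y. t3 y b a c) has_derivative
    (\<lambda>u. - (nt x u a b c + t3 x (\<Gamma> x u a) b c + t3 x a (\<Gamma> x u b) c + t3 x a b (\<Gamma> x u c)))) (at x)"
    by (rule has_derivative_transform_within_open[OF has_derivative_minus[OF t3_deriv[OF x]] U x])
       (simp add: t3_swap(1)[of _ b a])
  have e2: "((\<lambda>y. t3 y a c b) has_derivative
    (\<lambda>u. - (nt x u a b c + t3 x (\<Gamma> x u a) b c + t3 x a (\<Gamma> x u b) c + t3 x a b (\<Gamma> x u c)))) (at x)"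
    by (rule has_derivative_transform_within_open[OF has_derivative_minus[OF t3_deriv[OF x]] U x])
       (simp add: t3_swap(2)[of _ a c b])
  note s = t3_swap[OF x]
  show "nt x u b a c = - nt x u a b c"
    using fun_cong[OF has_derivative_unique[OF e1 t3_deriv[OF x]], of u]
      s(1)[of "\<Gamma> x u b" a c] s(1)[of b "\<Gamma> x u a" c] s(1)[of b a "\<Gamma> x u c"] by simp
  show "nt x u a c b = - nt x u a b c"
    using fun_cong[OF has_derivative_unique[OF e2 t3_deriv[OF x]], of u]
      s(2)[of "\<Gamma> x u a" c b] s(2)[of a "\<Gamma> x u c" b] s(2)[of a c "\<Gamma> x u b"] by simp
qed

definition dt where
  "dt x i j k l = ext_d (torsion \<phi> \<Gamma>) x [i, j, k, l]"

lemma torsion_frechet: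
  assumes x: "x \<in> U"
  shows "frechet_derivative (\<lambda>y. torsion \<phi> \<Gamma> y [a, b, c]) (at x) u =
    frechet_derivative (\<lambda>y. t3 y a b c) (at x) u"
proof -
  have "((\<lambda>y. torsion \<phi> \<Gamma> y [a, b, c]) has_derivative
    (\<lambda>u. nt x u a b c + t3 x (\<Gamma> x u a) b c + t3 x a (\<Gamma> x u b) c + t3 x a b (\<Gamma> x u c))) (at x)"
    by (rule has_derivative_transform_within_open[OF t3_deriv[OF x] U x]) (simp add: torsion_eq)
  from frechet_derivative_eq[OF this, of u] show ?thesis by (simp add: t3_frechet[OF x])
qed

lemma torsion_differentiable:
  assumes x: "x \<in> U" and vs: "length vs = 3"
  shows "(\<lambda>y. torsion \<phi> \<Gamma> y vs) differentiable (at x)"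
proof -
  obtain a b c where vs: "vs = [a, b, c]" using vs by (rule length_3E)
  show ?thesis
    unfolding vs differentiable_def
    by (rule exI, rule has_derivative_transform_within_open[OF t3_deriv[OF x] U x]) (simp add: torsion_eq)
qed

lemma ext_d_torsion_form:
  assumes x: "x \<in> U"
  shows "is_form 4 (ext_d (torsion \<phi> \<Gamma>) x)"
  using is_form_ext_d[OF U x torsion_form torsion_differentiable[OF x]] by simp

text \<open>The formula dT = alternation of \<nabla>T + 2 \<sigma>. Replacing derivatives by
  \<nabla> leaves six terms in which the torsion is applied to one pair of arguments; since T is a
  3-form they agree in pairs, hence the 2.\<close>

lemma dt_eq:
  assumes x: "x \<in> U"
  shows "dt x i j k l = nt x i j k l - nt x j i k l + nt x k i j l - nt x l i j k
    + 2 * (t3 x (\<tau> x i j) k l + t3 x (\<tau> x j k) i l + t3 x (\<tau> x k i) j l)"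
proof -
  have \<tau>1: "t3 x (\<tau> x a b) c d = t3 x (\<Gamma> x a b) c d - t3 x (\<Gamma> x b a) c d" for a b c d
    by (simp add: \<tau>_def linear_diff[OF t3_linear(1)[OF x]])
  \<comment> \<open>By total skewness both sides equal the scalar product of \<tau>(a, b) and
    \<tau>(c, d).\<close>
  have sym: "t3 x (\<tau> x a b) c d = t3 x (\<tau> x c d) a b" for a b c d
  proof -
    have "t3 x (\<tau> x a b) c d = t3 x c d (\<tau> x a b)"
      using t3_swap[OF x] by (metis minus_minus)
    also have "\<dots> = t3 x a b (\<tau> x c d)"
      unfolding t3_def by (rule g_sym[OF x])
    also have "\<dots> = t3 x (\<tau> x c d) a b"
      using t3_swap[OF x] by (metis minus_minus)
    finally show ?thesis .
  qed
  have skew\<tau>: "t3 x (\<tau> x a b) c d = - t3 x (\<tau> x b a) c d" for a b c d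
    by (simp add: \<tau>1)
  have mv: "t3 x a (\<Gamma> x u v) c = - t3 x (\<Gamma> x u v) a c" "t3 x a b (\<Gamma> x u v) = t3 x (\<Gamma> x u v) a b"
    for a b c u v
    using t3_swap[OF x] by (metis minus_minus)+
  have "dt x i j k l = nt x i j k l - nt x j i k l + nt x k i j l - nt x l i j k
    + (t3 x (\<tau> x i j) k l + t3 x (\<tau> x k i) j l + t3 x (\<tau> x j k) i l
      + t3 x (\<tau> x i l) j k + t3 x (\<tau> x j l) k i + t3 x (\<tau> x k l) i j)"
    unfolding dt_def ext_d_4 torsion_frechet[OF x] t3_frechet[OF x] mv \<tau>1
    using t3_swap(2)[OF x, of _ k i] t3_swap(2)[OF x, of _ k j] t3_swap(2)[OF x, of _ l i]
      t3_swap(2)[OF x, of _ l j] t3_swap(2)[OF x, of _ j i] t3_swap(2)[OF x, of _ l k]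
    by simp
  moreover have "t3 x (\<tau> x k l) i j = t3 x (\<tau> x i j) k l" by (rule sym)
  moreover have "t3 x (\<tau> x i l) j k = t3 x (\<tau> x j k) i l" by (rule sym)
  moreover have "t3 x (\<tau> x j l) k i = t3 x (\<tau> x k i) j l" by (rule sym)
  ultimately show ?thesis by simp
qed

lemma first_bianchi:
  assumes x: "x \<in> U"
  shows "R x i j k + R x j k i + R x k i j =
    N\<tau> x i j k + N\<tau> x j k i + N\<tau> x k i j + \<tau> x (\<tau> x i j) k + \<tau> x (\<tau> x j k) i + \<tau> x (\<tau> x k i) j"
  unfolding R_def N\<tau>_def
  by (simp add: \<tau>_def linear_diff[OF \<Gamma>_linear(1)[OF x]] linear_diff[OF \<Gamma>_linear(2)[OF x]])

text \<open>The cyclic sum of \<nabla>T is expressed through dT and -2 \<sigma> by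
  \<open>dt_eq\<close>; the torsion terms of \<open>first_bianchi\<close> add back one
  \<sigma>.\<close>

lemma bianchi_dt:
  assumes x: "x \<in> U"
  shows "g x (R x i j k) l + g x (R x j k i) l + g x (R x k i j) l =
    dt x i j k l - (t3 x (\<tau> x i j) k l + t3 x (\<tau> x j k) i l + t3 x (\<tau> x k i) j l) + nt x l i j k"
proof -
  have "g x (R x i j k + R x j k i + R x k i j) l =
      nt x i j k l + nt x j k i l + nt x k i j l
      + (t3 x (\<tau> x i j) k l + t3 x (\<tau> x j k) i l + t3 x (\<tau> x k i) j l)"
    unfolding first_bianchi[OF x] by (simp add: nt_def t3_def linear_add[OF g_linear(1)[OF x]])
  then show ?thesis
    using dt_eq[OF x, of i j k l] nt_swap(1)[OF x, of j k i l]
    by (simp add: linear_add[OF g_linear(1)[OF x]])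
qed

lemma R_skew: "R x u v w = - R x v u w"
  by (simp add: R_def)

lemma R_skew_pair:
  assumes "x \<in> U"
  shows "g x (R x i j k) l = - g x (R x j i k) l" "g x (R x i j k) l = - g x (R x i j l) k"
  using R_skew[of x i j k] linear_neg[OF g_linear(1)[OF assms]] R_metric[OF assms] g_sym[OF assms]
  by metis+

text \<open>Summing the first Bianchi identity over the four choices of the distinguished argument gives
  the cyclic sum over the last three arguments.\<close>

lemma bianchi_last:
  assumes x: "x \<in> U"
  shows "g x (R x i j k) l + g x (R x i k l) j + g x (R x i l j) k = dt x i j k l / 2 + nt x i j k l"
proof -
  define r where "r i j k l = g x (R x i j k) l" for i j k l
  define \<sigma> where "\<sigma> i j k l = t3 x (\<tau> x i j) k l + t3 x (\<tau> x j k) i l + t3 x (\<tau> x k i) j l" for i j k l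
  have r: "r a b c d = - r b a c d" "r a b c d = - r a b d c" for a b c d
    unfolding r_def by (rule R_skew_pair[OF x])+
  have b: "r a b c d + r b c a d + r c a b d = dt x a b c d - \<sigma> a b c d + nt x d a b c" for a b c d
    unfolding r_def \<sigma>_def by (rule bianchi_dt[OF x])
  have dt: "dt x a b c d = nt x a b c d - nt x b a c d + nt x c a b d - nt x d a b c + 2 * \<sigma> a b c d"
    for a b c d
    unfolding \<sigma>_def by (rule dt_eq[OF x])
  have n: "nt x a b d c = - nt x a b c d" "nt x a b c d = nt x a c d b" "nt x a b c d = nt x a d b c" for a b c d
    using nt_swap[OF x] by (metis minus_minus)+
  have ds: "dt x b a c d = - dt x a b c d" "dt x a c b d = - dt x a b c d" "dt x a b d c = - dt x a b c d"
    for a b c d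
    unfolding dt_def
    using is_form_swap[OF ext_d_torsion_form[OF x], of "[]" a b "[c, d]"]
      is_form_swap[OF ext_d_torsion_form[OF x], of "[a]" b c "[d]"]
      is_form_swap[OF ext_d_torsion_form[OF x], of "[a, b]" c d "[]"] by simp_all
  have dd: "dt x i k l j = dt x i j k l" "dt x i l j k = dt x i j k l" "dt x j k l i = - dt x i j k l"
    using ds by (metis minus_minus)+
  \<comment> \<open>By the two skew symmetries the six terms with i in the first pair make up the
    left side twice, and the other six cancel in pairs.\<close>
  have "2 * (r i j k l + r i k l j + r i l j k) =
      (r i j k l + r j k i l + r k i j l) + (r i k l j + r k l i j + r l i k j)
      + (r i l j k + r l j i k + r j i l k) + (r j k l i + r k l j i + r l j k i)"
    using r(1)[of k i j l] r(2)[of i k j l] r(1)[of l i k j] r(2)[of i l k j] r(1)[of j i l k]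
      r(2)[of i j l k] r(2)[of j k i l] r(2)[of k l i j] r(2)[of l j i k]
    by (simp add: algebra_simps)
  \<comment> \<open>The four values of dT add up to twice the first one. Eliminating each \<sigma>
    by \<open>dt\<close> takes half of that away, and the \<nabla>T terms collect to those in
    direction i.\<close>
  also have "\<dots> = dt x i j k l + 2 * nt x i j k l"
    unfolding b
    using dt[of i j k l] dt[of i k l j] dt[of i l j k] dt[of j k l i] dd
      n(2,3)[of i j k l] n(1)[of l i j k] n(2,3)[of l i j k] n(1)[of j i k l] n(2,3)[of j i k l]
      n(1)[of k i l j] n(2,3)[of k i l j] n(2,3)[of k i j l]
    by linarith
  finally show ?thesis by (simp add: r_def)
qed

end

lemma sum4_outer:
  fixes F :: "nat \<Rightarrow> nat \<Rightarrow> nat \<Rightarrow> nat \<Rightarrow> real"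
  shows "(\<Sum>m\<in>I. \<Sum>c\<in>I. \<Sum>a\<in>I. \<Sum>b\<in>I. F m c a b) = (\<Sum>c\<in>I. \<Sum>a\<in>I. \<Sum>b\<in>I. \<Sum>m\<in>I. F m c a b)"
proof -
  have "(\<Sum>m\<in>I. \<Sum>c\<in>I. \<Sum>a\<in>I. \<Sum>b\<in>I. F m c a b) = (\<Sum>c\<in>I. \<Sum>m\<in>I. \<Sum>a\<in>I. \<Sum>b\<in>I. F m c a b)"
    by (rule sum.swap)
  also have "\<dots> = (\<Sum>c\<in>I. \<Sum>a\<in>I. \<Sum>m\<in>I. \<Sum>b\<in>I. F m c a b)"
    by (intro sum.cong refl sum.swap)
  also have "\<dots> = (\<Sum>c\<in>I. \<Sum>a\<in>I. \<Sum>b\<in>I. \<Sum>m\<in>I. F m c a b)"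
    by (intro sum.cong refl sum.swap)
  finally show ?thesis .
qed

lemma sum3_outer:
  fixes F :: "nat \<Rightarrow> nat \<Rightarrow> nat \<Rightarrow> real"
  shows "(\<Sum>c\<in>I. \<Sum>a\<in>I. \<Sum>b\<in>I. F c a b) = (\<Sum>a\<in>I. \<Sum>b\<in>I. \<Sum>c\<in>I. F c a b)"
proof -
  have "(\<Sum>c\<in>I. \<Sum>a\<in>I. \<Sum>b\<in>I. F c a b) = (\<Sum>a\<in>I. \<Sum>c\<in>I. \<Sum>b\<in>I. F c a b)"
    by (rule sum.swap)
  also have "\<dots> = (\<Sum>a\<in>I. \<Sum>b\<in>I. \<Sum>c\<in>I. F c a b)"
    by (intro sum.cong refl sum.swap)
  finally show ?thesis .
qed

section \<open>Fields along adapted frames\<close>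

context g2_chart
begin

lemma ext_d_\<phi>:
  assumes x: "x \<in> U"
  shows "ext_d \<phi> x [a, b, c, d] = \<phi> x [\<tau> x a b, c, d] - \<phi> x [\<tau> x a c, b, d] + \<phi> x [\<tau> x a d, b, c]
    + \<phi> x [\<tau> x b c, a, d] - \<phi> x [\<tau> x b d, a, c] + \<phi> x [\<tau> x c d, a, b]"
proof -
  note s = is_form_3_swap[OF \<phi>_form[OF x]]
  have mv: "\<phi> x [a, \<Gamma> x u v, c] = - \<phi> x [\<Gamma> x u v, a, c]" "\<phi> x [a, b, \<Gamma> x u v] = \<phi> x [\<Gamma> x u v, a, b]"
    for a b c u v
    using s by (metis minus_minus)+
  show ?thesis
    unfolding ext_d_4 frechet_derivative_eq[OF \<phi>_deriv[OF x]] mv \<tau>_def linear_diff[OF \<phi>_linear(1)[OF x]]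
    by simp
qed

lemma ext_d_\<phi>_form: "x \<in> U \<Longrightarrow> is_form 4 (ext_d \<phi> x)"
  using is_form_ext_d[OF U _ \<phi>_form \<phi>_diff] by simp

text \<open>The Leibniz rule for moving arguments. As \<phi> is parallel, its derivative only
  completes the derivatives of the arguments to covariant ones.\<close>

lemma \<phi>_along:
  assumes x: "x \<in> U" and X: "(X has_derivative X') (at x)" and Y: "(Y has_derivative Y') (at x)"
    and Z: "(Z has_derivative Z') (at x)"
  shows "((\<lambda>y. \<phi> y [X y, Y y, Z y]) has_derivative
    (\<lambda>u. \<phi> x [X' u + \<Gamma> x u (X x), Y x, Z x] + \<phi> x [X x, Y' u + \<Gamma> x u (Y x), Z x]
      + \<phi> x [X x, Y x, Z' u + \<Gamma> x u (Z x)])) (at x)"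
  by (rule has_derivative_eq_rhs[OF has_derivative_trilinear_family
        [of U x "\<lambda>y a b c. \<phi> y [a, b, c]", OF U x \<phi>_linear \<phi>_deriv[OF x] X Y Z]])
     (simp_all add: add_ac linear_add[OF \<phi>_linear(1)[OF x]] linear_add[OF \<phi>_linear(2)[OF x]]
       linear_add[OF \<phi>_linear(3)[OF x]])

lemma t3_along:
  assumes x: "x \<in> U" and X: "(X has_derivative X') (at x)" and Y: "(Y has_derivative Y') (at x)"
    and Z: "(Z has_derivative Z') (at x)"
  shows "((\<lambda>y. t3 y (X y) (Y y) (Z y)) has_derivative
    (\<lambda>u. nt x u (X x) (Y x) (Z x) + t3 x (X' u + \<Gamma> x u (X x)) (Y x) (Z x)
      + t3 x (X x) (Y' u + \<Gamma> x u (Y x)) (Z x) + t3 x (X x) (Y x) (Z' u + \<Gamma> x u (Z x)))) (at x)"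
  by (rule has_derivative_eq_rhs[OF has_derivative_trilinear_family
        [of U x t3, OF U x t3_linear t3_deriv[OF x] X Y Z]])
     (simp_all add: add_ac linear_add[OF t3_linear(1)[OF x]] linear_add[OF t3_linear(2)[OF x]]
       linear_add[OF t3_linear(3)[OF x]])

lemma R_linear:
  assumes x: "x \<in> U"
  shows "linear (\<lambda>u. R x u v w)" "linear (R x u v)"
proof -
  note G = \<Gamma>_linear[OF x] and D = D\<Gamma>_linear[OF x]
  show "linear (\<lambda>u. R x u v w)"
    unfolding R_def
    by (rule linearI)
       (simp_all add: add_ac linear_add[OF G(1)] linear_add[OF G(2)] linear_add[OF D(1)] linear_add[OF D(2)]
         linear_cmul[OF G(1)] linear_cmul[OF G(2)] linear_cmul[OF D(1)] linear_cmul[OF D(2)] algebra_simps)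
  show "linear (R x u v)"
    unfolding R_def
    by (rule linearI)
       (simp_all add: add_ac linear_add[OF G(2)] linear_add[OF D(3)] linear_cmul[OF G(2)] linear_cmul[OF D(3)]
         algebra_simps)
qed

lemma adapted_frame_at:
  assumes y: "y \<in> U" and P: "g2_coframe (\<phi> y) e" and f: "dual_frame e f"
  shows "adapted_frame (\<phi> y) e f (ext_d \<phi> y) (\<lambda>a b c. t3 y (f a) (f b) (f c))"
proof
  let ?t = "\<lambda>a b c. t3 y (f a) (f b) (f c)"
  show "g2_coframe (\<phi> y) e" "dual_frame e f" by fact+
  show "is_form 4 (ext_d \<phi> y)" by (rule ext_d_\<phi>_form[OF y])
  show "?t b a c = - ?t a b c" "?t a c b = - ?t a b c" for a b c
    by (rule t3_swap[OF y])+
  fix a b c d :: nat assume abcd: "a \<in> {1..7}" "b \<in> {1..7}" "c \<in> {1..7}" "d \<in> {1..7}"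
  have \<tau>: "\<phi> y [\<tau> y (f a) (f b), f c, f d] = (\<Sum>m=1..7. ?t a b m * phi0 m c d)"
    if "c \<in> {1..7}" "d \<in> {1..7}" for a b c d
  proof -
    have "\<tau> y (f a) (f b) = (\<Sum>m=1..7. ?t a b m *\<^sub>R f m)"
      using orthonormal_expand[OF coframe_metric_linear(1)[OF P] orthonormal_dual_frame[OF f]]
      by (simp add: t3_def g_eq[OF P])
    then have "\<phi> y [\<tau> y (f a) (f b), f c, f d] = (\<Sum>m=1..7. ?t a b m * \<phi> y [f m, f c, f d])"
      by (simp add: linear_sum[OF \<phi>_linear(1)[OF y]] linear_cmul[OF \<phi>_linear(1)[OF y]])
    also have "\<dots> = (\<Sum>m=1..7. ?t a b m * phi0 m c d)"
      by (intro sum.cong refl) (simp add: g2_dual_frame_components[OF P f _ that])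
    finally show ?thesis .
  qed
  show "ext_d \<phi> y [f a, f b, f c, f d] = (\<Sum>m=1..7. ?t a b m * phi0 m c d - ?t a c m * phi0 m b d
        + ?t a d m * phi0 m b c + ?t b c m * phi0 m a d - ?t b d m * phi0 m a c + ?t c d m * phi0 m a b)"
    unfolding ext_d_\<phi>[OF y] using abcd by (simp add: \<tau> sum.distrib sum_subtractf)
qed

lemma dphi_sphi_at:
  assumes y: "y \<in> U" and P: "g2_coframe (\<phi> y) e" and f: "dual_frame e f"
  shows "dphi_sphi \<phi> y = phi_trace (\<lambda>a b c. t3 y (f a) (f b) (f c))"
proof -
  interpret A: adapted_frame "\<phi> y" e f "ext_d \<phi> y" "\<lambda>a b c. t3 y (f a) (f b) (f c)"
    by (rule adapted_frame_at[OF assms])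
  show ?thesis using A.inner_star by (simp add: dphi_sphi_def star_def metric_def)
qed

end

section \<open>Covariant differentiation in a moving adapted frame\<close>

locale g2_chart_frame = g2_chart +
  fixes x :: coord and V :: "coord set" and e :: "coord \<Rightarrow> nat \<Rightarrow> form" and f :: "coord \<Rightarrow> nat \<Rightarrow> coord"
  assumes V: "open V" "x \<in> V" "V \<subseteq> U"
    and e_diff: "\<And>i v. i \<in> {1..7} \<Longrightarrow> (\<lambda>y. e y i [v]) differentiable (at x)"
    and e_coframe: "\<And>y. y \<in> V \<Longrightarrow> g2_coframe (\<phi> y) (e y)"
    and f_dual: "\<And>y. y \<in> V \<Longrightarrow> dual_frame (e y) (f y)"
begin

lemma x: "x \<in> U" using V by blast

lemma f_diff: "j \<in> {1..7} \<Longrightarrow> (\<lambda>y. f y j) differentiable (at x)"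
  by (rule differentiable_dual_frame[OF V(1,2) e_coframe f_dual e_diff])

definition f' where "f' j u = frechet_derivative (\<lambda>y. f y j) (at x) u"
text \<open>The covariant derivative at x of the j-th frame field in direction u.\<close>

definition N where "N u j = f' j u + \<Gamma> x u (f x j)"

lemma f_deriv: "j \<in> {1..7} \<Longrightarrow> ((\<lambda>y. f y j) has_derivative f' j) (at x)"
  using f_diff frechet_derivative_works unfolding f'_def by blast

lemma g_V: "y \<in> V \<Longrightarrow> g y = coframe_metric (e y)"
  by (rule g_eq[OF e_coframe])

lemma orthonormal_f: "y \<in> V \<Longrightarrow> orthonormal (g y) (f y)"
  using orthonormal_dual_frame[OF f_dual] g_V by simp

lemma expand_f:
  assumes "y \<in> V"
  shows "v = (\<Sum>i=1..7. g y v (f y i) *\<^sub>R f y i)"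
  using orthonormal_expand[OF g_linear(1) orthonormal_f] assms V(3) by blast

lemma \<phi>_frame:
  "y \<in> V \<Longrightarrow> a \<in> {1..7} \<Longrightarrow> b \<in> {1..7} \<Longrightarrow> c \<in> {1..7} \<Longrightarrow> \<phi> y [f y a, f y b, f y c] = phi0 a b c"
  by (rule g2_dual_frame_components[OF e_coframe f_dual])

text \<open>The scalar products of the frame fields are constant on V, and g is parallel.\<close>

lemma N_skew:
  assumes "a \<in> {1..7}" "b \<in> {1..7}"
  shows "g x (N u a) (f x b) + g x (f x a) (N u b) = 0"
proof -
  have "((\<lambda>y. g y (f y a) (f y b)) has_derivative
    (\<lambda>u. (g x (\<Gamma> x u (f x a)) (f x b) + g x (f x a) (\<Gamma> x u (f x b))) + g x (f' a u) (f x b)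
      + g x (f x a) (f' b u))) (at x)"
    by (rule has_derivative_bilinear_family[OF U x g_linear g_deriv[OF x] f_deriv[OF assms(1)] f_deriv[OF assms(2)]])
  moreover have "((\<lambda>y. g y (f y a) (f y b)) has_derivative (\<lambda>_. 0)) (at x)"
    by (rule has_derivative_transform_within_open[OF has_derivative_const[of "if a = b then 1 else 0"] V(1,2)])
       (use orthonormal_f assms in \<open>simp add: orthonormal_def\<close>)
  ultimately have "(\<lambda>u. (g x (\<Gamma> x u (f x a)) (f x b) + g x (f x a) (\<Gamma> x u (f x b))) + g x (f' a u) (f x b)
      + g x (f x a) (f' b u)) = (\<lambda>_. 0)" by (rule has_derivative_unique)
  from fun_cong[OF this, of u] show ?thesis
    by (simp add: N_def linear_add[OF g_linear(1)[OF x]] linear_add[OF g_linear(2)[OF x]])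
qed

text \<open>The infinitesimal form of \<open>trace_frame_indep\<close>: in a contraction over an
  orthonormal frame the derivatives of the frame vectors contribute nothing, because their
  coefficient matrix is skew.\<close>

lemma skew_trace:
  fixes B :: "coord \<Rightarrow> coord \<Rightarrow> real"
  assumes B: "\<And>v. linear (\<lambda>u. B u v)" "\<And>u. linear (B u)"
  shows "(\<Sum>a=1..7. B (N u a) (f x a) + B (f x a) (N u a)) = 0"
proof -
  define \<omega> where "\<omega> a b = g x (N u a) (f x b)" for a b
  have N: "N u a = (\<Sum>b=1..7. \<omega> a b *\<^sub>R f x b)" for a
    unfolding \<omega>_def by (rule expand_f[OF V(2)])
  have \<omega>: "\<omega> b a = - \<omega> a b" if "a \<in> {1..7}" "b \<in> {1..7}" for a b
    using N_skew[OF that(2,1), of u] g_sym[OF x, of "f x b" "N u a"] by (simp add: \<omega>_def)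
  have "(\<Sum>a=1..7. B (f x a) (N u a)) = (\<Sum>a=1..7. \<Sum>b=1..7. \<omega> a b * B (f x a) (f x b))"
    by (intro sum.cong refl) (subst N, simp add: linear_sum[OF B(2)] linear_cmul[OF B(2)])
  also have "\<dots> = (\<Sum>b=1..7. \<Sum>a=1..7. \<omega> a b * B (f x a) (f x b))" by (rule sum.swap)
  also have "\<dots> = (\<Sum>b=1..7. \<Sum>a=1..7. - (\<omega> b a * B (f x a) (f x b)))"
    by (intro sum.cong refl) (subst \<omega>, simp_all)
  also have "\<dots> = - (\<Sum>b=1..7. B (N u b) (f x b))"
    unfolding sum_negf
    by (intro arg_cong[where f = uminus] sum.cong refl)
       (subst N, simp add: linear_sum[OF B(1)] linear_cmul[OF B(1)])
  finally show ?thesis by (simp add: sum.distrib)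
qed

definition t where "t y a b c = t3 y (f y a) (f y b) (f y c)"

lemma adapted_frame: "y \<in> V \<Longrightarrow> adapted_frame (\<phi> y) (e y) (f y) (ext_d \<phi> y) (t y)"
  using adapted_frame_at[OF _ e_coframe f_dual] V(3) by (auto simp: t_def[abs_def])

text \<open>The factors are values of \<phi> on the moving frame rather than the numbers
  \<open>phi0\<close>. This admits an arbitrary fixed v, as \<open>nabla_form\<close> needs, and
  makes each factor accessible to \<open>\<phi>_along\<close> or \<open>t3_along\<close>. Both sides
  are linear in v, so the frame vectors suffice.\<close>

lemma lee_form_frame:
  assumes y: "y \<in> V"
  shows "lee_form \<phi> y [v] = (\<Sum>m=1..7. \<Sum>c=1..7. \<Sum>a=1..7. \<Sum>b=1..7.
    \<phi> y [v, f y m, f y c] * (\<phi> y [f y m, f y a, f y b] * t y a b c)) / 6" (is "_ = ?r v")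
proof -
  interpret A: adapted_frame "\<phi> y" "e y" "f y" "ext_d \<phi> y" "t y" by (rule adapted_frame[OF y])
  have yU: "y \<in> U" using y V by blast
  have lee: "lee_form \<phi> y vs = - (1 / 3) * hodge (g2_metric (\<phi> y)) (g2_vol (\<phi> y))
      (wedge 3 (hodge (g2_metric (\<phi> y)) (g2_vol (\<phi> y)) (ext_d \<phi> y)) (\<phi> y)) vs" for vs
    by (simp add: lee_form_def star_def metric_def)
  have "is_form (3 + 3) (wedge 3 (hodge (g2_metric (\<phi> y)) (g2_vol (\<phi> y)) (ext_d \<phi> y)) (\<phi> y))"
    by (intro is_form_wedge is_form_hodge[OF A.P A.w] \<phi>_form[OF yU]) simp
  then have "is_form 1 (lee_form \<phi> y)"
    unfolding lee[abs_def] by (intro is_form_scale is_form_hodge[OF A.P]) auto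
  then have l1: "linear (\<lambda>v. lee_form \<phi> y [v])" by (simp add: is_form_1)
  have l2: "linear ?r"
    unfolding divide_inverse mult.commute[of _ "inverse 6"]
    by (intro linear_real_scale linear_real_sum)
       (use \<phi>_linear(1)[OF yU] in \<open>auto simp: linear_iff algebra_simps\<close>)
  show ?thesis
  proof (rule linear_eq_on_dual_frame[OF f_dual[OF y] e_coframe[OF y] l1 l2])
    fix d :: nat assume d: "d \<in> {1..7}"
    have "lee_form \<phi> y [f y d] = phi_contract (t y) d / 6"
      unfolding lee A.star_wedge_dual[OF d] by simp
    also have "phi_contract (t y) d = (\<Sum>m=1..7. \<Sum>c=1..7. \<Sum>a=1..7. \<Sum>b=1..7.
        \<phi> y [f y d, f y m, f y c] * (\<phi> y [f y m, f y a, f y b] * t y a b c))"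
      unfolding phi_contract_def sum_distrib_left
      by (intro sum.cong refl) (use d in \<open>simp add: \<phi>_frame[OF y]\<close>)
    finally show "lee_form \<phi> y [f y d] = ?r (f y d)" .
  qed
qed

lemma dphi_sphi_frame:
  assumes y: "y \<in> V"
  shows "dphi_sphi \<phi> y = (\<Sum>a=1..7. \<Sum>b=1..7. \<Sum>c=1..7. \<phi> y [f y a, f y b, f y c] * t y a b c)"
proof -
  have "dphi_sphi \<phi> y = phi_trace (t y)"
    using dphi_sphi_at[OF _ e_coframe[OF y] f_dual[OF y]] y V(3) by (auto simp: t_def[abs_def])
  also have "\<dots> = (\<Sum>a=1..7. \<Sum>b=1..7. \<Sum>c=1..7. \<phi> y [f y a, f y b, f y c] * t y a b c)"
    unfolding phi_trace_def by (intro sum.cong refl) (simp add: \<phi>_frame[OF y])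
  finally show ?thesis .
qed

text \<open>All indices except v are contracted over an orthonormal frame, so
  \<open>skew_trace\<close> removes the derivatives of the frame; \<phi> is parallel, and \<nabla>
  falls on the torsion alone.\<close>

lemma nabla_lee:
  "nabla_form \<Gamma> (lee_form \<phi>) x u [v] = (\<Sum>m=1..7. \<Sum>c=1..7. \<Sum>a=1..7. \<Sum>b=1..7.
    \<phi> x [v, f x m, f x c] * (\<phi> x [f x m, f x a, f x b] * nt x u (f x a) (f x b) (f x c))) / 6"
proof -
  define I :: "nat set" where "I = {1..7}"
  let ?p = "\<lambda>m c. \<phi> x [v, f x m, f x c]"
  let ?q = "\<lambda>m a b. \<phi> x [f x m, f x a, f x b]"
  define q' where "q' u m a b = \<phi> x [N u m, f x a, f x b] + \<phi> x [f x m, N u a, f x b] + \<phi> x [f x m, f x a, N u b]"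
    for u m a b
  \<comment> \<open>The 0 is the derivative of the constant argument v, in the shape that
    \<open>\<phi>_along\<close> produces.\<close>
  define p' where "p' u m c = \<phi> x [0 + \<Gamma> x u v, f x m, f x c] + \<phi> x [v, N u m, f x c] + \<phi> x [v, f x m, N u c]"
    for u m c
  define t' where "t' u a b c = nt x u (f x a) (f x b) (f x c) + t3 x (N u a) (f x b) (f x c)
    + t3 x (f x a) (N u b) (f x c) + t3 x (f x a) (f x b) (N u c)" for u a b c
  have q': "((\<lambda>y. \<phi> y [f y m, f y a, f y b]) has_derivative (\<lambda>u. q' u m a b)) (at x)"
    if "m \<in> I" "a \<in> I" "b \<in> I" for m a b
    unfolding q'_def N_def using that unfolding I_def by (intro \<phi>_along[OF x] f_deriv)
  have p': "((\<lambda>y. \<phi> y [v, f y m, f y c]) has_derivative (\<lambda>u. p' u m c)) (at x)"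
    if "m \<in> I" "c \<in> I" for m c
    unfolding p'_def N_def using that unfolding I_def
    by (intro \<phi>_along[OF x] f_deriv has_derivative_const)
  have t': "((\<lambda>y. t y a b c) has_derivative (\<lambda>u. t' u a b c)) (at x)"
    if "a \<in> I" "b \<in> I" "c \<in> I" for a b c
    unfolding t'_def t_def N_def using that unfolding I_def by (intro t3_along[OF x] f_deriv)
  have "((\<lambda>y. (\<Sum>m\<in>I. \<Sum>c\<in>I. \<Sum>a\<in>I. \<Sum>b\<in>I. \<phi> y [v, f y m, f y c] * (\<phi> y [f y m, f y a, f y b] * t y a b c)) / 6)
      has_derivative (\<lambda>u. (\<Sum>m\<in>I. \<Sum>c\<in>I. \<Sum>a\<in>I. \<Sum>b\<in>I. ?p m c * (?q m a b * t' u a b c + q' u m a b * t x a b c)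
        + p' u m c * (?q m a b * t x a b c)) / 6)) (at x)"
    unfolding divide_inverse
    by (intro has_derivative_mult_left has_derivative_sum has_derivative_mult p' q' t')
  then have "((\<lambda>y. lee_form \<phi> y [v])
      has_derivative (\<lambda>u. (\<Sum>m\<in>I. \<Sum>c\<in>I. \<Sum>a\<in>I. \<Sum>b\<in>I. ?p m c * (?q m a b * t' u a b c + q' u m a b * t x a b c)
        + p' u m c * (?q m a b * t x a b c)) / 6)) (at x)"
    by (rule has_derivative_transform_within_open[OF _ V(1,2)]) (simp add: lee_form_frame I_def)
  then have fd: "frechet_derivative (\<lambda>y. lee_form \<phi> y [v]) (at x) u =
      (\<Sum>m\<in>I. \<Sum>c\<in>I. \<Sum>a\<in>I. \<Sum>b\<in>I. ?p m c * (?q m a b * t' u a b c + q' u m a b * t x a b c)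
        + p' u m c * (?q m a b * t x a b c)) / 6"
    by (rule frechet_derivative_eq)
  let ?t = "t3 x" let ?f = "f x" let ?n = "N u" let ?ph = "\<lambda>a b c. \<phi> x [a, b, c]"
  \<comment> \<open>One group for each contracted index: the derivative of that frame vector occurs
    once in each of the two factors carrying the index, which is the pattern of
    \<open>skew_trace\<close>.\<close>
  define Am where "Am m c a b = ?ph v (?n m) (?f c) * (?q m a b * t x a b c)
    + ?p m c * (?ph (?n m) (?f a) (?f b) * t x a b c)" for m c a b
  define Ac where "Ac m c a b = ?ph v (?f m) (?n c) * (?q m a b * t x a b c)
    + ?p m c * (?q m a b * ?t (?f a) (?f b) (?n c))" for m c a b
  define Aa where "Aa m c a b = ?p m c * (?ph (?f m) (?n a) (?f b) * t x a b c)
    + ?p m c * (?q m a b * ?t (?n a) (?f b) (?f c))" for m c a b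
  define Ab where "Ab m c a b = ?p m c * (?ph (?f m) (?f a) (?n b) * t x a b c)
    + ?p m c * (?q m a b * ?t (?f a) (?n b) (?f c))" for m c a b
  note pl = \<phi>_linear[OF x] and tl = t3_linear[OF x]
  have m0: "(\<Sum>m\<in>I. Am m c a b) = 0" for c a b
    unfolding Am_def I_def
    using skew_trace[of "\<lambda>p q. ?ph v p (?f c) * (?ph q (?f a) (?f b) * t x a b c)"] pl
    by (auto simp: linear_iff algebra_simps)
  have c0: "(\<Sum>c\<in>I. Ac m c a b) = 0" for m a b
    unfolding Ac_def I_def
    using skew_trace[of "\<lambda>p q. ?ph v (?f m) p * (?q m a b * ?t (?f a) (?f b) q)"] pl tl
    by (auto simp: linear_iff algebra_simps t_def)
  have a0: "(\<Sum>a\<in>I. Aa m c a b) = 0" for m c b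
    unfolding Aa_def I_def
    using skew_trace[of "\<lambda>p q. ?p m c * (?ph (?f m) p (?f b) * ?t q (?f b) (?f c))"] pl tl
    by (auto simp: linear_iff algebra_simps t_def)
  have b0: "(\<Sum>b\<in>I. Ab m c a b) = 0" for m c a
    unfolding Ab_def I_def
    using skew_trace[of "\<lambda>p q. ?p m c * (?ph (?f m) (?f a) p * ?t (?f a) q (?f c))"] pl tl
    by (auto simp: linear_iff algebra_simps t_def)
  have M: "(\<Sum>m\<in>I. \<Sum>c\<in>I. \<Sum>a\<in>I. \<Sum>b\<in>I. Am m c a b) = 0"
    by (subst sum4_outer) (simp add: m0)
  have C: "(\<Sum>m\<in>I. \<Sum>c\<in>I. \<Sum>a\<in>I. \<Sum>b\<in>I. Ac m c a b) = 0"
    by (subst sum3_outer) (simp add: c0)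
  have A: "(\<Sum>m\<in>I. \<Sum>c\<in>I. \<Sum>a\<in>I. \<Sum>b\<in>I. Aa m c a b) = 0"
    by (subst sum.swap[of _ I I]) (simp add: a0)
  have B: "(\<Sum>m\<in>I. \<Sum>c\<in>I. \<Sum>a\<in>I. \<Sum>b\<in>I. Ab m c a b) = 0"
    by (simp add: b0)
  have "(\<Sum>m\<in>I. \<Sum>c\<in>I. \<Sum>a\<in>I. \<Sum>b\<in>I. ?p m c * (?q m a b * t' u a b c + q' u m a b * t x a b c)
        + p' u m c * (?q m a b * t x a b c)) =
      (\<Sum>m\<in>I. \<Sum>c\<in>I. \<Sum>a\<in>I. \<Sum>b\<in>I. ?p m c * (?q m a b * nt x u (?f a) (?f b) (?f c))
        + ?ph (\<Gamma> x u v) (?f m) (?f c) * (?q m a b * t x a b c)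
        + Am m c a b + Ac m c a b + Aa m c a b + Ab m c a b)"
    by (intro sum.cong refl)
       (simp add: q'_def p'_def t'_def Am_def Ac_def Aa_def Ab_def algebra_simps)
  also have "\<dots> = (\<Sum>m\<in>I. \<Sum>c\<in>I. \<Sum>a\<in>I. \<Sum>b\<in>I. ?p m c * (?q m a b * nt x u (?f a) (?f b) (?f c)))
        + (\<Sum>m\<in>I. \<Sum>c\<in>I. \<Sum>a\<in>I. \<Sum>b\<in>I. ?ph (\<Gamma> x u v) (?f m) (?f c) * (?q m a b * t x a b c))"
    by (simp add: sum.distrib M C A B)
  \<comment> \<open>The second sum is \<open>lee_form\<close> at \<Gamma> x u v up to the factor
    1/6, just what \<open>nabla_form\<close> subtracts from the derivative
    \<open>fd\<close>.\<close>
  finally show ?thesis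
    using fd lee_form_frame[OF V(2), of "\<Gamma> x u v"]
    by (simp add: nabla_form_def One_nat_def I_def add_divide_distrib)
qed

text \<open>As in \<open>nabla_lee\<close>, with every index contracted; for a function no
  Christoffel term has to be subtracted.\<close>

lemma dphi_sphi_deriv:
  "(dphi_sphi \<phi> has_derivative (\<lambda>u. phi_trace (\<lambda>a b c. nt x u (f x a) (f x b) (f x c)))) (at x)"
proof -
  define I :: "nat set" where "I = {1..7}"
  let ?q = "\<lambda>a b c. \<phi> x [f x a, f x b, f x c]"
  define q' where "q' u m a b = \<phi> x [N u m, f x a, f x b] + \<phi> x [f x m, N u a, f x b] + \<phi> x [f x m, f x a, N u b]"
    for u m a b
  define t' where "t' u a b c = nt x u (f x a) (f x b) (f x c) + t3 x (N u a) (f x b) (f x c)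
    + t3 x (f x a) (N u b) (f x c) + t3 x (f x a) (f x b) (N u c)" for u a b c
  have q': "((\<lambda>y. \<phi> y [f y m, f y a, f y b]) has_derivative (\<lambda>u. q' u m a b)) (at x)"
    if "m \<in> I" "a \<in> I" "b \<in> I" for m a b
    unfolding q'_def N_def using that unfolding I_def by (intro \<phi>_along[OF x] f_deriv)
  have t': "((\<lambda>y. t y a b c) has_derivative (\<lambda>u. t' u a b c)) (at x)"
    if "a \<in> I" "b \<in> I" "c \<in> I" for a b c
    unfolding t'_def t_def N_def using that unfolding I_def by (intro t3_along[OF x] f_deriv)
  have "((\<lambda>y. \<Sum>a\<in>I. \<Sum>b\<in>I. \<Sum>c\<in>I. \<phi> y [f y a, f y b, f y c] * t y a b c) has_derivative
      (\<lambda>u. \<Sum>a\<in>I. \<Sum>b\<in>I. \<Sum>c\<in>I. ?q a b c * t' u a b c + q' u a b c * t x a b c)) (at x)"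
    by (intro has_derivative_sum has_derivative_mult q' t')
  then have D: "(dphi_sphi \<phi> has_derivative
      (\<lambda>u. \<Sum>a\<in>I. \<Sum>b\<in>I. \<Sum>c\<in>I. ?q a b c * t' u a b c + q' u a b c * t x a b c)) (at x)"
    by (rule has_derivative_transform_within_open[OF _ V(1,2)]) (simp add: dphi_sphi_frame I_def)
  note pl = \<phi>_linear[OF x] and tl = t3_linear[OF x]
  have "(\<Sum>a\<in>I. \<Sum>b\<in>I. \<Sum>c\<in>I. ?q a b c * t' u a b c + q' u a b c * t x a b c) =
      phi_trace (\<lambda>a b c. nt x u (f x a) (f x b) (f x c))" for u
  proof -
    let ?t = "t3 x" let ?f = "f x" let ?n = "N u" let ?ph = "\<lambda>a b c. \<phi> x [a, b, c]"
    define Aa where "Aa a b c = ?ph (?n a) (?f b) (?f c) * t x a b c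
      + ?q a b c * ?t (?n a) (?f b) (?f c)" for a b c
    define Ab where "Ab a b c = ?ph (?f a) (?n b) (?f c) * t x a b c
      + ?q a b c * ?t (?f a) (?n b) (?f c)" for a b c
    define Ac where "Ac a b c = ?ph (?f a) (?f b) (?n c) * t x a b c
      + ?q a b c * ?t (?f a) (?f b) (?n c)" for a b c
    have a0: "(\<Sum>a\<in>I. Aa a b c) = 0" for b c
      unfolding Aa_def I_def
      using skew_trace[of "\<lambda>p q. ?ph p (?f b) (?f c) * ?t q (?f b) (?f c)"] pl tl
      by (auto simp: linear_iff algebra_simps t_def)
    have b0: "(\<Sum>b\<in>I. Ab a b c) = 0" for a c
      unfolding Ab_def I_def
      using skew_trace[of "\<lambda>p q. ?ph (?f a) p (?f c) * ?t (?f a) q (?f c)"] pl tl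
      by (auto simp: linear_iff algebra_simps t_def)
    have c0: "(\<Sum>c\<in>I. Ac a b c) = 0" for a b
      unfolding Ac_def I_def
      using skew_trace[of "\<lambda>p q. ?ph (?f a) (?f b) p * ?t (?f a) (?f b) q"] pl tl
      by (auto simp: linear_iff algebra_simps t_def)
    have A: "(\<Sum>a\<in>I. \<Sum>b\<in>I. \<Sum>c\<in>I. Aa a b c) = 0"
      by (subst sum3_outer) (simp add: a0)
    have B: "(\<Sum>a\<in>I. \<Sum>b\<in>I. \<Sum>c\<in>I. Ab a b c) = 0"
    proof -
      have "(\<Sum>b\<in>I. \<Sum>c\<in>I. Ab a b c) = (\<Sum>c\<in>I. \<Sum>b\<in>I. Ab a b c)" for a by (rule sum.swap)
      then show ?thesis by (simp add: b0)
    qed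
    have "(\<Sum>a\<in>I. \<Sum>b\<in>I. \<Sum>c\<in>I. ?q a b c * t' u a b c + q' u a b c * t x a b c) =
        (\<Sum>a\<in>I. \<Sum>b\<in>I. \<Sum>c\<in>I. ?q a b c * nt x u (?f a) (?f b) (?f c) + Aa a b c + Ab a b c + Ac a b c)"
      by (intro sum.cong refl) (simp add: q'_def t'_def Aa_def Ab_def Ac_def algebra_simps)
    also have "\<dots> = (\<Sum>a\<in>I. \<Sum>b\<in>I. \<Sum>c\<in>I. ?q a b c * nt x u (?f a) (?f b) (?f c))"
      by (simp add: sum.distrib A B c0)
    also have "\<dots> = phi_trace (\<lambda>a b c. nt x u (f x a) (f x b) (f x c))"
      unfolding phi_trace_def I_def by (intro sum.cong refl) (simp add: \<phi>_frame[OF V(2)])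
    finally show ?thesis .
  qed
  then show ?thesis using D by simp
qed

section \<open>Ricci tensor and torsion differential at a point\<close>

abbreviation dt_frame where "dt_frame u a b c \<equiv> dt x u (f x a) (f x b) (f x c)"
abbreviation nt_frame where "nt_frame u a b c \<equiv> nt x u (f x a) (f x b) (f x c)"

lemma nabla_lee_frame:
  assumes "d \<in> {1..7}"
  shows "nabla_form \<Gamma> (lee_form \<phi>) x u [f x d] = phi_contract (nt_frame u) d / 6"
  unfolding nabla_lee phi_contract_def sum_distrib_left
  by (intro arg_cong[where f = "\<lambda>z. z / 6"] sum.cong refl)
     (use assms in \<open>simp add: \<phi>_frame[OF V(2)]\<close>)

text \<open>For fixed u the components of R(u, f_a) are skew and, by \<open>R_\<phi>\<close>, act as
  a derivation annihilating \<phi>, while \<open>bianchi_last\<close> identifies their cyclic sum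
  with dT / 2 + \<nabla>T. Both parts of \<open>phi_contract_cyclic\<close> therefore apply.\<close>

lemma curvature_contract:
  shows "d \<in> {1..7} \<Longrightarrow> phi_contract (dt_frame u) d / 2 + phi_contract (nt_frame u) d =
      - 6 * (\<Sum>a=1..7. g x (R x u (f x a) (f x a)) (f x d))"
    and "phi_trace (dt_frame u) / 2 + phi_trace (nt_frame u) = 0"
proof -
  define r where "r a b c = g x (R x u (f x a) (f x b)) (f x c)" for a b c
  have skew: "r i b a = - r i a b" for i a b
    unfolding r_def by (rule R_skew_pair(2)[OF x])
  have der: "(\<Sum>z=1..7. r i a z * phi0 z b c + r i b z * phi0 a z c + r i c z * phi0 a b z) = 0"
    if "a \<in> {1..7}" "b \<in> {1..7}" "c \<in> {1..7}" for i a b c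
  proof -
    have ex: "R x u (f x i) (f x a) = (\<Sum>z=1..7. r i a z *\<^sub>R f x z)" for a
      unfolding r_def by (rule expand_f[OF V(2)])
    have "\<phi> x [R x u (f x i) (f x a), f x b, f x c] = (\<Sum>z=1..7. r i a z * phi0 z b c)"
      unfolding ex linear_sum[OF \<phi>_linear(1)[OF x]] linear_cmul[OF \<phi>_linear(1)[OF x]]
      by (intro sum.cong refl) (use that in \<open>simp add: \<phi>_frame[OF V(2)]\<close>)
    moreover have "\<phi> x [f x a, R x u (f x i) (f x b), f x c] = (\<Sum>z=1..7. r i b z * phi0 a z c)"
      unfolding ex linear_sum[OF \<phi>_linear(2)[OF x]] linear_cmul[OF \<phi>_linear(2)[OF x]]
      by (intro sum.cong refl) (use that in \<open>simp add: \<phi>_frame[OF V(2)]\<close>)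
    moreover have "\<phi> x [f x a, f x b, R x u (f x i) (f x c)] = (\<Sum>z=1..7. r i c z * phi0 a b z)"
      unfolding ex linear_sum[OF \<phi>_linear(3)[OF x]] linear_cmul[OF \<phi>_linear(3)[OF x]]
      by (intro sum.cong refl) (use that in \<open>simp add: \<phi>_frame[OF V(2)]\<close>)
    ultimately show ?thesis
      using R_\<phi>[OF x, of u "f x i" "f x a" "f x b" "f x c"] by (simp add: sum.distrib)
  qed
  have cyc: "(\<lambda>a b c. r a b c + r b c a + r c a b) = (\<lambda>a b c. dt_frame u a b c / 2 + nt_frame u a b c)"
    unfolding r_def by (intro ext bianchi_last[OF x])
  note c = phi_contract_cyclic[of r, OF skew der]
  show "d \<in> {1..7} \<Longrightarrow> phi_contract (dt_frame u) d / 2 + phi_contract (nt_frame u) d =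
      - 6 * (\<Sum>a=1..7. g x (R x u (f x a) (f x a)) (f x d))"
    using c(1)[of d] unfolding cyc phi_contract_add by (simp add: r_def)
  show "phi_trace (dt_frame u) / 2 + phi_trace (nt_frame u) = 0"
    using c(2) unfolding cyc phi_trace_add by simp
qed

lemma ricci_eq: "ricci \<phi> \<Gamma> x u v = (\<Sum>a=1..7. g x (R x (f x a) u v) (f x a))"
proof -
  have "orthonormal (g x) (frame (g x))"
    using g2_metric_frame(2)[OF e_coframe[OF V(2)]] by (simp add: g_V[OF V(2)])
  note tr = trace_frame_indep[OF g_linear(1)[OF x] g_sym[OF x] this orthonormal_f[OF V(2)]]
  have "ricci \<phi> \<Gamma> x u v = (\<Sum>i=1..7. g x (R x (frame (g x) i) u v) (frame (g x) i))"
    by (simp add: ricci_def Let_def curvature_eq[OF x])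
  also have "\<dots> = (\<Sum>a=1..7. g x (R x (f x a) u v) (f x a))"
    by (rule tr[of "\<lambda>p q. g x (R x p u v) q"])
       (auto intro: g_linear[OF x] linear_compose[OF R_linear(1)[OF x] g_linear(1)[OF x], unfolded o_def])
  finally show ?thesis .
qed

text \<open>The two skew symmetries turn the Ricci sum into the trace of
  \<open>curvature_contract\<close>; division by -6 there, with the 1/6 of
  \<open>nabla_lee_frame\<close>, gives the coefficients -1 and -1/12.\<close>

lemma ricci_frame:
  assumes d: "d \<in> {1..7}"
  shows "ricci \<phi> \<Gamma> x u (f x d) = - nabla_form \<Gamma> (lee_form \<phi>) x u [f x d] - phi_contract (dt_frame u) d / 12"
proof -
  have "ricci \<phi> \<Gamma> x u (f x d) = (\<Sum>a=1..7. g x (R x u (f x a) (f x a)) (f x d))"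
    unfolding ricci_eq by (intro sum.cong refl) (metis R_skew_pair[OF x] minus_minus)
  then show ?thesis
    using curvature_contract(1)[OF d, of u] nabla_lee_frame[OF d, of u] by simp
qed

lemma dt_frame_zero:
  assumes 0: "\<And>j d. j \<in> {1..7} \<Longrightarrow> d \<in> {1..7} \<Longrightarrow> phi_contract (dt_frame (f x j)) d = 0"
    and vs: "length vs = 4"
  shows "ext_d (torsion \<phi> \<Gamma>) x vs = 0"
proof -
  let ?\<omega> = "ext_d (torsion \<phi> \<Gamma>) x"
  note F = ext_d_torsion_form[OF x]
  define W where "W a b c d = dt_frame (f x a) b c d" for a b c d
  have sk: "W b a c d = - W a b c d" "W a c b d = - W a b c d" "W a b d c = - W a b c d" for a b c d
    unfolding W_def dt_def
    using is_form_swap[OF F, of "[]" "f x a" "f x b" "[f x c, f x d]"]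
      is_form_swap[OF F, of "[f x a]" "f x b" "f x c" "[f x d]"]
      is_form_swap[OF F, of "[f x a, f x b]" "f x c" "f x d" "[]"] by simp_all
  have "\<forall>j\<in>{1..7}. \<forall>d\<in>{1..7}. phi_contract (W j) d = 0"
    unfolding W_def using 0 by blast
  note z = four_form_phi_contract[of W, OF sk this]
  have eq: "?\<omega> [f x a, f x b, f x c, f x d] = W a b c d" for a b c d by (simp add: W_def dt_def)
  \<comment> \<open>A sum of squares over all increasing index sets: expanding it once with
    \<open>subset_sum\<close> brings the 35 vanishing components to an arbitrary set S.\<close>
  have "frame_inner (f x) 4 ?\<omega> ?\<omega> = 0"
    unfolding frame_inner_subset_sum by (simp add: subset_sum_numeral eq z)
  moreover have "finite {S. S \<subseteq> {1..7::nat} \<and> card S = 4}" by simp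
  ultimately have "?\<omega> (map (f x) (sorted_list_of_set S)) = 0" if "S \<subseteq> {1..7}" "card S = 4" for S
    using that unfolding frame_inner_def by (subst (asm) sum_nonneg_eq_0_iff) auto
  then show ?thesis
    by (rule form_eq_0[OF g_linear(1)[OF x] orthonormal_f[OF V(2)] F _ vs])
qed

text \<open>The equivalence holds at each point separately. Both tensors are linear in v, so
  \<open>ricci_frame\<close> decides it on frame vectors; the converse uses
  \<open>dt_frame_zero\<close>.\<close>

lemma ricci_iff:
  "(\<forall>vs. length vs = 4 \<longrightarrow> ext_d (torsion \<phi> \<Gamma>) x vs = 0) \<longleftrightarrow>
    (\<forall>u v. ricci \<phi> \<Gamma> x u v = - nabla_form \<Gamma> (lee_form \<phi>) x u [v])"
proof
  assume "\<forall>vs. length vs = 4 \<longrightarrow> ext_d (torsion \<phi> \<Gamma>) x vs = 0"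
  then have "dt x a b c d = 0" for a b c d by (simp add: dt_def)
  then have eq: "ricci \<phi> \<Gamma> x u (f x d) = - nabla_form \<Gamma> (lee_form \<phi>) x u [f x d]" if "d \<in> {1..7}" for u d
    using ricci_frame[OF that, of u] by (simp add: phi_contract_def)
  show "\<forall>u v. ricci \<phi> \<Gamma> x u v = - nabla_form \<Gamma> (lee_form \<phi>) x u [v]"
  proof (intro allI)
    fix u v
    have "linear (ricci \<phi> \<Gamma> x u)"
      unfolding ricci_eq
      by (intro linear_real_sum linear_compose[OF R_linear(2)[OF x] g_linear(1)[OF x], unfolded o_def])
    moreover have "linear (\<lambda>v. - nabla_form \<Gamma> (lee_form \<phi>) x u [v])"
      unfolding nabla_lee divide_inverse mult.commute[of _ "inverse 6"]
      by (intro linear_compose_neg linear_real_scale linear_real_sum)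
         (use \<phi>_linear(1)[OF x] in \<open>auto simp: linear_iff algebra_simps\<close>)
    ultimately show "ricci \<phi> \<Gamma> x u v = - nabla_form \<Gamma> (lee_form \<phi>) x u [v]"
      by (rule linear_eq_on_dual_frame[OF f_dual[OF V(2)] e_coframe[OF V(2)]]) (rule eq)
  qed
next
  assume "\<forall>u v. ricci \<phi> \<Gamma> x u v = - nabla_form \<Gamma> (lee_form \<phi>) x u [v]"
  then have "phi_contract (dt_frame (f x j)) d = 0" if "d \<in> {1..7}" for j d
    using ricci_frame[OF that, of "f x j"] by simp
  then show "\<forall>vs. length vs = 4 \<longrightarrow> ext_d (torsion \<phi> \<Gamma>) x vs = 0"
    by (intro allI impI dt_frame_zero) auto
qed

lemma dphi_sphi_deriv_closed:
  assumes "\<forall>vs. length vs = 4 \<longrightarrow> ext_d (torsion \<phi> \<Gamma>) x vs = 0"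
  shows "(dphi_sphi \<phi> has_derivative (\<lambda>_. 0)) (at x)"
proof -
  have "dt x a b c d = 0" for a b c d using assms by (simp add: dt_def)
  then have "phi_trace (nt_frame u) = 0" for u
    using curvature_contract(2)[of u] by (simp add: phi_trace_def)
  then show ?thesis using dphi_sphi_deriv by simp
qed

end

context g2_chart
begin

lemma ex_frame:
  assumes "x \<in> U"
  obtains V e f where "g2_chart_frame U \<phi> \<Gamma> x V e f"
proof -
  obtain V e where V: "open V" "x \<in> V" "V \<subseteq> U"
    "\<And>i v y. i \<in> {1..7} \<Longrightarrow> y \<in> V \<Longrightarrow> (\<lambda>z. e z i [v]) differentiable (at y)"
    "\<And>y. y \<in> V \<Longrightarrow> g2_coframe (\<phi> y) (e y)" using coframe[OF assms] by blast
  have "\<forall>y\<in>V. \<exists>f. dual_frame (e y) f" using ex_dual_frame[OF V(5)] by blast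
  \<comment> \<open>The dual frames are chosen point by point; \<open>f_diff\<close> recovers their
    differentiability.\<close>
  then obtain f where "\<And>y. y \<in> V \<Longrightarrow> dual_frame (e y) (f y)" by metis
  then have "g2_chart_frame U \<phi> \<Gamma> x V e f"
    by unfold_locales (use V in auto)
  then show ?thesis by (rule that)
qed

end

section \<open>Change of charts\<close>

lemma wedge_map: "wedge p (\<lambda>vs. \<alpha> (map h vs)) (\<lambda>vs. \<beta> (map h vs)) vs = wedge p \<alpha> \<beta> (map h vs)"
  by (simp add: wedge_def nths_map)

lemma wedge_list_map:
  "wedge_list (map (\<lambda>\<alpha> vs. \<alpha> (map h vs)) \<alpha>s) vs = wedge_list \<alpha>s (map h vs)"
proof (induction \<alpha>s arbitrary: vs)
  case (Cons \<alpha> \<alpha>s)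
  then have "wedge_list (map (\<lambda>\<alpha> vs. \<alpha> (map h vs)) \<alpha>s) = (\<lambda>vs. wedge_list \<alpha>s (map h vs))" by blast
  then show ?case by (simp add: wedge_map)
qed simp

lemma g2_coframe_pullback:
  assumes P: "g2_coframe P e" and h: "linear h" "surj h"
    and Q: "\<And>vs. length vs = 3 \<Longrightarrow> Q vs = P (map h vs)"
  shows "g2_coframe Q (\<lambda>i vs. e i (map h vs))"
  unfolding g2_coframe_def
proof (intro conjI ballI allI impI)
  fix i :: nat assume i: "i \<in> {1..7}"
  have "linear (\<lambda>v. e i [h v])"
    using linear_compose[OF h(1) g2_coframe_linear[OF P i]] by (simp add: o_def)
  then show "is_form 1 (\<lambda>vs. e i (map h vs))" by (simp add: is_form_1)
next
  fix a :: "nat \<Rightarrow> real" and i :: nat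
  assume a: "\<forall>v. (\<Sum>i=1..7. a i * e i (map h [v])) = 0" and i: "i \<in> {1..7}"
  have "(\<Sum>i=1..7. a i * e i [v]) = 0" for v
  proof -
    obtain u where "v = h u" using h(2) by (rule surjE)
    then show ?thesis using a by simp
  qed
  then show "a i = 0" using P i by (simp add: g2_coframe_def)
next
  fix vs :: "coord list" assume vs: "length vs = 3"
  have w: "wedge_list [\<lambda>vs. e i (map h vs), \<lambda>vs. e j (map h vs), \<lambda>vs. e k (map h vs)] vs =
      wedge_list [e i, e j, e k] (map h vs)" for i j k
    using wedge_list_map[of h "[e i, e j, e k]" vs] by simp
  have "\<forall>vs. length vs = 3 \<longrightarrow>
        (let e3 = (\<lambda>i j k. wedge_list [e i, e j, e k] vs) in
         P vs = e3 1 2 7 + e3 1 3 5 - e3 1 4 6 - e3 2 3 6 - e3 2 4 5 + e3 3 4 7 + e3 5 6 7)"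
    using P unfolding g2_coframe_def by blast
  then show "let e3 = (\<lambda>i j k. wedge_list [\<lambda>vs. e i (map h vs), \<lambda>vs. e j (map h vs), \<lambda>vs. e k (map h vs)] vs) in
         Q vs = e3 1 2 7 + e3 1 3 5 - e3 1 4 6 - e3 2 3 6 - e3 2 4 5 + e3 3 4 7 + e3 5 6 7"
    unfolding w Q[OF vs] using vs by (simp add: Let_def del: wedge_list.simps)
qed

text \<open>If \<iota>_v P vanishes, so does the cubic invariant at (v, v), and hence g(v, v). This
  will show that the derivative of a transition map is injective.\<close>

lemma g2_coframe_nondegenerate:
  assumes P: "g2_coframe P e" and v: "\<And>ws. length ws = 2 \<Longrightarrow> P (v # ws) = 0"
  shows "v = 0"
proof -
  obtain f where f: "dual_frame e f" using ex_dual_frame[OF P] by blast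
  have "g2_cubic P v v (map f [1, 2, 3, 4, 5, 6, 7]) = 0"
    unfolding g2_cubic_def by (rule wedge_zero_left) (rule v)
  then have "coframe_metric e v v = 0"
    using g2_cubic_eq[OF P, of "map f [1, 2, 3, 4, 5, 6, 7]" v v] coframe_vol_dual[OF f] by simp
  then have "\<forall>i\<in>{1..7}. e i [v] * e i [v] = 0"
    unfolding coframe_metric_def by (subst (asm) sum_nonneg_eq_0_iff) auto
  then have "e i [v] = 0" if "i \<in> {1..7}" for i using that by simp
  then have "(\<Sum>i=1..7. coframe_metric e v (f i) *\<^sub>R f i) = 0"
    by (intro sum.neutral) (simp add: coframe_metric_dual[OF f])
  then show ?thesis
    using orthonormal_expand[OF coframe_metric_linear(1)[OF P] orthonormal_dual_frame[OF f], of v] by simp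
qed

lemma frechet_derivative_symmetric:
  fixes \<tau> :: "coord \<Rightarrow> coord"
  assumes S: "open S" "x \<in> S" and \<tau>: "smooth_on S \<tau>"
  shows "frechet_derivative (\<lambda>y. frechet_derivative \<tau> (at y) v) (at x) u =
    frechet_derivative (\<lambda>y. frechet_derivative \<tau> (at y) u) (at x) v"
proof (rule euclidean_eqI)
  fix b :: coord
  let ?D = "\<lambda>y. frechet_derivative \<tau> (at y)"
  have d: "((\<lambda>y. \<tau> y \<bullet> b) has_derivative (\<lambda>u. ?D y u \<bullet> b)) (at y)" if "y \<in> S" for y
    using smooth_on_differentiable[OF \<tau> that]
    by (intro has_derivative_inner_left) (simp flip: frechet_derivative_works)
  have dd: "((\<lambda>y. ?D y v \<bullet> b) has_derivative (\<lambda>u. frechet_derivative (\<lambda>y. ?D y v) (at x) u \<bullet> b)) (at x)" for v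
    using smooth_on_differentiable[OF smooth_on_frechet_derivative[OF \<tau>] S(2)]
    by (intro has_derivative_inner_left) (simp flip: frechet_derivative_works)
  show "frechet_derivative (\<lambda>y. ?D y v) (at x) u \<bullet> b = frechet_derivative (\<lambda>y. ?D y u) (at x) v \<bullet> b"
    by (rule second_derivative_symmetric[OF S d dd dd])
qed

text \<open>Instead of transforming \<open>ext_d\<close> and the star, the formula
  \<open>dphi_sphi_at\<close> is compared on both sides: D pulls the adapted coframe back and pushes
  its dual frame forward, and only the tensorial behaviour of the torsion has to be checked.\<close>

lemma dphi_sphi_transform:
  assumes c: "g2_chart U \<phi> \<Gamma>" and c': "g2_chart U' \<phi>' \<Gamma>'"
    and S: "open S" "S \<subseteq> U" "x \<in> S" and \<tau>: "smooth_on S \<tau>" and x': "\<tau> x \<in> U'"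
    and \<phi>: "\<And>vs. length vs = 3 \<Longrightarrow> \<phi> x vs = \<phi>' (\<tau> x) (map (frechet_derivative \<tau> (at x)) vs)"
    and \<Gamma>: "\<And>u v. frechet_derivative \<tau> (at x) (\<Gamma> x u v) =
      frechet_derivative (\<lambda>y. frechet_derivative \<tau> (at y) v) (at x) u +
      \<Gamma>' (\<tau> x) (frechet_derivative \<tau> (at x) u) (frechet_derivative \<tau> (at x) v)"
  shows "dphi_sphi \<phi> x = dphi_sphi \<phi>' (\<tau> x)"
proof -
  interpret c: g2_chart U \<phi> \<Gamma> by (rule c)
  interpret c': g2_chart U' \<phi>' \<Gamma>' by (rule c')
  define D where "D = frechet_derivative \<tau> (at x)"
  have xU: "x \<in> U" using S by blast
  have D: "linear D"
    unfolding D_def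
    by (rule has_derivative_linear[OF iffD1[OF frechet_derivative_works smooth_on_differentiable[OF \<tau> S(3)]]])
  have "inj D"
  proof (rule linear_injective_0[OF D, THEN iffD2], intro allI impI)
    fix v assume v: "D v = 0"
    obtain e where e: "g2_coframe (\<phi> x) e" using c.ex_coframe[OF xU] by blast
    have "\<phi> x (v # ws) = 0" if "length ws = 2" for ws
    proof -
      have "linear (\<lambda>v. \<phi>' (\<tau> x) (v # map D ws))"
        using is_form_linear_hd[of 2 "\<phi>' (\<tau> x)"] c'.\<phi>_form[OF x'] that by simp
      from linear_0[OF this] show ?thesis using \<phi>[of "v # ws"] that v by (simp add: D_def)
    qed
    then show "v = 0" by (rule g2_coframe_nondegenerate[OF e])
  qed
  then have surj: "surj D" using D by (simp add: linear_injective_imp_surjective)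
  obtain e' where e': "g2_coframe (\<phi>' (\<tau> x)) e'" using c'.ex_coframe[OF x'] by blast
  define e where "e i vs = e' i (map D vs)" for i vs
  have e: "g2_coframe (\<phi> x) e"
    using g2_coframe_pullback[OF e' D surj] \<phi> unfolding e_def[abs_def] D_def by blast
  obtain f where f: "dual_frame e f" using ex_dual_frame[OF e] by blast
  then have f': "dual_frame e' (\<lambda>i. D (f i))" by (simp add: dual_frame_def e_def)
  have g: "c.g x u v = c'.g (\<tau> x) (D u) (D v)" for u v
    by (simp add: c.g_eq[OF e] c'.g_eq[OF e'] coframe_metric_def e_def)
  \<comment> \<open>The inhomogeneous term in the law for \<Gamma> is a second derivative of \<tau>,
    symmetric in u and v, and drops out of the difference.\<close>
  have \<tau>\<tau>: "D (c.\<tau> x u v) = c'.\<tau> (\<tau> x) (D u) (D v)" for u v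
    using \<Gamma>[of u v] \<Gamma>[of v u] frechet_derivative_symmetric[OF S(1,3) \<tau>, of u v]
    by (simp add: c.\<tau>_def c'.\<tau>_def linear_diff[OF D] flip: D_def)
  have "c.t3 x u v w = c'.t3 (\<tau> x) (D u) (D v) (D w)" for u v w
    by (simp add: c.t3_def c'.t3_def g \<tau>\<tau>)
  then show ?thesis
    by (simp add: c.dphi_sphi_at[OF xU e f] c'.dphi_sphi_at[OF x' e' f'])
qed

section \<open>From charts to the manifold\<close>

locale char_g2_manifold =
  fixes A :: "'a::{t2_space,second_countable_topology} chart set"
    and \<phi> :: "'a chart \<Rightarrow> form_field" and \<Gamma> :: "'a chart \<Rightarrow> christoffel"
  assumes M: "smooth_manifold A" and \<phi>: "g2_structure A \<phi>"
    and \<Gamma>: "characteristic_connection A \<phi> \<Gamma>"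
begin

lemma chart:
  assumes "c \<in> A"
  shows "open (fst c)" "open (chart_image c)" "continuous_on (fst c) (snd c)" "inj_on (snd c) (fst c)"
    and "c' \<in> A \<Longrightarrow> open (overlap c c')"
proof -
  show o: "open (fst c)" "open (chart_image c)" using M assms by (auto simp: smooth_manifold_def)
  obtain h where h: "homeomorphism (fst c) (chart_image c) (snd c) h"
    using M assms by (auto simp: smooth_manifold_def)
  show "continuous_on (fst c) (snd c)" using h by (rule homeomorphism_cont1)
  show inj: "inj_on (snd c) (fst c)"
    by (rule inj_on_inverseI[of _ h]) (rule homeomorphism_apply1[OF h])
  show "open (overlap c c')" if "c' \<in> A"
  proof -
    have "open (fst c')" using M that by (auto simp: smooth_manifold_def)
    then have "open (chart_image c \<inter> h -` fst c')"
      by (rule continuous_open_preimage[OF homeomorphism_cont2[OF h] o(2)])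
    moreover have "overlap c c' = chart_image c \<inter> h -` fst c'"
      using homeomorphism_apply1[OF h] by (auto simp: overlap_def chart_image_def)
    ultimately show ?thesis by simp
  qed
qed

lemma g2_chart:
  assumes c: "c \<in> A"
  shows "g2_chart (chart_image c) (\<phi> c) (\<Gamma> c)"
proof
  note df = \<phi>[unfolded g2_structure_def differential_form_def]
  note cc = \<Gamma>[unfolded characteristic_connection_def affine_connection_def]
  show "open (chart_image c)" by (rule chart(2)[OF c])
  fix x assume x: "x \<in> chart_image c"
  show "bilinear (\<Gamma> c x)" using cc c x by blast
  show "(\<lambda>y. \<Gamma> c y u v) differentiable (at x)" for u v
    using cc c by (intro smooth_on_differentiable[OF _ x]) blast
  show "is_form 3 (\<phi> c x)" using df c x by blast
  show "(\<lambda>y. \<phi> c y vs) differentiable (at x)" if "length vs = 3" for vs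
    using df c that by (intro smooth_on_differentiable[OF _ x]) blast
  show "nabla_form (\<Gamma> c) (\<lambda>y vs. metric (\<phi> c) y (vs ! 0) (vs ! 1)) x u [v, w] = 0" for u v w
    using cc c x by blast
  show "nabla_form (\<Gamma> c) (\<phi> c) x u vs = 0" if "length vs = 3" for u vs
    using cc c x that by blast
  show "is_form 3 (torsion (\<phi> c) (\<Gamma> c) x)" using cc c x by blast
  obtain V e where V: "open V" "x \<in> V" "V \<subseteq> chart_image c"
    "\<forall>i\<in>{1..7}. \<forall>v. smooth_on V (\<lambda>y. e y i [v])" "\<forall>y\<in>V. g2_coframe (\<phi> c y) (e y)"
    using \<phi> c x unfolding g2_structure_def by blast
  show "\<exists>V e. open V \<and> x \<in> V \<and> V \<subseteq> chart_image c \<and>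
      (\<forall>i\<in>{1..7}. \<forall>v. \<forall>y\<in>V. (\<lambda>z. e z i [v]) differentiable (at y)) \<and>
      (\<forall>y\<in>V. g2_coframe (\<phi> c y) (e y))"
    using V smooth_on_differentiable by (intro exI[of _ V] exI[of _ e]) blast
qed

lemma ricci_iff:
  "closed_torsion A \<phi> \<Gamma> \<longleftrightarrow> (\<forall>c\<in>A. \<forall>x\<in>chart_image c. \<forall>u v.
     ricci (\<phi> c) (\<Gamma> c) x u v = - nabla_form (\<Gamma> c) (lee_form (\<phi> c)) x u [v])"
proof -
  have "(\<forall>vs. length vs = 4 \<longrightarrow> ext_d (torsion (\<phi> c) (\<Gamma> c)) x vs = 0) \<longleftrightarrow>
      (\<forall>u v. ricci (\<phi> c) (\<Gamma> c) x u v = - nabla_form (\<Gamma> c) (lee_form (\<phi> c)) x u [v])"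
    if c: "c \<in> A" and x: "x \<in> chart_image c" for c x
  proof -
    obtain V e f where F: "g2_chart_frame (chart_image c) (\<phi> c) (\<Gamma> c) x V e f"
      using g2_chart.ex_frame[OF g2_chart[OF c] x] by metis
    show ?thesis by (rule g2_chart_frame.ricci_iff[OF F])
  qed
  then show ?thesis unfolding closed_torsion_def vanishes_def by blast
qed

lemma dphi_sphi_deriv:
  assumes "closed_torsion A \<phi> \<Gamma>" "c \<in> A" "x \<in> chart_image c"
  shows "(dphi_sphi (\<phi> c) has_derivative (\<lambda>_. 0)) (at x)"
proof -
  have "\<forall>vs. length vs = 4 \<longrightarrow> ext_d (torsion (\<phi> c) (\<Gamma> c)) x vs = 0"
    using assms unfolding closed_torsion_def vanishes_def by blast
  moreover obtain V e f where F: "g2_chart_frame (chart_image c) (\<phi> c) (\<Gamma> c) x V e f"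
    using g2_chart.ex_frame[OF g2_chart[OF assms(2)] assms(3)] by metis
  ultimately show ?thesis by (intro g2_chart_frame.dphi_sphi_deriv_closed[OF F])
qed

lemma dphi_sphi_chart_indep:
  assumes "c \<in> A" "c' \<in> A" "p \<in> fst c" "p \<in> fst c'"
  shows "dphi_sphi (\<phi> c) (snd c p) = dphi_sphi (\<phi> c') (snd c' p)"
proof -
  have \<tau>: "transition c c' (snd c p) = snd c' p"
    using chart(4)[OF assms(1)] assms(3) by (simp add: transition_def)
  have x: "snd c p \<in> overlap c c'" using assms by (auto simp: overlap_def)
  have "dphi_sphi (\<phi> c) (snd c p) = dphi_sphi (\<phi> c') (transition c c' (snd c p))"
  proof (rule dphi_sphi_transform[OF g2_chart[OF assms(1)] g2_chart[OF assms(2)]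
        chart(5)[OF assms(1,2)] _ x])
    show "overlap c c' \<subseteq> chart_image c" by (auto simp: overlap_def chart_image_def)
    show "smooth_on (overlap c c') (transition c c')"
      using M assms by (simp add: smooth_manifold_def)
    show "transition c c' (snd c p) \<in> chart_image c'"
      using assms(4) by (simp add: \<tau> chart_image_def)
    show "\<phi> c (snd c p) vs = \<phi> c' (transition c c' (snd c p))
        (map (frechet_derivative (transition c c') (at (snd c p))) vs)" if "length vs = 3" for vs
      using \<phi> assms(1,2) x that unfolding g2_structure_def differential_form_def by blast
    show "frechet_derivative (transition c c') (at (snd c p)) (\<Gamma> c (snd c p) u v) =
      frechet_derivative (\<lambda>y. frechet_derivative (transition c c') (at y) v) (at (snd c p)) u +
      \<Gamma> c' (transition c c' (snd c p)) (frechet_derivative (transition c c') (at (snd c p)) u)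
        (frechet_derivative (transition c c') (at (snd c p)) v)" for u v
      using \<Gamma> assms(1,2) x unfolding characteristic_connection_def affine_connection_def Let_def by blast
  qed
  then show ?thesis by (simp add: \<tau>)
qed

lemma constant_type:
  assumes closed: "closed_torsion A \<phi> \<Gamma>"
  shows "constant_type A \<phi>"
proof -
  \<comment> \<open>The chart at each point is arbitrary; \<open>dphi_sphi_chart_indep\<close> makes
    F a well-defined function on the manifold. It is locally constant on coordinate balls, hence
    constant by connectedness.\<close>
  define C where "C p = (SOME c. c \<in> A \<and> p \<in> fst c)" for p
  have C: "C p \<in> A \<and> p \<in> fst (C p)" for p
  proof -
    have "(\<Union>c\<in>A. fst c) = UNIV" using M by (simp add: smooth_manifold_def)
    then have "\<exists>c. c \<in> A \<and> p \<in> fst c" by blast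
    then show ?thesis unfolding C_def by (rule someI_ex)
  qed
  define F where "F p = dphi_sphi (\<phi> (C p)) (snd (C p) p)" for p
  have F: "F p = dphi_sphi (\<phi> c) (snd c p)" if "c \<in> A" "p \<in> fst c" for c p
    unfolding F_def using C that by (intro dphi_sphi_chart_indep) auto
  have "eventually (\<lambda>q. F p = F q) (at p within UNIV)" for p
  proof -
    define c where "c = C p"
    have c: "c \<in> A" "p \<in> fst c" using C by (auto simp: c_def)
    obtain r where r: "r > 0" "ball (snd c p) r \<subseteq> chart_image c"
      using chart(2)[OF c(1)] c(2) open_contains_ball by (metis chart_image_def image_eqI)
    have "\<exists>k. \<forall>y\<in>ball (snd c p) r. dphi_sphi (\<phi> c) y = k"
    proof (rule has_derivative_zero_constant[OF convex_ball])
      fix y assume "y \<in> ball (snd c p) r"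
      with r(2) have "y \<in> chart_image c" by blast
      then show "(dphi_sphi (\<phi> c) has_derivative (\<lambda>h. 0)) (at y within ball (snd c p) r)"
        by (rule has_derivative_at_withinI[OF dphi_sphi_deriv[OF closed c(1)]])
    qed
    then obtain k where k: "\<forall>y\<in>ball (snd c p) r. dphi_sphi (\<phi> c) y = k" by (rule exE)
    have const: "dphi_sphi (\<phi> c) y = dphi_sphi (\<phi> c) (snd c p)" if "y \<in> ball (snd c p) r" for y
      using bspec[OF k that] bspec[OF k, of "snd c p"] r(1) by simp
    define W where "W = fst c \<inter> snd c -` ball (snd c p) r"
    have "open W"
      unfolding W_def by (rule continuous_open_preimage[OF chart(3,1)[OF c(1)]]) simp
    moreover have "p \<in> W" using c r by (simp add: W_def)
    moreover have "F p = F q" if "q \<in> W" for q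
      using that F[OF c(1)] c(2) const by (simp add: W_def)
    ultimately show ?thesis unfolding eventually_at_topological by blast
  qed
  then have const: "F p = F q" for p q
    using connected_local_const[of UNIV p q F] M by (simp add: smooth_manifold_def)
  show ?thesis
    unfolding constant_type_def
  \<comment> \<open>F takes the same value everywhere; \<open>undefined\<close> merely names some
    point at which to read it off.\<close>
  proof (intro exI[of _ "F undefined"] ballI)
    fix c x assume c: "c \<in> A" "x \<in> chart_image c"
    then obtain p where "p \<in> fst c" "x = snd c p" by (auto simp: chart_image_def)
    then show "dphi_sphi (\<phi> c) x = F undefined" using F[OF c(1)] const by metis
  qed
qed

lemma lam_closed:
  assumes closed: "closed_torsion A \<phi> \<Gamma>"
  shows "vanishes A 1 (\<lambda>c. ext_d (lam (\<phi> c)))"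
  unfolding vanishes_def
proof (intro ballI allI impI)
  fix c x and vs :: "coord list" assume c: "c \<in> A" "x \<in> chart_image c" and "length vs = 1"
  then obtain v where vs: "vs = [v]" by (auto simp: One_nat_def length_Suc_conv)
  have "((\<lambda>y. dphi_sphi (\<phi> c) y / 6) has_derivative (\<lambda>_. 0 / 6)) (at x)"
    unfolding divide_inverse by (intro has_derivative_mult_left dphi_sphi_deriv[OF closed c])
  from frechet_derivative_eq[OF this] show "ext_d (lam (\<phi> c)) x vs = 0"
    by (simp add: ext_d_alternate vs alternate_Cons lam_def)
qed

end

theorem theorem7p1:
  fixes A :: "'a::{t2_space,second_countable_topology} chart set"
    and \<phi> :: "'a chart \<Rightarrow> form_field"
    and \<Gamma> :: "'a chart \<Rightarrow> christoffel"
  assumes "smooth_manifold A"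
    and "integrable_g2 A \<phi>"
    and "characteristic_connection A \<phi> \<Gamma>"
  shows "(closed_torsion A \<phi> \<Gamma> \<longleftrightarrow>
            (\<forall>c\<in>A. \<forall>x\<in>chart_image c. \<forall>u v.
               ricci (\<phi> c) (\<Gamma> c) x u v = - nabla_form (\<Gamma> c) (lee_form (\<phi> c)) x u [v])) \<and>
         (closed_torsion A \<phi> \<Gamma> \<longrightarrow>
            constant_type A \<phi> \<and> vanishes A 1 (\<lambda>c. ext_d (lam (\<phi> c))))"
proof -
  interpret char_g2_manifold A \<phi> \<Gamma>
    by unfold_locales (use assms in \<open>auto simp: integrable_g2_def\<close>)
  show ?thesis using ricci_iff constant_type lam_closed by blast
qed

end
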